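(* Let $k\ge1$. (i) Let $A$ be a formal manifold. Then $A$ carries a unique i-structure $A_k$ with the following universal property: for every space $M$ equipped with an i-structure, a map $f:A\to M$ is an i-morphism $A_k\to M$ if and only if for every chart $\iota:U\hookrightarrow A$ of $A$ the restriction $f\circ\iota$ is an i-morphism $U_k\to M$. (ii) Every map between formal manifolds is an i-morphism for the respective $k$th-order i-structures (those of part (i)).
   Context: Setting: naive axiomatic Synthetic Differential Geometry, i.e. one argues intuitionistically (in the internal logic of a topos); "space" means a set/object of this universe and "map" an arbitrary map. $R$ is a commutative ring which is a $\mathbb{Q}$-algebra. For $k,n\ge 1$ let $D_k(n)=\{(d_1,\dots,d_n)\in R^n \mid \text{any product of } k+1 \text{ of the } d_j \text{ (repetitions allowed) vanishes}\}$. $R$ is assumed to satisfy the Kock–Lawvere axiom for all $D_k(n)$, $k,n\ge1$: every map $t:D_k(n)\to R$ is given by a uniquely determined polynomial in $R[X_1,\dots,X_n]$ of total degree $\le k$. A subspace (injective map) $U\hookrightarrow X$ is formally open if it is stable under infinitesimal perturbations: for all $k,m\ge1$ every map $t:D_k(m)\to X$ with $t(0)\in U$ takes all its values in $U$ (for $X=R^n$: $P\in U$ and $d\in D_k(n)$ imply $P+d\in U$). A chart of a space $A$ is a formally open subspace $\iota:U\hookrightarrow A$ that is also a formally open subspace $\varphi:U\hookrightarrow R^n$. A formal manifold (of dimension $n$) is a space $A$ that is covered by (i.e. is the union of) its charts into $R^n$. An i-structure on a space $A$ is a family of subsets $A\langle p\rangle\subseteq A^p$ ($p\in\mathbb{N}$)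 such that (1) $A\langle 1\rangle=A$, $A\langle 0\rangle=A^0=1$; (2) for every map $h:\{1,\dots,m\}\to\{1,\dots,p\}$ and every $(P_1,\dots,P_p)\in A\langle p\rangle$ one has $(P_{h(1)},\dots,P_{h(m)})\in A\langle m\rangle$. A map $f:A\to X$ between spaces with i-structures is an i-morphism if $f^p(A\langle p\rangle)\subseteq X\langle p\rangle$ for all $p$. For $V=R^n$ put $\mathrm{DN}_k(V)=\{(v_1,\dots,v_{k+1})\in D_k(n)^{k+1}\mid \phi(v_1,\dots,v_{k+1})=0 \text{ for every } (k+1)\text{-linear map } \phi:V^{k+1}\to R\}$. The $k$th-order i-structure on $R^n$ is: $(R^n)_k\langle 1\rangle=R^n$, $(R^n)_k\langle 0\rangle=1$, and for $p\ge 2$, $(R^n)_k\langle p\rangle=\{(P_1,\dots,P_p)\mid (P_{i_1}-P_{j_1},\dots,P_{i_{k+1}}-P_{j_{k+1}})\in \mathrm{DN}_k(V) \text{ for all } i_\ell,j_\ell\in\{1,\dots,p\},\ i_\ell\ne j_\ell,\ 1\le \ell\le k+1\}$. For a formally open subspace $\varphi:U\hookrightarrow R^n$ (in particular for the domain of a chart), $U_k$ is the pullback of this i-structure along $\varphi$: $(P_1,\dots,P_p)\in U_k\langle p\rangle$ iff $(\varphi(P_1),\dots,\varphi(P_p))\in(R^n)_k\langle p\rangle$. *)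

theory Defs
  imports "HOL-Algebra.Ring" "HOL-Algebra.FiniteProduct" "HOL-Algebra.RingHom" "HOL.Rat"
begin

text \<open>
  The Kock--Lawvere axiom contradicts classical logic (it forces R to be the zero ring), so
  naive synthetic differential geometry cannot be rendered by HOL types and HOL functions. It is
  interpreted here in an arbitrary elementary topos: a space is an object of the topos, and every
  intuitionistic assertion about spaces is spelled out by its Kripke--Joyal semantics.

  \<^item> An element of a space X at stage I is an arrow from I to X. It is restricted to a
    later stage along u : J \<rightarrow> I by composing with u.
  \<^item> A map from X to Y at stage I is an arrow from I \<times> X to Y. A subset of X at stage I is
    an arrow from I to the power object of X.
  \<^item> Universal quantifiers and implications range over all later stages u : J \<rightarrow> I, while an
    existential quantifier is witnessed after passing to an epimorphism e : J \<rightarrow> I. Unique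
    existence needs no such passage.
  \<^item> A space at stage I is an object U with an arrow q : U \<rightarrow> I (an object of the slice over I).
    Its elements at u : J \<rightarrow> I are the y : J \<rightarrow> U with q y = u.
  \<^item> Orders, dimensions and arities are natural numbers of the metatheory.
\<close>

section \<open>Elementary toposes\<close>

record ('o, 'm) topos =
  src :: "'m \<Rightarrow> 'o"
  tgt :: "'m \<Rightarrow> 'o"
  ident :: "'o \<Rightarrow> 'm"
  cmp :: "'m \<Rightarrow> 'm \<Rightarrow> 'm"  (infixr "\<odot>\<index>" 75)
  tmn :: "'o"
  prd :: "'o \<Rightarrow> 'o \<Rightarrow> 'o"
  prj1 :: "'o \<Rightarrow> 'o \<Rightarrow> 'm"
  prj2 :: "'o \<Rightarrow> 'o \<Rightarrow> 'm"
  eqz :: "'m \<Rightarrow> 'm \<Rightarrow> 'm"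
  pwr :: "'o \<Rightarrow> 'o"
  elt :: "'o \<Rightarrow> 'm"

locale topos_ops =
  fixes E :: "('o, 'm, 'z) topos_scheme" (structure)
begin

definition hom :: "'o \<Rightarrow> 'o \<Rightarrow> 'm set" where
  "hom X Y = {f. src E f = X \<and> tgt E f = Y}"

definition monic :: "'m \<Rightarrow> bool" where
  "monic m \<longleftrightarrow> (\<forall>I. \<forall>f\<in>hom I (src E m). \<forall>g\<in>hom I (src E m). m \<odot> f = m \<odot> g \<longrightarrow> f = g)"

definition epic :: "'m \<Rightarrow> bool" where
  "epic e \<longleftrightarrow> (\<forall>X. \<forall>f\<in>hom (tgt E e) X. \<forall>g\<in>hom (tgt E e) X. f \<odot> e = g \<odot> e \<longrightarrow> f = g)"

definition bang :: "'o \<Rightarrow> 'm" where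
  "bang I = (THE f. f \<in> hom I (tmn E))"

definition pair :: "'m \<Rightarrow> 'm \<Rightarrow> 'm"  ("\<langle>_, _\<rangle>") where
  "\<langle>f, g\<rangle> = (THE h. h \<in> hom (src E f) (prd E (tgt E f) (tgt E g)) \<and>
      prj1 E (tgt E f) (tgt E g) \<odot> h = f \<and> prj2 E (tgt E f) (tgt E g) \<odot> h = g)"

definition is_pullback :: "'m \<Rightarrow> 'm \<Rightarrow> 'm \<Rightarrow> 'm \<Rightarrow> bool" where
  "is_pullback p q f g \<longleftrightarrow>
     src E p = src E q \<and> tgt E p = src E f \<and> tgt E q = src E g \<and> tgt E f = tgt E g \<and>
     f \<odot> p = g \<odot> q \<and>
     (\<forall>I. \<forall>a\<in>hom I (src E f). \<forall>b\<in>hom I (src E g). f \<odot> a = g \<odot> b \<longrightarrow>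
        (\<exists>!h. h \<in> hom I (src E p) \<and> p \<odot> h = a \<and> q \<odot> h = b))"

end

locale elementary_topos = topos_ops E for E :: "('o, 'm, 'z) topos_scheme" (structure) +
  assumes ident_hom: "ident E X \<in> hom X X"
    and cmp_hom: "\<lbrakk>f \<in> hom X Y; g \<in> hom Y Z\<rbrakk> \<Longrightarrow> g \<odot> f \<in> hom X Z"
    and ident_left: "f \<in> hom X Y \<Longrightarrow> ident E Y \<odot> f = f"
    and ident_right: "f \<in> hom X Y \<Longrightarrow> f \<odot> ident E X = f"
    and cmp_assoc: "\<lbrakk>f \<in> hom W X; g \<in> hom X Y; h \<in> hom Y Z\<rbrakk> \<Longrightarrow> (h \<odot> g) \<odot> f = h \<odot> (g \<odot> f)"
    and terminal: "\<exists>!f. f \<in> hom I (tmn E)"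
    and prj1_hom: "prj1 E X Y \<in> hom (prd E X Y) X"
    and prj2_hom: "prj2 E X Y \<in> hom (prd E X Y) Y"
    and product: "\<lbrakk>f \<in> hom I X; g \<in> hom I Y\<rbrakk> \<Longrightarrow>
      \<exists>!h. h \<in> hom I (prd E X Y) \<and> prj1 E X Y \<odot> h = f \<and> prj2 E X Y \<odot> h = g"
    and eqz_tgt: "\<lbrakk>f \<in> hom X Y; g \<in> hom X Y\<rbrakk> \<Longrightarrow> tgt E (eqz E f g) = X"
    and eqz_eq: "\<lbrakk>f \<in> hom X Y; g \<in> hom X Y\<rbrakk> \<Longrightarrow> f \<odot> eqz E f g = g \<odot> eqz E f g"
    and equalizer: "\<lbrakk>f \<in> hom X Y; g \<in> hom X Y; h \<in> hom I X; f \<odot> h = g \<odot> h\<rbrakk> \<Longrightarrow>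
      \<exists>!h'. h' \<in> hom I (src E (eqz E f g)) \<and> eqz E f g \<odot> h' = h"
    and elt_tgt: "tgt E (elt E X) = prd E X (pwr E X)"
    and elt_monic: "monic (elt E X)"
    and power_object: "\<lbrakk>monic m; tgt E m = prd E X I\<rbrakk> \<Longrightarrow>
      \<exists>!c. c \<in> hom I (pwr E X) \<and>
        (\<exists>t. is_pullback m t \<langle>prj1 E X I, c \<odot> prj2 E X I\<rangle> (elt E X))"

context topos_ops
begin

definition lies_in :: "'m \<Rightarrow> 'm \<Rightarrow> bool" where
  "lies_in x i \<longleftrightarrow> (\<exists>y\<in>hom (src E x) (src E i). i \<odot> y = x)"

definition member :: "'o \<Rightarrow> 'm \<Rightarrow> 'm \<Rightarrow> bool" where
  "member X x s \<longleftrightarrow> lies_in \<langle>x, s\<rangle> (elt E X)"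

primrec pw :: "'o \<Rightarrow> nat \<Rightarrow> 'o" where
  "pw X 0 = tmn E"
| "pw X (Suc n) = prd E X (pw X n)"

text \<open>\<open>coord X n j x\<close> is the component, counted from 0, of \<open>x\<close> in the \<open>n\<close>-th power of X.\<close>

fun coord :: "'o \<Rightarrow> nat \<Rightarrow> nat \<Rightarrow> 'm \<Rightarrow> 'm" where
  "coord X 0 j x = undefined"
| "coord X (Suc n) 0 x = prj1 E X (pw X n) \<odot> x"
| "coord X (Suc n) (Suc j) x = coord X n j (prj2 E X (pw X n) \<odot> x)"

primrec tup :: "'o \<Rightarrow> 'm list \<Rightarrow> 'm" where
  "tup I [] = bang I"
| "tup I (x # xs) = \<langle>x, tup I xs\<rangle>"

definition tuples :: "'o \<Rightarrow> 'o \<Rightarrow> nat \<Rightarrow> 'm list set" where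
  "tuples I X p = {xs. length xs = p \<and> set xs \<subseteq> hom I X}"

end

section \<open>The line and its infinitesimals\<close>

record ('o, 'm) sdg = "('o, 'm) topos" +
  line :: "'o"
  rzero :: "'m"
  rone :: "'m"
  radd :: "'m"
  rmul :: "'m"

definition rat_ring :: "rat ring" where
  "rat_ring = \<lparr>carrier = UNIV, mult = (*), one = 1, zero = 0, add = (+)\<rparr>"

locale sdg_ops = topos_ops E for E :: "('o, 'm, 'z) sdg_scheme" (structure)
begin

definition stage_ring :: "'o \<Rightarrow> 'm ring"  ("\<R>") where
  "\<R> I = \<lparr>carrier = hom I (line E),
          mult = (\<lambda>x y. rmul E \<odot> \<langle>x, y\<rangle>), one = rone E \<odot> bang I,
          zero = rzero E \<odot> bang I, add = (\<lambda>x y. radd E \<odot> \<langle>x, y\<rangle>)\<rparr>"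

abbreviation Rn :: "nat \<Rightarrow> 'o" where
  "Rn n \<equiv> pw (line E) n"

abbreviation rc :: "nat \<Rightarrow> nat \<Rightarrow> 'm \<Rightarrow> 'm" where
  "rc n j x \<equiv> coord (line E) n j x"

definition vzero :: "nat \<Rightarrow> 'o \<Rightarrow> 'm" where
  "vzero n I = tup I (map (\<lambda>j. \<zero>\<^bsub>\<R> I\<^esub>) [0..<n])"

definition vadd :: "nat \<Rightarrow> 'o \<Rightarrow> 'm \<Rightarrow> 'm \<Rightarrow> 'm" where
  "vadd n I x y = tup I (map (\<lambda>j. rc n j x \<oplus>\<^bsub>\<R> I\<^esub> rc n j y) [0..<n])"

definition vdiff :: "nat \<Rightarrow> 'o \<Rightarrow> 'm \<Rightarrow> 'm \<Rightarrow> 'm" where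
  "vdiff n I x y = tup I (map (\<lambda>j. rc n j x \<ominus>\<^bsub>\<R> I\<^esub> rc n j y) [0..<n])"

definition vscale :: "nat \<Rightarrow> 'o \<Rightarrow> 'm \<Rightarrow> 'm \<Rightarrow> 'm" where
  "vscale n I a x = tup I (map (\<lambda>j. a \<otimes>\<^bsub>\<R> I\<^esub> rc n j x) [0..<n])"

text \<open>
  The inclusion of \<open>D\<^sub>k(n)\<close> into \<open>R\<^sup>n\<close>, as the equalizer with 0 of the map that sends a vector to
  the tuple of all products of \<open>k + 1\<close> of its components. The generic vector is the identity of
  \<open>R\<^sup>n\<close>, and \<open>List.n_lists\<close> enumerates the choices of \<open>k + 1\<close> indices with repetitions.
\<close>

definition Dinc :: "nat \<Rightarrow> nat \<Rightarrow> 'm" where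
  "Dinc k n =
     (let V = Rn n; L = List.n_lists (Suc k) [0..<n] in
      eqz E
       (tup V (map (\<lambda>js. \<Otimes>\<^bsub>\<R> V\<^esub>l\<in>{..<Suc k}. rc n (js ! l) (ident E V)) L))
       (tup V (map (\<lambda>js. \<zero>\<^bsub>\<R> V\<^esub>) L)))"

definition D :: "nat \<Rightarrow> nat \<Rightarrow> 'o" where
  "D k n = src E (Dinc k n)"

definition Dzero :: "nat \<Rightarrow> nat \<Rightarrow> 'o \<Rightarrow> 'm" where
  "Dzero k n I = (THE d. d \<in> hom I (D k n) \<and> Dinc k n \<odot> d = vzero n I)"

definition multi_indices :: "nat \<Rightarrow> nat \<Rightarrow> nat list set" where
  "multi_indices n k = {\<alpha>. length \<alpha> = n \<and> sum_list \<alpha> \<le> k}"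

definition poly_value :: "nat \<Rightarrow> nat \<Rightarrow> 'o \<Rightarrow> (nat list \<Rightarrow> 'm) \<Rightarrow> 'm \<Rightarrow> 'm" where
  "poly_value n k I c x =
     (\<Oplus>\<^bsub>\<R> I\<^esub>\<alpha>\<in>multi_indices n k. c \<alpha> \<otimes>\<^bsub>\<R> I\<^esub>
        (\<Otimes>\<^bsub>\<R> I\<^esub>j\<in>{..<n}. rc n j x [^]\<^bsub>\<R> I\<^esub> (\<alpha> ! j)))"

definition kock_lawvere :: "nat \<Rightarrow> nat \<Rightarrow> bool" where
  "kock_lawvere k n \<longleftrightarrow>
     (\<forall>I. \<forall>t\<in>hom (prd E I (D k n)) (line E).
        \<exists>!c. c \<in> multi_indices n k \<rightarrow>\<^sub>E hom I (line E) \<and>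
          (\<forall>J. \<forall>u\<in>hom J I. \<forall>d\<in>hom J (D k n).
             t \<odot> \<langle>u, d\<rangle> = poly_value n k J (\<lambda>\<alpha>. c \<alpha> \<odot> u) (Dinc k n \<odot> d)))"

end

locale sdg_model = elementary_topos E + sdg_ops E
  for E :: "('o, 'm, 'z) sdg_scheme" (structure) +
  assumes rzero_hom: "rzero E \<in> hom (tmn E) (line E)"
    and rone_hom: "rone E \<in> hom (tmn E) (line E)"
    and radd_hom: "radd E \<in> hom (prd E (line E) (line E)) (line E)"
    and rmul_hom: "rmul E \<in> hom (prd E (line E) (line E)) (line E)"
    and stage_cring: "cring (\<R> I)"
    and rat_algebra: "\<exists>h. h \<in> ring_hom rat_ring (\<R> (tmn E))"
    and kock_lawvere: "\<lbrakk>k \<ge> 1; n \<ge> 1\<rbrakk> \<Longrightarrow> kock_lawvere k n"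

context sdg_ops
begin

section \<open>Formal manifolds\<close>

text \<open>
  A space \<open>q : U \<rightarrow> I\<close> at stage I with a map \<open>\<iota> : U \<rightarrow> X\<close>; \<open>formally_open\<close> includes that the
  map is injective.
\<close>

definition fibre :: "'o \<Rightarrow> 'm \<Rightarrow> 'm \<Rightarrow> 'm set" where
  "fibre U q u = {y \<in> hom (src E u) U. q \<odot> y = u}"

definition formally_open :: "'o \<Rightarrow> 'o \<Rightarrow> 'm \<Rightarrow> 'm \<Rightarrow> 'o \<Rightarrow> bool" where
  "formally_open I U q \<iota> X \<longleftrightarrow>
     q \<in> hom U I \<and> \<iota> \<in> hom U X \<and> monic \<langle>q, \<iota>\<rangle> \<and>
     (\<forall>k\<ge>1. \<forall>m\<ge>1. \<forall>J. \<forall>u\<in>hom J I. \<forall>t\<in>hom (prd E J (D k m)) X.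
        (\<exists>y\<in>fibre U q u. \<iota> \<odot> y = t \<odot> \<langle>ident E J, Dzero k m J\<rangle>) \<longrightarrow>
        (\<forall>K. \<forall>w\<in>hom K J. \<forall>d\<in>hom K (D k m).
           \<exists>y\<in>fibre U q (u \<odot> w). \<iota> \<odot> y = t \<odot> \<langle>w, d\<rangle>))"

definition chart :: "nat \<Rightarrow> 'o \<Rightarrow> 'o \<Rightarrow> 'm \<Rightarrow> 'm \<Rightarrow> 'm \<Rightarrow> 'o \<Rightarrow> bool" where
  "chart n I U q \<iota> \<phi> A \<longleftrightarrow> formally_open I U q \<iota> A \<and> formally_open I U q \<phi> (Rn n)"

definition formal_manifold :: "nat \<Rightarrow> 'o \<Rightarrow> bool" where
  "formal_manifold n A \<longleftrightarrow>
     (\<forall>I. \<forall>x\<in>hom I A. \<exists>J. \<exists>e\<in>hom J I. epic e \<and>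
        (\<exists>U q \<iota> \<phi>. chart n J U q \<iota> \<phi> A \<and> (\<exists>y\<in>fibre U q (ident E J). \<iota> \<odot> y = x \<odot> e)))"

section \<open>Infinitesimal structures\<close>

text \<open>
  The family \<open>S\<close> of subsets of the powers of A, given at stage I, as a relation on tuples: the
  tuple \<open>xs\<close> given at the later stage u : J \<rightarrow> I belongs to the subset for its length.
\<close>

definition family_rel :: "'o \<Rightarrow> (nat \<Rightarrow> 'm) \<Rightarrow> 'm \<Rightarrow> 'm list \<Rightarrow> bool" where
  "family_rel A S u xs \<longleftrightarrow>
     member (pw A (length xs)) (tup (src E u) xs) (S (length xs) \<odot> u)"

definition i_structure :: "'o \<Rightarrow> 'o \<Rightarrow> (nat \<Rightarrow> 'm) \<Rightarrow> bool" where
  "i_structure I A S \<longleftrightarrow>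
     (\<forall>p. S p \<in> hom I (pwr E (pw A p))) \<and>
     (\<forall>J. \<forall>u\<in>hom J I.
        family_rel A S u [] \<and>
        (\<forall>x\<in>hom J A. family_rel A S u [x]) \<and>
        (\<forall>m p. \<forall>h\<in>{..<m} \<rightarrow> {..<p}. \<forall>xs\<in>tuples J A p.
           family_rel A S u xs \<longrightarrow> family_rel A S u (map (\<lambda>i. xs ! h i) [0..<m])))"

text \<open>
  A map between spaces with i-structures at stage I, presented on elements: \<open>X u\<close> is the set of
  elements of the source at the later stage \<open>u\<close>, and \<open>F u\<close> is the action of the map on them.
\<close>

definition i_morphism ::
  "'o \<Rightarrow> ('m \<Rightarrow> 'm set) \<Rightarrow> ('m \<Rightarrow> 'm list \<Rightarrow> bool) \<Rightarrow> ('m \<Rightarrow> 'm \<Rightarrow> 'm) \<Rightarrow>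
    ('m \<Rightarrow> 'm list \<Rightarrow> bool) \<Rightarrow> bool" where
  "i_morphism I X S F T \<longleftrightarrow>
     (\<forall>J. \<forall>u\<in>hom J I. \<forall>xs. set xs \<subseteq> X u \<and> S u xs \<longrightarrow> T u (map (F u) xs))"

definition space_i_morphism ::
  "'o \<Rightarrow> 'o \<Rightarrow> (nat \<Rightarrow> 'm) \<Rightarrow> 'm \<Rightarrow> 'o \<Rightarrow> (nat \<Rightarrow> 'm) \<Rightarrow> bool" where
  "space_i_morphism I A S f M T \<longleftrightarrow>
     i_morphism I (\<lambda>u. hom (src E u) A) (family_rel A S) (\<lambda>u x. f \<odot> \<langle>u, x\<rangle>) (family_rel M T)"

definition multilinear :: "nat \<Rightarrow> nat \<Rightarrow> 'o \<Rightarrow> 'm \<Rightarrow> bool" where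
  "multilinear r n J \<phi> \<longleftrightarrow>
     \<phi> \<in> hom (prd E J (pw (Rn n) r)) (line E) \<and>
     (\<forall>K. \<forall>w\<in>hom K J. \<forall>vs\<in>tuples K (Rn n) r. \<forall>l<r.
        let \<Phi> = (\<lambda>x. \<phi> \<odot> \<langle>w, tup K (vs[l := x])\<rangle>) in
        (\<forall>x\<in>hom K (Rn n). \<forall>y\<in>hom K (Rn n). \<Phi> (vadd n K x y) = \<Phi> x \<oplus>\<^bsub>\<R> K\<^esub> \<Phi> y) \<and>
        (\<forall>a\<in>hom K (line E). \<forall>x\<in>hom K (Rn n). \<Phi> (vscale n K a x) = a \<otimes>\<^bsub>\<R> K\<^esub> \<Phi> x))"

definition DN :: "nat \<Rightarrow> nat \<Rightarrow> 'o \<Rightarrow> 'm list set" where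
  "DN k n I = {vs \<in> tuples I (Rn n) (Suc k).
     (\<forall>v\<in>set vs. lies_in v (Dinc k n)) \<and>
     (\<forall>J. \<forall>u\<in>hom J I. \<forall>\<phi>. multilinear (Suc k) n J \<phi> \<longrightarrow>
        \<phi> \<odot> \<langle>ident E J, tup J (map (\<lambda>v. v \<odot> u) vs)\<rangle> = \<zero>\<^bsub>\<R> J\<^esub>)}"

definition Rn_rel :: "nat \<Rightarrow> nat \<Rightarrow> 'o \<Rightarrow> 'm list \<Rightarrow> bool" where
  "Rn_rel k n I Ps \<longleftrightarrow>
     (length Ps \<ge> 2 \<longrightarrow>
       (\<forall>i\<in>{..k} \<rightarrow> {..<length Ps}. \<forall>j\<in>{..k} \<rightarrow> {..<length Ps}.
          (\<forall>l\<le>k. i l \<noteq> j l) \<longrightarrow>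
          map (\<lambda>l. vdiff n I (Ps ! i l) (Ps ! j l)) [0..<Suc k] \<in> DN k n I))"

definition chart_rel :: "nat \<Rightarrow> nat \<Rightarrow> 'm \<Rightarrow> 'm \<Rightarrow> 'm list \<Rightarrow> bool" where
  "chart_rel k n \<phi> u ys \<longleftrightarrow> Rn_rel k n (src E u) (map (\<lambda>y. \<phi> \<odot> y) ys)"

text \<open>
  \<open>S\<close> is, at stage I, an i-structure on the \<open>n\<close>-dimensional formal manifold A with the universal
  property of the \<open>k\<close>-th order one. The space M, its i-structure T and the map f live at a later
  stage J, and the charts at a later stage K than that. That M is a constant family over J is no
  restriction: a general space over J is a subspace of a constant one, and adding all constant
  tuples extends its i-structure to that space.
\<close>

definition kth_order_structure :: "nat \<Rightarrow> nat \<Rightarrow> 'o \<Rightarrow> 'o \<Rightarrow> (nat \<Rightarrow> 'm) \<Rightarrow> bool" where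
  "kth_order_structure k n I A S \<longleftrightarrow>
     i_structure I A S \<and>
     (\<forall>M J T. \<forall>v\<in>hom J I. \<forall>f\<in>hom (prd E J A) M. i_structure J M T \<longrightarrow>
        (space_i_morphism J A (\<lambda>p. S p \<odot> v) f M T \<longleftrightarrow>
          (\<forall>K. \<forall>w\<in>hom K J. \<forall>U q \<iota> \<phi>. chart n K U q \<iota> \<phi> A \<longrightarrow>
             i_morphism K (fibre U q) (chart_rel k n \<phi>)
               (\<lambda>u y. f \<odot> \<langle>w \<odot> u, \<iota> \<odot> y\<rangle>) (family_rel M (\<lambda>p. T p \<odot> w)))))"

end

end

theory Submission
  imports Defs
begin

text \<open>
  Everything rests on one fact: a map out of \<open>D\<^sub>k(n)\<close> is polynomial, and polynomial maps preserve
  \<open>k\<close>-th order neighbours.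

  In coordinates, points \<open>P\<^sub>1, \<dots>, P\<^sub>p\<close> of \<open>R\<^sup>n\<close> are \<open>k\<close>-th order neighbours exactly when every product of
  \<open>k + 1\<close> coordinate differences \<open>P\<^sub>i[c] - P\<^sub>j[c]\<close> vanishes (\<open>Rn_rel_iff\<close>), because a multilinear form is a
  combination of products of coordinates. If \<open>G\<close> is a polynomial, \<open>G(x) - G(y)\<close> lies in the ideal of the
  coordinate differences of \<open>x\<close> and \<open>y\<close>, so the same products vanish for the values of polynomials
  (\<open>map_preserves_neighbours\<close>).

  This globalizes as follows. Neighbours in a chart \<open>U\<close> all lie in \<open>y\<^sub>0 + D\<^sub>k(n)\<close> for a member \<open>y\<^sub>0\<close>. A map \<open>F\<close>
  on the manifold yields the map \<open>d \<mapsto> F(y\<^sub>0 + d)\<close> on \<open>D\<^sub>k(n)\<close>. If \<open>F(y\<^sub>0)\<close> lies in a chart \<open>V\<close>, formal openness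
  of \<open>V\<close> puts all values in \<open>V\<close>, where the map is polynomial in coordinates. So \<open>F\<close> carries neighbours in
  \<open>U\<close> to neighbours in \<open>V\<close>, for any two charts (\<open>transport_neighbours\<close>). With \<open>F\<close> the identity this is
  independence of the chart.

  The structure with the universal property consists of the images of the \<open>U\<^sub>k\<close> for all charts \<open>U\<close>, but a
  union over all charts is not an operation of an elementary topos. One chart is enough: covering the
  generic point of \<open>A\<close> gives an epimorphism \<open>e\<^sub>0 : J\<^sub>0 \<rightarrow> A\<close> and one chart over \<open>J\<^sub>0\<close>, whose member at \<open>j\<close>
  contains \<open>e\<^sub>0 j\<close>. A tuple is declared to be a tuple of neighbours if for all \<open>j\<close> over its first point it
  comes from neighbours in the member at \<open>j\<close>. This is built from equations, an implication and a
  quantifier over \<open>J\<^sub>0\<close>, hence is classified by an arrow into the power object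
  (\<open>neighbours_definable\<close>). By chart independence it contains the images of all charts
  (\<open>chart_neighbours\<close>), and since epimorphisms are stable under pullback, every such tuple comes locally
  from a chart (\<open>neighbours_locally\<close>). Membership descends along epimorphisms, and the universal property
  follows (\<open>neighbours_kth_order\<close>).

  Two structures with the universal property are compared by the identity map of \<open>A\<close>, which gives
  uniqueness. For a map \<open>f : A \<rightarrow> B\<close> the universal property reduces the claim to charts of \<open>A\<close>; locally
  \<open>f\<close> sends a given point into a chart of \<open>B\<close>, and \<open>transport_neighbours\<close> applies.
\<close>

context topos_ops
begin

text \<open>
  Typing is carried as equations for source and target, so that the simplifier can discharge the
  side conditions of the categorical laws below.
\<close>

lemma hom_iff: "f \<in> hom X Y \<longleftrightarrow> src E f = X \<and> tgt E f = Y"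
  by (simp add: hom_def)

lemma monicD:
  assumes "monic m" "m \<odot> f = m \<odot> g" "tgt E f = src E m" "tgt E g = src E m" "src E f = src E g"
  shows "f = g"
  using assms unfolding monic_def hom_def by blast

lemma monicI:
  assumes "\<And>f g. tgt E f = src E m \<Longrightarrow> tgt E g = src E m \<Longrightarrow> src E f = src E g \<Longrightarrow>
    m \<odot> f = m \<odot> g \<Longrightarrow> f = g"
  shows "monic m"
  unfolding monic_def hom_def using assms by auto

lemma epicD:
  assumes "epic e" "f \<odot> e = g \<odot> e" "src E f = tgt E e" "src E g = tgt E e" "tgt E f = tgt E g"
  shows "f = g"
  using assms unfolding epic_def hom_def by blast

lemma epicI:
  assumes "\<And>f g. src E f = tgt E e \<Longrightarrow> src E g = tgt E e \<Longrightarrow> tgt E f = tgt E g \<Longrightarrow>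
    f \<odot> e = g \<odot> e \<Longrightarrow> f = g"
  shows "epic e"
  unfolding epic_def hom_def using assms by auto

lemma lies_in_iff: "lies_in x m \<longleftrightarrow> (\<exists>y. src E y = src E x \<and> tgt E y = src E m \<and> m \<odot> y = x)"
  by (auto simp: lies_in_def hom_def)

lemma lies_inE:
  assumes "lies_in x m"
  obtains y where "src E y = src E x" "tgt E y = src E m" "m \<odot> y = x"
  using assms unfolding lies_in_iff by blast

lemma lies_inI:
  "\<lbrakk>m \<odot> y = x; src E y = src E x; tgt E y = src E m\<rbrakk> \<Longrightarrow> lies_in x m"
  by (auto simp: lies_in_iff)

end

context elementary_topos
begin

section \<open>Arrows, pairs and tuples\<close>

lemma src_ident [simp]: "src E (ident E X) = X" and tgt_ident [simp]: "tgt E (ident E X) = X"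
  using ident_hom[of X] by (simp_all add: hom_iff)

lemma src_cmp [simp]: "tgt E f = src E g \<Longrightarrow> src E (g \<odot> f) = src E f"
  and tgt_cmp [simp]: "tgt E f = src E g \<Longrightarrow> tgt E (g \<odot> f) = tgt E g"
  using cmp_hom[of f "src E f" "tgt E f" g "tgt E g"] by (simp_all add: hom_iff)

lemma cmp_ident [simp]: "src E f = X \<Longrightarrow> f \<odot> ident E X = f"
  and ident_cmp [simp]: "tgt E f = X \<Longrightarrow> ident E X \<odot> f = f"
  using ident_left[of f "src E f" "tgt E f"] ident_right[of f "src E f" "tgt E f"]
  by (auto simp: hom_iff)

lemma assoc [simp]:
  "\<lbrakk>tgt E f = src E g; tgt E g = src E h\<rbrakk> \<Longrightarrow> (h \<odot> g) \<odot> f = h \<odot> (g \<odot> f)"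
  using cmp_assoc[of f "src E f" "tgt E f" g "tgt E g" h "tgt E h"] by (simp add: hom_iff)

text \<open>
  Composites are normalized to the right, which hides a commuting square that is precomposed with
  an arrow; this form recovers it.
\<close>

lemma square_cmp:
  assumes "g \<odot> m = n \<odot> t" "tgt E m = src E g" "tgt E t = src E n" "src E t = src E m" "tgt E a = src E m"
  shows "g \<odot> (m \<odot> a) = n \<odot> (t \<odot> a)"
  using assms by (metis assoc)

lemma src_bang [simp]: "src E (bang I) = I" and tgt_bang [simp]: "tgt E (bang I) = tmn E"
  using theI'[OF terminal[of I]] by (simp_all add: bang_def hom_iff)

lemma terminal_unique:
  "\<lbrakk>tgt E f = tmn E; tgt E g = tmn E; src E f = src E g\<rbrakk> \<Longrightarrow> f = g"
  using terminal[of "src E f"] unfolding hom_iff by metis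

lemma bang_unique: "tgt E f = tmn E \<Longrightarrow> f = bang (src E f)"
  by (rule terminal_unique) simp_all

lemma bang_cmp [simp]: "tgt E u = I \<Longrightarrow> bang I \<odot> u = bang (src E u)"
  by (rule terminal_unique) simp_all

lemma src_prj [simp]: "src E (prj1 E X Y) = prd E X Y" "src E (prj2 E X Y) = prd E X Y"
  and tgt_prj [simp]: "tgt E (prj1 E X Y) = X" "tgt E (prj2 E X Y) = Y"
  using prj1_hom[of X Y] prj2_hom[of X Y] by (simp_all add: hom_iff)

lemma pair_props:
  assumes "src E f = src E g"
  shows "src E \<langle>f, g\<rangle> = src E f \<and> tgt E \<langle>f, g\<rangle> = prd E (tgt E f) (tgt E g) \<and>
    prj1 E (tgt E f) (tgt E g) \<odot> \<langle>f, g\<rangle> = f \<and> prj2 E (tgt E f) (tgt E g) \<odot> \<langle>f, g\<rangle> = g"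
  using theI'[OF product[of f "src E f" "tgt E f" g "tgt E g"]] assms
  by (simp add: pair_def hom_iff)

lemma src_pair [simp]: "src E f = src E g \<Longrightarrow> src E \<langle>f, g\<rangle> = src E g"
  and tgt_pair [simp]: "src E f = src E g \<Longrightarrow> tgt E \<langle>f, g\<rangle> = prd E (tgt E f) (tgt E g)"
  and prj1_pair [simp]:
    "\<lbrakk>src E f = src E g; tgt E f = X; tgt E g = Y\<rbrakk> \<Longrightarrow> prj1 E X Y \<odot> \<langle>f, g\<rangle> = f"
  and prj2_pair [simp]:
    "\<lbrakk>src E f = src E g; tgt E f = X; tgt E g = Y\<rbrakk> \<Longrightarrow> prj2 E X Y \<odot> \<langle>f, g\<rangle> = g"
  using pair_props by auto

lemma prj_eqI:
  assumes "tgt E f = prd E X Y" "tgt E g = prd E X Y" "src E f = src E g"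
    "prj1 E X Y \<odot> f = prj1 E X Y \<odot> g" "prj2 E X Y \<odot> f = prj2 E X Y \<odot> g"
  shows "f = g"
  using product[of "prj1 E X Y \<odot> g" "src E g" X "prj2 E X Y \<odot> g" Y] assms
  unfolding hom_iff by (metis src_cmp src_prj tgt_cmp tgt_prj)

lemma pair_cmp [simp]:
  "\<lbrakk>src E f = src E g; tgt E h = src E g\<rbrakk> \<Longrightarrow> \<langle>f, g\<rangle> \<odot> h = \<langle>f \<odot> h, g \<odot> h\<rangle>"
  by (rule prj_eqI[where X = "tgt E f" and Y = "tgt E g"]) (simp_all flip: assoc)

lemma pair_prj [simp]:
  "tgt E z = prd E X Y \<Longrightarrow> \<langle>prj1 E X Y \<odot> z, prj2 E X Y \<odot> z\<rangle> = z"
  by (rule prj_eqI[where X = X and Y = Y]) simp_all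

lemma pair_inject:
  assumes "\<langle>f, g\<rangle> = \<langle>f', g'\<rangle>" "src E f = src E g" "src E f' = src E g'"
    "tgt E f = tgt E f'" "tgt E g = tgt E g'"
  shows "f = f' \<and> g = g'"
  using assms by (metis prj1_pair prj2_pair)

lemma src_tup [simp]: "\<forall>x\<in>set xs. src E x = I \<Longrightarrow> src E (tup I xs) = I"
  by (induction xs) simp_all

lemma tgt_tup: "\<forall>x\<in>set xs. src E x = I \<and> tgt E x = X \<Longrightarrow> tgt E (tup I xs) = pw X (length xs)"
  by (induction xs) simp_all

lemma tup_cmp:
  "\<lbrakk>\<forall>x\<in>set xs. src E x = I \<and> tgt E x = X; tgt E u = I\<rbrakk> \<Longrightarrow>
    tup I xs \<odot> u = tup (src E u) (map (\<lambda>x. x \<odot> u) xs)"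
  by (induction xs) simp_all

lemma src_coord [simp]: "\<lbrakk>tgt E x = pw X n; j < n\<rbrakk> \<Longrightarrow> src E (coord X n j x) = src E x"
  and tgt_coord [simp]: "\<lbrakk>tgt E x = pw X n; j < n\<rbrakk> \<Longrightarrow> tgt E (coord X n j x) = X"
proof (induction X n j x rule: coord.induct)
  case (1 X j x)
  { case 1 then show ?case by simp }
  { case 2 then show ?case by simp }
next
  case (2 X n x)
  { case 1 then show ?case by simp }
  { case 2 then show ?case by simp }
next
  case (3 X n j x)
  { case 1 with 3 show ?case by simp }
  { case 2 with 3 show ?case by simp }
qed

lemma coord_cmp:
  "\<lbrakk>tgt E x = pw X n; j < n; tgt E u = src E x\<rbrakk> \<Longrightarrow> coord X n j x \<odot> u = coord X n j (x \<odot> u)"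
  by (induction X n j x rule: coord.induct) simp_all

lemma coord_tup:
  "\<lbrakk>\<forall>x\<in>set xs. src E x = I \<and> tgt E x = X; length xs = n; j < n\<rbrakk> \<Longrightarrow> coord X n j (tup I xs) = xs ! j"
proof (induction xs arbitrary: n j)
  case (Cons x xs)
  then show ?case
    by (cases j) (auto simp: tgt_tup[where X = X])
qed simp

lemma coord_eqI:
  "\<lbrakk>tgt E x = pw X n; tgt E y = pw X n; src E x = src E y; \<And>j. j < n \<Longrightarrow> coord X n j x = coord X n j y\<rbrakk>
    \<Longrightarrow> x = y"
proof (induction n arbitrary: x y)
  case 0
  then show ?case by (auto intro: terminal_unique)
next
  case (Suc n)
  show ?case
  proof (rule prj_eqI[where X = X and Y = "pw X n"])
    show "prj1 E X (pw X n) \<odot> x = prj1 E X (pw X n) \<odot> y"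
      using Suc.prems(4)[of 0] by simp
    show "prj2 E X (pw X n) \<odot> x = prj2 E X (pw X n) \<odot> y"
    proof (rule Suc.IH)
      show "coord X n j (prj2 E X (pw X n) \<odot> x) = coord X n j (prj2 E X (pw X n) \<odot> y)" if "j < n" for j
        using Suc.prems(4)[of "Suc j"] that by simp
    qed (use Suc.prems in simp_all)
  qed (use Suc.prems in simp_all)
qed

lemma tup_coord:
  assumes "tgt E x = pw X n" "src E x = I"
  shows "tup I (map (\<lambda>j. coord X n j x) [0..<n]) = x"
proof -
  let ?xs = "map (\<lambda>j. coord X n j x) [0..<n]"
  have ty: "\<forall>y\<in>set ?xs. src E y = I \<and> tgt E y = X"
    using assms by simp
  show ?thesis
  proof (rule coord_eqI)
    show "tgt E (tup I ?xs) = pw X n" using tgt_tup[OF ty] by simp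
    show "src E (tup I ?xs) = src E x" using ty assms(2) by (subst src_tup) auto
    show "coord X n j (tup I ?xs) = coord X n j x" if "j < n" for j
      using that by (subst coord_tup[OF ty]) simp_all
  qed (rule assms(1))
qed

abbreviation comps :: "'o \<Rightarrow> nat \<Rightarrow> 'm \<Rightarrow> 'm list" where
  "comps X p x \<equiv> map (\<lambda>j. coord X p j x) [0..<p]"

lemma comps_tup:
  assumes "\<forall>x\<in>set xs. src E x = I \<and> tgt E x = X" "length xs = p"
  shows "comps X p (tup I xs) = xs"
  using assms by (intro nth_equalityI) (simp_all add: coord_tup[OF assms])

lemma tup_inject:
  assumes "\<forall>x\<in>set xs. src E x = I \<and> tgt E x = X" "\<forall>x\<in>set ys. src E x = I \<and> tgt E x = X"
    "length xs = length ys" "tup I xs = tup I ys"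
  shows "xs = ys"
proof (rule nth_equalityI)
  fix j assume j: "j < length xs"
  have "xs ! j = coord X (length xs) j (tup I xs)"
    by (rule coord_tup[OF assms(1) refl j, symmetric])
  also have "\<dots> = ys ! j"
    unfolding assms(4) by (rule coord_tup[OF assms(2) assms(3)[symmetric] j])
  finally show "xs ! j = ys ! j" .
qed (rule assms(3))

section \<open>Definable predicates\<close>

lemma tgt_eqz [simp]: "\<lbrakk>src E f = src E g; tgt E f = tgt E g\<rbrakk> \<Longrightarrow> tgt E (eqz E f g) = src E g"
  using eqz_tgt[of f "src E f" "tgt E f" g] by (simp add: hom_iff)

lemma eqz_factor:
  assumes "src E f = src E g" "tgt E f = tgt E g" "tgt E h = src E g"
  shows "lies_in h (eqz E f g) \<longleftrightarrow> f \<odot> h = g \<odot> h"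
proof
  assume "lies_in h (eqz E f g)"
  then obtain y where y: "src E y = src E h" "tgt E y = src E (eqz E f g)" "eqz E f g \<odot> y = h"
    by (auto simp: lies_in_iff)
  have "f \<odot> eqz E f g = g \<odot> eqz E f g"
    using eqz_eq[of f "src E f" "tgt E f" g] assms by (simp add: hom_iff)
  then have "(f \<odot> eqz E f g) \<odot> y = (g \<odot> eqz E f g) \<odot> y" by simp
  then show "f \<odot> h = g \<odot> h" using y assms by simp
next
  assume "f \<odot> h = g \<odot> h"
  then show "lies_in h (eqz E f g)"
    using equalizer[of f "src E f" "tgt E f" g h "src E h"] assms by (auto simp: lies_in_iff hom_iff)
qed

lemma eqz_monic:
  assumes "src E f = src E g" "tgt E f = tgt E g"
  shows "monic (eqz E f g)"
proof (rule monicI)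
  fix a b assume ab: "tgt E a = src E (eqz E f g)" "tgt E b = src E (eqz E f g)" "src E a = src E b"
    "eqz E f g \<odot> a = eqz E f g \<odot> b"
  have "lies_in (eqz E f g \<odot> a) (eqz E f g)" using ab assms by (auto simp: lies_in_iff)
  then have "f \<odot> (eqz E f g \<odot> a) = g \<odot> (eqz E f g \<odot> a)"
    using eqz_factor assms ab by simp
  then show "a = b"
    using equalizer[of f "src E f" "tgt E f" g "eqz E f g \<odot> a" "src E a"] assms ab
    by (auto simp: hom_iff)
qed

lemma pullback_exists:
  assumes "tgt E f = tgt E g"
  shows "\<exists>p q. is_pullback p q f g"
proof -
  let ?f = "f \<odot> prj1 E (src E f) (src E g)" and ?g = "g \<odot> prj2 E (src E f) (src E g)"
  define m where "m = eqz E ?f ?g"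
  have fac: "lies_in h m \<longleftrightarrow> ?f \<odot> h = ?g \<odot> h" if "tgt E h = prd E (src E f) (src E g)" for h
    unfolding m_def using that assms by (intro eqz_factor) simp_all
  have mm: "monic m" unfolding m_def using assms by (intro eqz_monic) simp_all
  have tm: "tgt E m = prd E (src E f) (src E g)" unfolding m_def using assms by simp
  have "lies_in m m" by - (rule lies_inI[of _ "ident E (src E m)"], simp_all)
  then have sq: "f \<odot> (prj1 E (src E f) (src E g) \<odot> m) = g \<odot> (prj2 E (src E f) (src E g) \<odot> m)"
    using fac[of m] tm assms by simp
  have "is_pullback (prj1 E (src E f) (src E g) \<odot> m) (prj2 E (src E f) (src E g) \<odot> m) f g"
    unfolding is_pullback_def hom_iff
  proof (intro conjI allI ballI impI ex_ex1I)
    fix I a b assume ab: "a \<in> hom I (src E f)" "b \<in> hom I (src E g)" "f \<odot> a = g \<odot> b"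
    then have "lies_in \<langle>a, b\<rangle> m" using assms by (subst fac) (simp_all add: hom_iff)
    then obtain h where h: "src E h = I" "tgt E h = src E m" "m \<odot> h = \<langle>a, b\<rangle>"
      using ab by (auto simp: lies_in_iff hom_iff)
    show "\<exists>h. (src E h = I \<and> tgt E h = src E (prj1 E (src E f) (src E g) \<odot> m)) \<and>
      (prj1 E (src E f) (src E g) \<odot> m) \<odot> h = a \<and> (prj2 E (src E f) (src E g) \<odot> m) \<odot> h = b"
      using h ab tm by (intro exI[of _ h]) (simp add: hom_iff)
    fix h h'
    assume *: "(src E h = I \<and> tgt E h = src E (prj1 E (src E f) (src E g) \<odot> m)) \<and>
      (prj1 E (src E f) (src E g) \<odot> m) \<odot> h = a \<and> (prj2 E (src E f) (src E g) \<odot> m) \<odot> h = b"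
      "(src E h' = I \<and> tgt E h' = src E (prj1 E (src E f) (src E g) \<odot> m)) \<and>
      (prj1 E (src E f) (src E g) \<odot> m) \<odot> h' = a \<and> (prj2 E (src E f) (src E g) \<odot> m) \<odot> h' = b"
    then have ty: "tgt E h = src E m" "tgt E h' = src E m" "src E h = src E h'"
      using tm by simp_all
    have "m \<odot> h = m \<odot> h'"
      using * ty tm by - (rule prj_eqI[where X = "src E f" and Y = "src E g"], simp_all)
    then show "h = h'" using ty by (rule monicD[OF mm])
  qed (use tm sq assms in simp_all)
  then show ?thesis by blast
qed

lemma pullback_typing:
  assumes "is_pullback p q f g"
  shows "src E q = src E p" "tgt E p = src E f" "tgt E q = src E g" "tgt E g = tgt E f" "f \<odot> p = g \<odot> q"
  using assms unfolding is_pullback_def by auto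

lemma pullback_lift:
  assumes "is_pullback p q f g" "src E a = src E b" "tgt E a = src E f" "tgt E b = src E g" "f \<odot> a = g \<odot> b"
  obtains h where "src E h = src E b" "tgt E h = src E p" "p \<odot> h = a" "q \<odot> h = b"
proof -
  have "a \<in> hom (src E b) (src E f)" "b \<in> hom (src E b) (src E g)"
    using assms by (simp_all add: hom_iff)
  then have "\<exists>h. h \<in> hom (src E b) (src E p) \<and> p \<odot> h = a \<and> q \<odot> h = b"
    using assms(1,5) unfolding is_pullback_def by blast
  then show ?thesis using that by (auto simp: hom_iff)
qed

text \<open>
  The universal property read on elements: a pullback of \<open>n\<close> along \<open>g\<close> is the inverse image.
\<close>

lemma pullback_lies_in:
  assumes pb: "is_pullback m t g n" and z: "tgt E z = src E g"
  shows "lies_in z m \<longleftrightarrow> lies_in (g \<odot> z) n"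
proof
  note ty = pullback_typing[OF pb]
  assume "lies_in z m"
  then obtain y where y: "src E y = src E z" "tgt E y = src E m" "m \<odot> y = z"
    by (auto simp: lies_in_iff)
  have "n \<odot> (t \<odot> y) = (n \<odot> t) \<odot> y" using y ty by simp
  also have "\<dots> = (g \<odot> m) \<odot> y" using ty by simp
  also have "\<dots> = g \<odot> z" using y ty by (subst assoc) simp_all
  finally show "lies_in (g \<odot> z) n" using y ty z by - (rule lies_inI[of _ "t \<odot> y"], simp_all)
next
  assume "lies_in (g \<odot> z) n"
  then obtain b where b: "src E b = src E z" "tgt E b = src E n" "g \<odot> z = n \<odot> b"
    using z by (auto simp: lies_in_iff)
  with pullback_lift[OF pb, of z b] z show "lies_in z m"
    by (metis lies_in_iff)
qed

lemma pullback_monic: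
  assumes pb: "is_pullback m t g n" and n: "monic n"
  shows "monic m"
proof (rule monicI)
  note ty = pullback_typing[OF pb]
  fix a b assume ab: "tgt E a = src E m" "tgt E b = src E m" "src E a = src E b" "m \<odot> a = m \<odot> b"
  have "n \<odot> (t \<odot> a) = n \<odot> (t \<odot> b)"
    using square_cmp[OF ty(5), of a] square_cmp[OF ty(5), of b] ty ab by simp
  then have "t \<odot> a = t \<odot> b" using ty ab by - (rule monicD[OF n], simp_all)
  moreover have "\<exists>!h. h \<in> hom (src E b) (src E m) \<and> m \<odot> h = m \<odot> b \<and> t \<odot> h = t \<odot> b"
  proof -
    have "g \<odot> (m \<odot> b) = n \<odot> (t \<odot> b)" using square_cmp[OF ty(5), of b] ty ab by simp
    moreover have "m \<odot> b \<in> hom (src E b) (src E g)" "t \<odot> b \<in> hom (src E b) (src E n)"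
      using ty ab by (simp_all add: hom_iff)
    ultimately show ?thesis using pb unfolding is_pullback_def by blast
  qed
  ultimately show "a = b" using ab unfolding hom_iff by metis
qed

text \<open>
  A predicate on the elements of \<open>X\<close> at all stages that is the membership predicate of a subobject of
  \<open>X\<close>. The closure properties below are the clauses of the Kripke--Joyal semantics, which is why the
  universal quantifier and the implication range over later stages.
\<close>

definition definable :: "'o \<Rightarrow> ('m \<Rightarrow> bool) \<Rightarrow> bool" where
  "definable X P \<longleftrightarrow> (\<exists>m. monic m \<and> tgt E m = X \<and> (\<forall>x. tgt E x = X \<longrightarrow> (P x \<longleftrightarrow> lies_in x m)))"

lemma definable_cong:
  assumes "definable X P" "\<And>x. tgt E x = X \<Longrightarrow> P x \<longleftrightarrow> Q x"
  shows "definable X Q"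
  using assms unfolding definable_def by metis

lemma definable_restrict:
  assumes "definable X P" "P x" "tgt E x = X" "tgt E u = src E x"
  shows "P (x \<odot> u)"
proof -
  obtain m where m: "tgt E m = X" "\<And>x. tgt E x = X \<Longrightarrow> P x \<longleftrightarrow> lies_in x m"
    using assms(1) unfolding definable_def by blast
  obtain y where "src E y = src E x" "tgt E y = src E m" "m \<odot> y = x"
    using m(2) assms by (auto simp: lies_in_iff)
  then have "lies_in (x \<odot> u) m"
    using assms by (auto intro!: lies_inI[of _ "y \<odot> u"])
  then show ?thesis using m assms by simp
qed

lemma definable_lies_in: "monic m \<Longrightarrow> definable (tgt E m) (\<lambda>x. lies_in x m)"
  unfolding definable_def by blast

lemma definable_True: "definable X (\<lambda>x. True)"
  unfolding definable_def
proof (intro exI[of _ "ident E X"] conjI allI impI)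
  show "True \<longleftrightarrow> lies_in x (ident E X)" if "tgt E x = X" for x
    using that lies_inI[of "ident E X" x x] by simp
qed (auto intro: monicI)

lemma definable_eq:
  assumes "src E f = X" "src E g = X" "tgt E f = tgt E g"
  shows "definable X (\<lambda>x. f \<odot> x = g \<odot> x)"
  unfolding definable_def
  using assms by (intro exI[of _ "eqz E f g"]) (simp add: eqz_monic eqz_factor)

lemma definable_subst:
  assumes "definable Y P" "src E f = X" "tgt E f = Y"
  shows "definable X (\<lambda>x. P (f \<odot> x))"
proof -
  obtain m where m: "monic m" "tgt E m = Y" "\<And>x. tgt E x = Y \<Longrightarrow> P x \<longleftrightarrow> lies_in x m"
    using assms(1) unfolding definable_def by blast
  obtain p t where pb: "is_pullback p t f m" using pullback_exists[of f m] m assms by auto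
  show ?thesis unfolding definable_def
    using pullback_monic[OF pb] pullback_typing[OF pb] pullback_lies_in[OF pb] m assms
    by (intro exI[of _ p]) simp
qed

text \<open>
  An existential quantifier with at most one witness needs no passage to an epimorphism: the composite of
  a monomorphism with a map that is injective on it is again a monomorphism.
\<close>

lemma definable_image:
  assumes P: "definable Y P" and g: "src E g = Y" "tgt E g = X"
    and inj: "\<And>y z. \<lbrakk>tgt E y = Y; tgt E z = Y; src E y = src E z; P y; P z; g \<odot> y = g \<odot> z\<rbrakk> \<Longrightarrow> y = z"
  shows "definable X (\<lambda>x. \<exists>y. src E y = src E x \<and> tgt E y = Y \<and> P y \<and> g \<odot> y = x)"
proof -
  obtain m where m: "monic m" "tgt E m = Y" "\<And>x. tgt E x = Y \<Longrightarrow> P x \<longleftrightarrow> lies_in x m"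
    using P unfolding definable_def by blast
  have "monic (g \<odot> m)"
  proof (rule monicI)
    fix a b assume ab: "tgt E a = src E (g \<odot> m)" "tgt E b = src E (g \<odot> m)" "src E a = src E b"
      "(g \<odot> m) \<odot> a = (g \<odot> m) \<odot> b"
    then have *: "tgt E a = src E m" "tgt E b = src E m" "g \<odot> (m \<odot> a) = g \<odot> (m \<odot> b)" using m g by simp_all
    then have "P (m \<odot> a)" "P (m \<odot> b)"
      using m(2) m(3)[of "m \<odot> a"] m(3)[of "m \<odot> b"] lies_inI[of m a] lies_inI[of m b] by simp_all
    then have "m \<odot> a = m \<odot> b" using * m ab by - (rule inj, simp_all)
    then show "a = b" using * m ab by - (rule monicD[OF m(1)], simp_all)
  qed
  moreover have "(\<exists>y. src E y = src E x \<and> tgt E y = Y \<and> P y \<and> g \<odot> y = x) \<longleftrightarrow> lies_in x (g \<odot> m)" for x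
  proof
    assume "\<exists>y. src E y = src E x \<and> tgt E y = Y \<and> P y \<and> g \<odot> y = x"
    then obtain y where y: "src E y = src E x" "tgt E y = Y" "P y" "g \<odot> y = x" by blast
    then obtain z where "src E z = src E y" "tgt E z = src E m" "m \<odot> z = y"
      using m(3) by (auto simp: lies_in_iff)
    then show "lies_in x (g \<odot> m)" using y m g by - (rule lies_inI[of _ z], simp_all)
  next
    assume "lies_in x (g \<odot> m)"
    then obtain z where z: "src E z = src E x" "tgt E z = src E (g \<odot> m)" "(g \<odot> m) \<odot> z = x"
      by (rule lies_inE)
    then have z': "tgt E z = src E m" using m(2) g by simp
    then have "P (m \<odot> z)" using m(2) m(3)[of "m \<odot> z"] lies_inI[of m z] z' by simp
    then show "\<exists>y. src E y = src E x \<and> tgt E y = Y \<and> P y \<and> g \<odot> y = x"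
      using z z' m g by (intro exI[of _ "m \<odot> z"]) simp
  qed
  ultimately show ?thesis unfolding definable_def using m g by (intro exI[of _ "g \<odot> m"]) simp
qed

lemma definable_conj:
  assumes "definable X P" "definable X Q"
  shows "definable X (\<lambda>x. P x \<and> Q x)"
proof -
  obtain m where m: "monic m" "tgt E m = X" "\<And>x. tgt E x = X \<Longrightarrow> P x \<longleftrightarrow> lies_in x m"
    using assms(1) unfolding definable_def by blast
  have "definable X (\<lambda>x. \<exists>y. src E y = src E x \<and> tgt E y = src E m \<and> Q (m \<odot> y) \<and> m \<odot> y = x)"
  proof (rule definable_image)
    show "definable (src E m) (\<lambda>y. Q (m \<odot> y))" by (rule definable_subst[OF assms(2)]) (simp_all add: m)
  qed (use m in simp_all, blast dest: monicD)
  then show ?thesis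
  proof (rule definable_cong)
    show "(\<exists>y. src E y = src E x \<and> tgt E y = src E m \<and> Q (m \<odot> y) \<and> m \<odot> y = x) \<longleftrightarrow> P x \<and> Q x"
      if "tgt E x = X" for x
      using m(3)[OF that] by (auto simp: lies_in_iff)
  qed
qed

lemma definable_finite_conj:
  assumes "finite F" "\<And>i. i \<in> F \<Longrightarrow> definable X (P i)"
  shows "definable X (\<lambda>x. \<forall>i\<in>F. P i x)"
  using assms by (induction F) (simp_all add: definable_True definable_conj)

lemma tgt_elt [simp]: "tgt E (elt E X) = prd E X (pwr E X)"
  by (rule elt_tgt)

lemma comprehension:
  assumes "definable (prd E X I) P"
  shows "\<exists>c. src E c = I \<and> tgt E c = pwr E X \<and>
    (\<forall>u x. tgt E u = I \<longrightarrow> tgt E x = X \<longrightarrow> src E x = src E u \<longrightarrow> (member X x (c \<odot> u) \<longleftrightarrow> P \<langle>x, u\<rangle>))"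
proof -
  obtain m where m: "monic m" "tgt E m = prd E X I"
      "\<And>x. tgt E x = prd E X I \<Longrightarrow> P x \<longleftrightarrow> lies_in x m"
    using assms unfolding definable_def by blast
  obtain c t where c: "src E c = I" "tgt E c = pwr E X"
      and pb: "is_pullback m t \<langle>prj1 E X I, c \<odot> prj2 E X I\<rangle> (elt E X)"
    using power_object[OF m(1,2)] by (auto simp: hom_iff)
  have "member X x (c \<odot> u) \<longleftrightarrow> P \<langle>x, u\<rangle>" if "tgt E u = I" "tgt E x = X" "src E x = src E u" for u x
    unfolding member_def using pullback_lies_in[OF pb, of "\<langle>x, u\<rangle>"] m(3)[of "\<langle>x, u\<rangle>"] that c by simp
  then show ?thesis using c by blast
qed

text \<open>
  The subobject of \<open>X \<times> I\<close> classified by \<open>c\<close> has the elements that \<open>c\<close> prescribes, so it is also a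
  pullback along \<open>c'\<close>; the classifying arrow of a subobject is unique.
\<close>

lemma extensionality:
  assumes c: "src E c = I" "tgt E c = pwr E X" and c': "src E c' = I" "tgt E c' = pwr E X"
    and same: "\<And>u x. \<lbrakk>tgt E u = I; tgt E x = X; src E x = src E u\<rbrakk> \<Longrightarrow>
      member X x (c \<odot> u) \<longleftrightarrow> member X x (c' \<odot> u)"
  shows "c = c'"
proof -
  let ?g = "\<langle>prj1 E X I, c \<odot> prj2 E X I\<rangle>" and ?g' = "\<langle>prj1 E X I, c' \<odot> prj2 E X I\<rangle>"
  have same': "lies_in (?g \<odot> z) (elt E X) \<longleftrightarrow> lies_in (?g' \<odot> z) (elt E X)" if "tgt E z = prd E X I" for z
    using same[of "prj2 E X I \<odot> z" "prj1 E X I \<odot> z"] that c c' by (simp add: member_def)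
  obtain m t where pb: "is_pullback m t ?g (elt E X)"
    using pullback_exists[of ?g "elt E X"] c by auto
  have m: "monic m" "tgt E m = prd E X I"
    using pullback_monic[OF pb elt_monic] pullback_typing[OF pb] c by simp_all
  have mem: "lies_in z m \<longleftrightarrow> lies_in (?g' \<odot> z) (elt E X)" if "tgt E z = prd E X I" for z
    using pullback_lies_in[OF pb, of z] same'[of z] that c by simp
  have "lies_in m m" by - (rule lies_inI[of _ "ident E (src E m)"], simp_all)
  then obtain t' where t': "src E t' = src E m" "tgt E t' = src E (elt E X)" "elt E X \<odot> t' = ?g' \<odot> m"
    using mem[of m] m c' by (auto simp: lies_in_iff)
  have "is_pullback m t' ?g' (elt E X)"
    unfolding is_pullback_def hom_iff
  proof (intro conjI allI ballI impI ex_ex1I)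
    fix J a b assume ab: "a \<in> hom J (src E ?g')" "b \<in> hom J (src E (elt E X))" "?g' \<odot> a = elt E X \<odot> b"
    then have a: "src E a = J" "tgt E a = prd E X I" and b: "src E b = J" "tgt E b = src E (elt E X)"
      using c' by (simp_all add: hom_iff)
    then have "lies_in a m" using ab(3) c' by (subst mem) (auto simp: lies_in_iff)
    then obtain h where h: "src E h = J" "tgt E h = src E m" "m \<odot> h = a"
      using a by (auto simp: lies_in_iff)
    have "elt E X \<odot> (t' \<odot> h) = (?g' \<odot> m) \<odot> h"
      using h t' by (simp only: t'(3)[symmetric]) simp
    also have "\<dots> = ?g' \<odot> a" using h m c' by (subst assoc) simp_all
    finally have "t' \<odot> h = b" using h t' a b ab(3) by - (rule monicD[OF elt_monic], simp_all)
    then show "\<exists>h. (src E h = J \<and> tgt E h = src E m) \<and> m \<odot> h = a \<and> t' \<odot> h = b"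
      using h by blast
    fix h1 h2 assume "(src E h1 = J \<and> tgt E h1 = src E m) \<and> m \<odot> h1 = a \<and> t' \<odot> h1 = b"
      "(src E h2 = J \<and> tgt E h2 = src E m) \<and> m \<odot> h2 = a \<and> t' \<odot> h2 = b"
    then show "h1 = h2" by - (rule monicD[OF m(1)], simp_all)
  qed (use t' m c' in simp_all)
  with pb power_object[OF m] c c' show ?thesis unfolding hom_iff by metis
qed

text \<open>
  The section \<open>{y. P y x}\<close> is everything exactly when its name in the power object of \<open>Y\<close> equals the
  name of all of \<open>Y\<close>, and equality of arrows is definable.
\<close>

lemma definable_all:
  assumes "definable (prd E Y X) P"
  shows "definable X (\<lambda>x. \<forall>u y. tgt E u = src E x \<longrightarrow> tgt E y = Y \<longrightarrow> src E y = src E u \<longrightarrow> P \<langle>y, x \<odot> u\<rangle>)"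
proof -
  obtain c where c: "src E c = X" "tgt E c = pwr E Y"
    "\<And>u y. tgt E u = X \<Longrightarrow> tgt E y = Y \<Longrightarrow> src E y = src E u \<Longrightarrow> member Y y (c \<odot> u) \<longleftrightarrow> P \<langle>y, u\<rangle>"
    using comprehension[OF assms] by blast
  obtain c' where c': "src E c' = X" "tgt E c' = pwr E Y"
    "\<And>u y. tgt E u = X \<Longrightarrow> tgt E y = Y \<Longrightarrow> src E y = src E u \<Longrightarrow> member Y y (c' \<odot> u)"
    using comprehension[where X = Y and I = X, OF definable_True] by auto
  have "definable X (\<lambda>x. c \<odot> x = c' \<odot> x)" using c c' by (intro definable_eq) simp_all
  then show ?thesis
  proof (rule definable_cong)
    fix x assume x: "tgt E x = X"
    show "c \<odot> x = c' \<odot> x \<longleftrightarrow>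
      (\<forall>u y. tgt E u = src E x \<longrightarrow> tgt E y = Y \<longrightarrow> src E y = src E u \<longrightarrow> P \<langle>y, x \<odot> u\<rangle>)"
    proof (intro iffI allI impI)
      fix u y assume *: "c \<odot> x = c' \<odot> x" "tgt E u = src E x" "tgt E y = Y" "src E y = src E u"
      then have "c \<odot> (x \<odot> u) = c' \<odot> (x \<odot> u)"
        using x c(1) c'(1) by (metis assoc)
      then show "P \<langle>y, x \<odot> u\<rangle>" using c(3)[of "x \<odot> u" y] c'(3)[of "x \<odot> u" y] * x by simp
    next
      assume *: "\<forall>u y. tgt E u = src E x \<longrightarrow> tgt E y = Y \<longrightarrow> src E y = src E u \<longrightarrow> P \<langle>y, x \<odot> u\<rangle>"
      show "c \<odot> x = c' \<odot> x"
      proof (rule extensionality)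
        fix u y assume "tgt E u = src E x" "tgt E y = Y" "src E y = src E u"
        then show "member Y y ((c \<odot> x) \<odot> u) \<longleftrightarrow> member Y y ((c' \<odot> x) \<odot> u)"
          using c(1) c(3)[of "x \<odot> u" y] c'(1) c'(3)[of "x \<odot> u" y] * x by simp
      qed (use x c c' in simp_all)
    qed
  qed
qed

text \<open>
  Truth values are the elements of the power object of the terminal object.
\<close>

lemma truth_value:
  assumes "definable X P"
  shows "\<exists>c. src E c = X \<and> tgt E c = pwr E (tmn E) \<and>
    (\<forall>x. tgt E x = X \<longrightarrow> (member (tmn E) (bang (src E x)) (c \<odot> x) \<longleftrightarrow> P x))"
proof -
  have "definable (prd E (tmn E) X) (\<lambda>z. P (prj2 E (tmn E) X \<odot> z))"
    using assms by (rule definable_subst) simp_all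
  from comprehension[OF this] obtain c where c: "src E c = X" "tgt E c = pwr E (tmn E)"
    "\<And>u y. tgt E u = X \<Longrightarrow> tgt E y = tmn E \<Longrightarrow> src E y = src E u \<Longrightarrow>
      member (tmn E) y (c \<odot> u) \<longleftrightarrow> P (prj2 E (tmn E) X \<odot> \<langle>y, u\<rangle>)" by blast
  have "member (tmn E) (bang (src E x)) (c \<odot> x) \<longleftrightarrow> P x" if "tgt E x = X" for x
    using c(3)[of x "bang (src E x)"] that by simp
  with c show ?thesis by blast
qed

lemma truth_value_eqI:
  assumes "tgt E c = pwr E (tmn E)" "tgt E c' = pwr E (tmn E)" "src E c = I" "src E c' = I"
    "\<And>u. tgt E u = I \<Longrightarrow>
      member (tmn E) (bang (src E u)) (c \<odot> u) \<longleftrightarrow> member (tmn E) (bang (src E u)) (c' \<odot> u)"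
  shows "c = c'"
proof (rule extensionality)
  fix u x assume "tgt E u = I" "tgt E x = tmn E" "src E x = src E u"
  then show "member (tmn E) x (c \<odot> u) \<longleftrightarrow> member (tmn E) x (c' \<odot> u)"
    using assms(5)[of u] bang_unique[of x] by simp
qed (use assms in simp_all)

text \<open>
  \<open>P\<close> implies \<open>Q\<close> exactly when the truth values of \<open>P\<close> and of \<open>P \<and> Q\<close> are equal.
\<close>

lemma definable_imp:
  assumes P: "definable X P" and Q: "definable X Q"
  shows "definable X (\<lambda>x. \<forall>u. tgt E u = src E x \<longrightarrow> P (x \<odot> u) \<longrightarrow> Q (x \<odot> u))"
proof -
  let ?\<Omega> = "tmn E"
  obtain c where c: "src E c = X" "tgt E c = pwr E ?\<Omega>"
    "\<And>x. tgt E x = X \<Longrightarrow> member ?\<Omega> (bang (src E x)) (c \<odot> x) \<longleftrightarrow> P x"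
    using truth_value[OF P] by blast
  obtain c' where c': "src E c' = X" "tgt E c' = pwr E ?\<Omega>"
    "\<And>x. tgt E x = X \<Longrightarrow> member ?\<Omega> (bang (src E x)) (c' \<odot> x) \<longleftrightarrow> P x \<and> Q x"
    using truth_value[OF definable_conj[OF P Q]] by blast
  have "definable X (\<lambda>x. c \<odot> x = c' \<odot> x)" using c c' by (intro definable_eq) simp_all
  then show ?thesis
  proof (rule definable_cong)
    fix x assume x: "tgt E x = X"
    show "c \<odot> x = c' \<odot> x \<longleftrightarrow> (\<forall>u. tgt E u = src E x \<longrightarrow> P (x \<odot> u) \<longrightarrow> Q (x \<odot> u))"
    proof (intro iffI allI impI)
      fix u assume *: "c \<odot> x = c' \<odot> x" "tgt E u = src E x" "P (x \<odot> u)"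
      then have "c \<odot> (x \<odot> u) = c' \<odot> (x \<odot> u)" using x c(1) c'(1) by (metis assoc)
      then show "Q (x \<odot> u)" using c(3)[of "x \<odot> u"] c'(3)[of "x \<odot> u"] * x by simp
    next
      assume *: "\<forall>u. tgt E u = src E x \<longrightarrow> P (x \<odot> u) \<longrightarrow> Q (x \<odot> u)"
      show "c \<odot> x = c' \<odot> x"
      proof (rule truth_value_eqI)
        fix u assume u: "tgt E u = src E x"
        then show "member ?\<Omega> (bang (src E u)) ((c \<odot> x) \<odot> u) \<longleftrightarrow> member ?\<Omega> (bang (src E u)) ((c' \<odot> x) \<odot> u)"
          using c(1) c'(1) c(3)[of "x \<odot> u"] c'(3)[of "x \<odot> u"] x * by auto
      qed (use x c c' in simp_all)
    qed
  qed
qed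

section \<open>Epimorphisms\<close>

text \<open>
  The truth value of \<open>P\<close> at \<open>x\<close> becomes equal to that of \<open>True\<close> after composing with \<open>e\<close>, and an
  epimorphism can be cancelled from equal arrows.
\<close>

lemma definable_descent:
  assumes P: "definable X P" and e: "epic e" and x: "tgt E x = X" "tgt E e = src E x" "P (x \<odot> e)"
  shows "P x"
proof -
  obtain c where c: "src E c = X" "tgt E c = pwr E (tmn E)"
    "\<And>x. tgt E x = X \<Longrightarrow> member (tmn E) (bang (src E x)) (c \<odot> x) \<longleftrightarrow> P x"
    using truth_value[OF P] by blast
  obtain c' where c': "src E c' = X" "tgt E c' = pwr E (tmn E)"
    "\<And>x. tgt E x = X \<Longrightarrow> member (tmn E) (bang (src E x)) (c' \<odot> x)"
    using truth_value[where X = X, OF definable_True] by auto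
  have "c \<odot> (x \<odot> e) = c' \<odot> (x \<odot> e)"
  proof (rule truth_value_eqI)
    fix u assume u: "tgt E u = src E (x \<odot> e)"
    then have "P ((x \<odot> e) \<odot> u)" using x by - (rule definable_restrict[OF P], simp_all)
    then show "member (tmn E) (bang (src E u)) ((c \<odot> (x \<odot> e)) \<odot> u) \<longleftrightarrow>
      member (tmn E) (bang (src E u)) ((c' \<odot> (x \<odot> e)) \<odot> u)"
      using c(1) c'(1) c(3)[of "x \<odot> (e \<odot> u)"] c'(3)[of "x \<odot> (e \<odot> u)"] x u by simp
  qed (use x c c' in simp_all)
  then have "c \<odot> x = c' \<odot> x"
    using x c c' by - (rule epicD[OF e], simp_all)
  then show ?thesis using c(3)[of x] c'(3)[of x] x by simp
qed

text \<open>
  Suppose \<open>f p = g p\<close>. The subsets \<open>{i. x i = a}\<close> and \<open>{i. x i = a \<and> f i = g i}\<close> depend on \<open>a\<close>, and as arrows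
  into a power object they agree after composing with \<open>e\<close>: if \<open>x i = e u\<close>, then \<open>i\<close> comes from the
  pullback. So they agree, and evaluation at \<open>a = x\<close> with \<open>i\<close> generic gives \<open>f = g\<close>.
\<close>

lemma pullback_epic:
  assumes e: "epic e" and pb: "is_pullback p q x e"
  shows "epic p"
proof (rule epicI)
  note ty = pullback_typing[OF pb]
  let ?A = "tgt E e" and ?I = "src E x"
  let ?i = "prj1 E ?I ?A" and ?a = "prj2 E ?I ?A"
  fix f g assume fg: "src E f = tgt E p" "src E g = tgt E p" "tgt E f = tgt E g" "f \<odot> p = g \<odot> p"
  have d1: "definable (prd E ?I ?A) (\<lambda>z. (x \<odot> ?i) \<odot> z = ?a \<odot> z)"
    using ty by (intro definable_eq) simp_all
  have d2: "definable (prd E ?I ?A) (\<lambda>z. (f \<odot> ?i) \<odot> z = (g \<odot> ?i) \<odot> z)"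
    using ty fg by (intro definable_eq) simp_all
  obtain c where c: "src E c = ?A" "tgt E c = pwr E ?I"
    "\<And>u i. tgt E u = ?A \<Longrightarrow> tgt E i = ?I \<Longrightarrow> src E i = src E u \<Longrightarrow>
      member ?I i (c \<odot> u) \<longleftrightarrow> (x \<odot> ?i) \<odot> \<langle>i, u\<rangle> = ?a \<odot> \<langle>i, u\<rangle>"
    using comprehension[OF d1] by blast
  obtain c' where c': "src E c' = ?A" "tgt E c' = pwr E ?I"
    "\<And>u i. tgt E u = ?A \<Longrightarrow> tgt E i = ?I \<Longrightarrow> src E i = src E u \<Longrightarrow>
      member ?I i (c' \<odot> u) \<longleftrightarrow> (x \<odot> ?i) \<odot> \<langle>i, u\<rangle> = ?a \<odot> \<langle>i, u\<rangle> \<and>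
        (f \<odot> ?i) \<odot> \<langle>i, u\<rangle> = (g \<odot> ?i) \<odot> \<langle>i, u\<rangle>"
    using comprehension[OF definable_conj[OF d1 d2]] by blast
  have "c \<odot> e = c' \<odot> e"
  proof (rule extensionality)
    fix u i assume ui: "tgt E u = src E e" "tgt E i = ?I" "src E i = src E u"
    have "f \<odot> i = g \<odot> i" if xi: "x \<odot> i = e \<odot> u"
    proof -
      obtain h where h: "src E h = src E u" "tgt E h = src E p" "p \<odot> h = i"
        by (rule pullback_lift[OF pb, of i u]) (use ui xi in simp_all)
      then show ?thesis using square_cmp[OF fg(4), of h] fg ty by simp
    qed
    then show "member ?I i ((c \<odot> e) \<odot> u) \<longleftrightarrow> member ?I i ((c' \<odot> e) \<odot> u)"
      using c(1) c'(1) c(3)[of "e \<odot> u" i] c'(3)[of "e \<odot> u" i] ui fg ty by auto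
  qed (use c c' in simp_all)
  then have "c = c'" using c c' by - (rule epicD[OF e], simp_all)
  then show "f = g"
    using c(3)[of x "ident E ?I"] c'(3)[of x "ident E ?I"] ty fg by simp
qed

end

section \<open>Sets with vanishing products in a commutative ring\<close>

definition products_vanish :: "('a, 'b) ring_scheme \<Rightarrow> nat \<Rightarrow> 'a set \<Rightarrow> bool" where
  "products_vanish R k X \<longleftrightarrow> (\<forall>f\<in>{..k} \<rightarrow> X. (\<Otimes>\<^bsub>R\<^esub>l\<in>{..k}. f l) = \<zero>\<^bsub>R\<^esub>)"

lemma products_vanish_mono: "products_vanish R k X \<Longrightarrow> Y \<subseteq> X \<Longrightarrow> products_vanish R k Y"
  unfolding products_vanish_def by blast

context cring
begin

lemma finprod_remove:
  assumes "finite A" "i \<in> A" "f \<in> A \<rightarrow> carrier R"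
  shows "finprod R f A = f i \<otimes> finprod R f (A - {i})"
  using finprod_insert[of "A - {i}" i f] assms by (auto simp: insert_absorb)

lemma finprod_zero:
  assumes "finite A" "i \<in> A" "f \<in> A \<rightarrow> carrier R" "f i = \<zero>"
  shows "finprod R f A = \<zero>"
proof -
  have "finprod R f (A - {i}) \<in> carrier R"
    using assms(3) by (intro finprod_closed) auto
  then show ?thesis by (simp add: finprod_remove[OF assms(1-3)] assms(4))
qed

text \<open>
  The annihilator of the annihilator of \<open>X\<close>. It contains the ideal generated by \<open>X\<close>, and it replaces
  that ideal because the vanishing of products passes to it without any expansion into sums.
\<close>

definition double_ann :: "'a set \<Rightarrow> 'a set" where
  "double_ann X = {a \<in> carrier R. \<forall>b\<in>carrier R. (\<forall>x\<in>X. b \<otimes> x = \<zero>) \<longrightarrow> b \<otimes> a = \<zero>}"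

lemma double_ann_carrier: "a \<in> double_ann X \<Longrightarrow> a \<in> carrier R"
  by (simp add: double_ann_def)

lemma subset_double_ann: "X \<subseteq> carrier R \<Longrightarrow> X \<subseteq> double_ann X"
  by (auto simp: double_ann_def)

lemma double_ann_zero: "\<zero> \<in> double_ann X"
  by (simp add: double_ann_def)

lemma double_ann_add: "\<lbrakk>a \<in> double_ann X; b \<in> double_ann X\<rbrakk> \<Longrightarrow> a \<oplus> b \<in> double_ann X"
  by (auto simp: double_ann_def r_distr)

lemma double_ann_mult:
  assumes "X \<subseteq> carrier R" "r \<in> carrier R" "a \<in> double_ann X"
  shows "r \<otimes> a \<in> double_ann X"
  unfolding double_ann_def
proof (intro CollectI conjI ballI impI)
  show "r \<otimes> a \<in> carrier R" using assms double_ann_carrier by simp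
  fix b assume b: "b \<in> carrier R" "\<forall>x\<in>X. b \<otimes> x = \<zero>"
  have "(b \<otimes> r) \<otimes> x = \<zero>" if "x \<in> X" for x
  proof -
    have x: "x \<in> carrier R" using that assms by blast
    have "(b \<otimes> r) \<otimes> x = r \<otimes> (b \<otimes> x)" using x b assms by algebra
    then show ?thesis using that b assms by simp
  qed
  then have "(b \<otimes> r) \<otimes> a = \<zero>" using assms b by (simp add: double_ann_def)
  then show "b \<otimes> (r \<otimes> a) = \<zero>" using assms b double_ann_carrier by (simp add: m_assoc)
qed

text \<open>
  The factors are exchanged one at a time: the product of the other factors annihilates \<open>X\<close>, hence also
  annihilates the double annihilator of \<open>X\<close>.
\<close>

lemma products_vanish_double_ann:
  assumes X: "X \<subseteq> carrier R" and v: "products_vanish R k X"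
  shows "products_vanish R k (double_ann X)"
proof -
  have *: "finprod R f {..k} = \<zero>" if "\<forall>l\<le>k. f l \<in> (if l < m then double_ann X else X)" for m f
    using that
  proof (induction m arbitrary: f)
    case 0
    then show ?case using v by (simp add: products_vanish_def)
  next
    case (Suc m)
    show ?case
    proof (cases "m \<le> k")
      case False
      then show ?thesis using Suc.prems by (intro Suc.IH) auto
    next
      case True
      have fc: "f \<in> {..k} \<rightarrow> carrier R"
        using Suc.prems X double_ann_carrier by (auto split: if_splits)
      let ?b = "finprod R f ({..k} - {m})"
      have b: "?b \<in> carrier R" using fc by (intro finprod_closed) auto
      \<comment> \<open>Replacing the factor at \<open>m\<close> by \<open>x\<close> gives a product to which the induction hypothesis applies.\<close>
      have "?b \<otimes> x = \<zero>" if x: "x \<in> X" for x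
      proof -
        have c: "f(m := x) \<in> {..k} \<rightarrow> carrier R" using fc x X by auto
        have "finprod R (f(m := x)) {..k} = \<zero>"
          using Suc.prems x by (intro Suc.IH) (auto simp: less_Suc_eq)
        moreover have "finprod R (f(m := x)) {..k} = x \<otimes> finprod R (f(m := x)) ({..k} - {m})"
          using finprod_remove[OF _ _ c, of m] True by simp
        moreover have "finprod R (f(m := x)) ({..k} - {m}) = ?b"
          using fc by (intro finprod_cong) (auto simp: simp_implies_def)
        ultimately show ?thesis using b x X by (auto simp: m_comm)
      qed
      moreover have "f m \<in> double_ann X" using Suc.prems True by auto
      ultimately have "?b \<otimes> f m = \<zero>" using b by (simp add: double_ann_def)
      then show ?thesis
        using finprod_remove[OF _ _ fc, of m] True b double_ann_carrier[OF \<open>f m \<in> double_ann X\<close>]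
        by (simp add: m_comm)
    qed
  qed
  show ?thesis unfolding products_vanish_def
    by (auto intro!: *[of _ "Suc k"])
qed

text \<open>
  Congruence modulo the double annihilator of \<open>X\<close> is compatible with the operations from which polynomials
  are built; this lemma and those for sums, powers and finite products and sums treat them in turn.
\<close>

lemma double_ann_diff_mult:
  assumes "X \<subseteq> carrier R" "a \<in> carrier R" "b \<in> carrier R" "c \<in> carrier R" "d \<in> carrier R"
    "a \<ominus> b \<in> double_ann X" "c \<ominus> d \<in> double_ann X"
  shows "(a \<otimes> c) \<ominus> (b \<otimes> d) \<in> double_ann X"
proof -
  have "(a \<otimes> c) \<ominus> (b \<otimes> d) = a \<otimes> (c \<ominus> d) \<oplus> d \<otimes> (a \<ominus> b)"
    using assms(2-5) by algebra
  then show ?thesis using assms by (simp add: double_ann_add double_ann_mult)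
qed

lemma double_ann_diff_add:
  assumes "a \<in> carrier R" "b \<in> carrier R" "c \<in> carrier R" "d \<in> carrier R"
    "a \<ominus> b \<in> double_ann X" "c \<ominus> d \<in> double_ann X"
  shows "(a \<oplus> c) \<ominus> (b \<oplus> d) \<in> double_ann X"
proof -
  have "(a \<oplus> c) \<ominus> (b \<oplus> d) = (a \<ominus> b) \<oplus> (c \<ominus> d)"
    using assms(1-4) by algebra
  then show ?thesis using assms by (simp add: double_ann_add)
qed

lemma diff_self: "a \<in> carrier R \<Longrightarrow> a \<ominus> a = \<zero>"
  by (simp add: a_minus_def r_neg)

lemma double_ann_diff_pow:
  assumes "X \<subseteq> carrier R" "a \<in> carrier R" "b \<in> carrier R" "a \<ominus> b \<in> double_ann X"
  shows "(a [^] (e::nat)) \<ominus> (b [^] e) \<in> double_ann X"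
  using assms by (induction e) (simp_all add: diff_self double_ann_zero double_ann_diff_mult)

lemma double_ann_diff_finprod:
  assumes X: "X \<subseteq> carrier R" and "finite A" "f \<in> A \<rightarrow> carrier R" "g \<in> A \<rightarrow> carrier R"
    "\<And>i. i \<in> A \<Longrightarrow> f i \<ominus> g i \<in> double_ann X"
  shows "finprod R f A \<ominus> finprod R g A \<in> double_ann X"
  using assms(2-)
proof (induction A rule: finite_induct)
  case empty
  then show ?case by (simp add: diff_self double_ann_zero)
next
  case (insert i A)
  then have "f \<in> A \<rightarrow> carrier R" "g \<in> A \<rightarrow> carrier R" by auto
  with insert X show ?case by (simp add: double_ann_diff_mult)
qed

lemma double_ann_diff_finsum:
  assumes "finite A" "f \<in> A \<rightarrow> carrier R" "g \<in> A \<rightarrow> carrier R"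
    "\<And>i. i \<in> A \<Longrightarrow> f i \<ominus> g i \<in> double_ann X"
  shows "finsum R f A \<ominus> finsum R g A \<in> double_ann X"
  using assms
proof (induction A rule: finite_induct)
  case empty
  then show ?case by (simp add: diff_self double_ann_zero)
next
  case (insert i A)
  then have "f \<in> A \<rightarrow> carrier R" "g \<in> A \<rightarrow> carrier R" by auto
  with insert show ?case by (simp add: double_ann_diff_add)
qed

end

lemma (in ring_hom_cring) hom_minus: "\<lbrakk>x \<in> carrier R; y \<in> carrier R\<rbrakk> \<Longrightarrow> h (x \<ominus> y) = h x \<ominus>\<^bsub>S\<^esub> h y"
  by (simp add: a_minus_def R.minus_eq S.minus_eq)

lemma (in ring_hom_cring) products_vanish_hom:
  assumes "X \<subseteq> carrier R" "products_vanish R k X"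
  shows "products_vanish S k (h ` X)"
  unfolding products_vanish_def
proof
  fix f assume f: "f \<in> {..k} \<rightarrow> h ` X"
  then have "\<forall>l\<in>{..k}. \<exists>x. x \<in> X \<and> f l = h x" by auto
  then obtain g where g: "\<forall>l\<in>{..k}. g l \<in> X \<and> f l = h (g l)" by metis
  then have gX: "g \<in> {..k} \<rightarrow> X" and gc: "g \<in> {..k} \<rightarrow> carrier R" using assms(1) by auto
  have "finprod S f {..k} = finprod S (h \<circ> g) {..k}"
    using g gc by (intro S.finprod_cong) (auto simp: simp_implies_def Pi_iff)
  also have "\<dots> = h (finprod R g {..k})" using gc by (simp only: hom_finprod)
  also have "\<dots> = \<zero>\<^bsub>S\<^esub>" using assms(2) gX by (simp add: products_vanish_def)
  finally show "finprod S f {..k} = \<zero>\<^bsub>S\<^esub>" .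
qed

lemma (in cring) double_ann_mono: "X \<subseteq> Y \<Longrightarrow> double_ann X \<subseteq> double_ann Y"
  by (auto simp: double_ann_def)

lemma (in cring) products_vanish_zero: "products_vanish R k {\<zero>}"
  unfolding products_vanish_def by (auto intro!: finprod_zero[where i = 0] simp: Pi_iff)

lemma (in cring) diff_cancel_base:
  assumes "a \<in> carrier R" "b \<in> carrier R" "c \<in> carrier R"
  shows "(a \<ominus> c) \<ominus> (b \<ominus> c) = a \<ominus> b"
  using assms by algebra

section \<open>The line at each stage\<close>

context sdg_model
begin

interpretation R: cring "\<R> I" for I
  by (rule stage_cring)

lemma carrier_iff: "x \<in> carrier (\<R> I) \<longleftrightarrow> src E x = I \<and> tgt E x = line E"
  by (simp add: stage_ring_def hom_iff)

text \<open>
  Change of stage is a ring homomorphism. It moves equations between ring terms from a generic element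
  to arbitrary elements and to later stages.
\<close>

lemma restrict_hom:
  assumes "tgt E u = I"
  shows "ring_hom_cring (\<R> I) (\<R> (src E u)) (\<lambda>x. x \<odot> u)"
proof -
  note homs = rzero_hom[unfolded hom_iff] rone_hom[unfolded hom_iff]
    radd_hom[unfolded hom_iff] rmul_hom[unfolded hom_iff]
  have "(\<lambda>x. x \<odot> u) \<in> ring_hom (\<R> I) (\<R> (src E u))"
    using assms homs by (intro ring_hom_memI) (simp_all add: stage_ring_def hom_iff)
  then show ?thesis
    by (intro ring_hom_cring.intro ring_hom_cring_axioms.intro stage_cring)
qed

lemma rc_carrier: "\<lbrakk>src E x = I; tgt E x = Rn n; j < n\<rbrakk> \<Longrightarrow> rc n j x \<in> carrier (\<R> I)"
  by (simp add: carrier_iff)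

lemma tup_map_typing:
  assumes "\<And>j. j < n \<Longrightarrow> f j \<in> carrier (\<R> I)"
  shows "src E (tup I (map f [0..<n])) = I" "tgt E (tup I (map f [0..<n])) = Rn n"
    "j < n \<Longrightarrow> rc n j (tup I (map f [0..<n])) = f j"
proof -
  have ty: "\<forall>x\<in>set (map f [0..<n]). src E x = I \<and> tgt E x = line E"
    using assms by (auto simp: carrier_iff)
  show "tgt E (tup I (map f [0..<n])) = Rn n" using tgt_tup[OF ty] by simp
  show "src E (tup I (map f [0..<n])) = I" using ty by (intro src_tup) blast
  show "j < n \<Longrightarrow> rc n j (tup I (map f [0..<n])) = f j"
    by (subst coord_tup[OF ty]) simp_all
qed

lemma vzero_typing [simp]: "src E (vzero n I) = I" "tgt E (vzero n I) = Rn n"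
  and rc_vzero [simp]: "j < n \<Longrightarrow> rc n j (vzero n I) = \<zero>\<^bsub>\<R> I\<^esub>"
  unfolding vzero_def by (simp_all add: tup_map_typing)

lemma vec_ops_typing:
  assumes "src E x = I" "tgt E x = Rn n" "src E y = I" "tgt E y = Rn n" "a \<in> carrier (\<R> I)"
  shows "src E (vadd n I x y) = I" "tgt E (vadd n I x y) = Rn n"
    "src E (vdiff n I x y) = I" "tgt E (vdiff n I x y) = Rn n"
    "src E (vscale n I a x) = I" "tgt E (vscale n I a x) = Rn n"
    "j < n \<Longrightarrow> rc n j (vadd n I x y) = rc n j x \<oplus>\<^bsub>\<R> I\<^esub> rc n j y"
    "j < n \<Longrightarrow> rc n j (vdiff n I x y) = rc n j x \<ominus>\<^bsub>\<R> I\<^esub> rc n j y"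
    "j < n \<Longrightarrow> rc n j (vscale n I a x) = a \<otimes>\<^bsub>\<R> I\<^esub> rc n j x"
  unfolding vadd_def vdiff_def vscale_def using assms
  by (simp_all add: tup_map_typing rc_carrier)

section \<open>Infinitesimals in coordinates\<close>

abbreviation index_choices :: "nat \<Rightarrow> nat \<Rightarrow> nat list list" where
  "index_choices k n \<equiv> List.n_lists (Suc k) [0..<n]"

abbreviation generic_products :: "nat \<Rightarrow> nat \<Rightarrow> 'm list" where
  "generic_products k n \<equiv> map (\<lambda>js. \<Otimes>\<^bsub>\<R> (Rn n)\<^esub>l\<in>{..<Suc k}. rc n (js ! l) (ident E (Rn n)))
     (index_choices k n)"

abbreviation generic_zeros :: "nat \<Rightarrow> nat \<Rightarrow> 'm list" where
  "generic_zeros k n \<equiv> map (\<lambda>js. \<zero>\<^bsub>\<R> (Rn n)\<^esub>) (index_choices k n)"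

lemma index_choices_bound:
  assumes "js \<in> set (index_choices k n)" "l \<le> k"
  shows "js ! l < n"
proof -
  have "length js = Suc k" "set js \<subseteq> {..<n}" using assms(1) unfolding set_n_lists by auto
  then show ?thesis using assms(2) by (metis le_imp_less_Suc lessThan_iff nth_mem subsetD)
qed

lemma generic_factors:
  "js \<in> set (index_choices k n) \<Longrightarrow>
    (\<lambda>l. rc n (js ! l) (ident E (Rn n))) \<in> {..<Suc k} \<rightarrow> carrier (\<R> (Rn n))"
  using index_choices_bound by (auto intro!: rc_carrier simp del: n_lists.simps)

lemma generic_products_elements:
    "\<forall>x\<in>set (generic_products k n). src E x = Rn n \<and> tgt E x = line E"
  and generic_zeros_elements:
    "\<forall>x\<in>set (generic_zeros k n). src E x = Rn n \<and> tgt E x = line E"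
  using R.finprod_closed[OF generic_factors] R.zero_closed[of "Rn n"]
  by (auto simp: carrier_iff simp del: n_lists.simps)

lemma generic_tuples_typing:
  "src E (tup (Rn n) (generic_products k n)) = Rn n" "src E (tup (Rn n) (generic_zeros k n)) = Rn n"
  "tgt E (tup (Rn n) (generic_products k n)) = tgt E (tup (Rn n) (generic_zeros k n))"
proof -
  show "src E (tup (Rn n) (generic_products k n)) = Rn n"
    by (rule src_tup) (use generic_products_elements in blast)
  show "src E (tup (Rn n) (generic_zeros k n)) = Rn n"
    by (rule src_tup) (use generic_zeros_elements in blast)
  show "tgt E (tup (Rn n) (generic_products k n)) = tgt E (tup (Rn n) (generic_zeros k n))"
    unfolding tgt_tup[OF generic_products_elements] tgt_tup[OF generic_zeros_elements] by simp
qed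

lemma Dinc_eq: "Dinc k n = eqz E (tup (Rn n) (generic_products k n)) (tup (Rn n) (generic_zeros k n))"
  by (simp only: Dinc_def Let_def)

lemma lies_in_Dinc:
  assumes "src E v = I" "tgt E v = Rn n"
  shows "lies_in v (Dinc k n) \<longleftrightarrow> products_vanish (\<R> I) k ((\<lambda>j. rc n j v) ` {..<n})"
proof -
  let ?V = "Rn n" and ?L = "index_choices k n"
  let ?p = "\<lambda>js. \<Otimes>\<^bsub>\<R> ?V\<^esub>l\<in>{..<Suc k}. rc n (js ! l) (ident E ?V)"
  have Lt: "js ! l < n" if "js \<in> set ?L" "l < Suc k" for js l
    using that index_choices_bound less_Suc_eq_le by blast
  note c = generic_factors[of _ k n] and ty1 = generic_products_elements[where n=n and k=k]
    and ty2 = generic_zeros_elements[where n=n and k=k]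
  interpret r: ring_hom_cring "\<R> ?V" "\<R> I" "\<lambda>x. x \<odot> v"
    using restrict_hom[of v ?V] assms by simp
  have pv: "?p js \<odot> v = (\<Otimes>\<^bsub>\<R> I\<^esub>l\<in>{..k}. rc n (js ! l) v)" if js: "js \<in> set ?L" for js
  proof -
    have "?p js \<odot> v = (\<Otimes>\<^bsub>\<R> I\<^esub>l\<in>{..<Suc k}. ((\<lambda>x. x \<odot> v) \<circ> (\<lambda>l. rc n (js ! l) (ident E ?V))) l)"
      by (rule r.hom_finprod[OF c[OF js]])
    also have "\<dots> = (\<Otimes>\<^bsub>\<R> I\<^esub>l\<in>{..<Suc k}. rc n (js ! l) v)"
      using Lt[OF js] assms
      by (intro R.finprod_cong) (auto simp: simp_implies_def coord_cmp intro!: rc_carrier)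
    finally show ?thesis by (simp only: lessThan_Suc_atMost)
  qed
  have "lies_in v (Dinc k n) \<longleftrightarrow> tup ?V (map ?p ?L) \<odot> v = tup ?V (map (\<lambda>js. \<zero>\<^bsub>\<R> ?V\<^esub>) ?L) \<odot> v"
    unfolding Dinc_eq using generic_tuples_typing[of n k] assms by (intro eqz_factor) simp_all
  also have "\<dots> \<longleftrightarrow> tup I (map (\<lambda>x. x \<odot> v) (map ?p ?L)) =
      tup I (map (\<lambda>x. x \<odot> v) (map (\<lambda>js. \<zero>\<^bsub>\<R> ?V\<^esub>) ?L))"
    using tup_cmp[OF ty1 assms(2)] tup_cmp[OF ty2 assms(2)] assms(1) by simp
  also have "\<dots> \<longleftrightarrow> map (\<lambda>x. x \<odot> v) (map ?p ?L) = map (\<lambda>x. x \<odot> v) (map (\<lambda>js. \<zero>\<^bsub>\<R> ?V\<^esub>) ?L)"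
  proof
    assume eq: "tup I (map (\<lambda>x. x \<odot> v) (map ?p ?L)) =
      tup I (map (\<lambda>x. x \<odot> v) (map (\<lambda>js. \<zero>\<^bsub>\<R> ?V\<^esub>) ?L))"
    show "map (\<lambda>x. x \<odot> v) (map ?p ?L) = map (\<lambda>x. x \<odot> v) (map (\<lambda>js. \<zero>\<^bsub>\<R> ?V\<^esub>) ?L)"
      by (rule tup_inject[OF _ _ _ eq, where X = "line E"]) (use ty1 ty2 assms R.zero_closed[of I] in \<open>auto simp: carrier_iff simp del: n_lists.simps\<close>)
  qed (rule arg_cong)
  also have "\<dots> \<longleftrightarrow> (\<forall>js\<in>set ?L. (\<Otimes>\<^bsub>\<R> I\<^esub>l\<in>{..k}. rc n (js ! l) v) = \<zero>\<^bsub>\<R> I\<^esub>)"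
    using pv by (auto simp: r.hom_zero simp del: n_lists.simps)
  also have "\<dots> \<longleftrightarrow> products_vanish (\<R> I) k ((\<lambda>j. rc n j v) ` {..<n})"
  proof
    assume *: "\<forall>js\<in>set ?L. (\<Otimes>\<^bsub>\<R> I\<^esub>l\<in>{..k}. rc n (js ! l) v) = \<zero>\<^bsub>\<R> I\<^esub>"
    show "products_vanish (\<R> I) k ((\<lambda>j. rc n j v) ` {..<n})"
      unfolding products_vanish_def
    proof
      fix f assume f: "f \<in> {..k} \<rightarrow> (\<lambda>j. rc n j v) ` {..<n}"
      then have "\<forall>l\<in>{..k}. \<exists>j. j < n \<and> f l = rc n j v" by auto
      then obtain g where g: "\<forall>l\<in>{..k}. g l < n \<and> f l = rc n (g l) v" by metis
      have "map g [0..<Suc k] \<in> set ?L" using g unfolding set_n_lists by auto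
      with * have "(\<Otimes>\<^bsub>\<R> I\<^esub>l\<in>{..k}. rc n (map g [0..<Suc k] ! l) v) = \<zero>\<^bsub>\<R> I\<^esub>" by blast
      moreover have "(\<Otimes>\<^bsub>\<R> I\<^esub>l\<in>{..k}. f l) = (\<Otimes>\<^bsub>\<R> I\<^esub>l\<in>{..k}. rc n (map g [0..<Suc k] ! l) v)"
        using g assms
        by (intro R.finprod_cong) (auto simp: simp_implies_def less_Suc_eq_le simp del: upt_Suc intro!: rc_carrier)
      ultimately show "(\<Otimes>\<^bsub>\<R> I\<^esub>l\<in>{..k}. f l) = \<zero>\<^bsub>\<R> I\<^esub>" by simp
    qed
  next
    assume "products_vanish (\<R> I) k ((\<lambda>j. rc n j v) ` {..<n})"
    then show "\<forall>js\<in>set ?L. (\<Otimes>\<^bsub>\<R> I\<^esub>l\<in>{..k}. rc n (js ! l) v) = \<zero>\<^bsub>\<R> I\<^esub>"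
      unfolding products_vanish_def using Lt by (auto simp: less_Suc_eq_le simp del: n_lists.simps)
  qed
  finally show ?thesis .
qed

lemma tuples_iff: "xs \<in> tuples I X p \<longleftrightarrow> length xs = p \<and> (\<forall>x\<in>set xs. src E x = I \<and> tgt E x = X)"
  by (auto simp: tuples_def hom_iff)

text \<open>
  Expanding \<open>v\<close> in the standard basis writes \<open>\<Phi>(v)\<close> as a combination of values of \<open>\<Phi>\<close> with the coordinates
  of \<open>v\<close> as coefficients. The expansion is done by adding one coordinate at a time.
\<close>

lemma linear_annihilated:
  assumes \<Phi>: "\<And>x. \<lbrakk>src E x = J; tgt E x = Rn n\<rbrakk> \<Longrightarrow> \<Phi> x \<in> carrier (\<R> J)"
    and add: "\<And>x y. \<lbrakk>src E x = J; tgt E x = Rn n; src E y = J; tgt E y = Rn n\<rbrakk> \<Longrightarrow>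
      \<Phi> (vadd n J x y) = \<Phi> x \<oplus>\<^bsub>\<R> J\<^esub> \<Phi> y"
    and scale: "\<And>a x. \<lbrakk>a \<in> carrier (\<R> J); src E x = J; tgt E x = Rn n\<rbrakk> \<Longrightarrow>
      \<Phi> (vscale n J a x) = a \<otimes>\<^bsub>\<R> J\<^esub> \<Phi> x"
    and v: "src E v = J" "tgt E v = Rn n" and c: "c \<in> carrier (\<R> J)"
    and ann: "\<And>j x. \<lbrakk>j < n; src E x = J; tgt E x = Rn n\<rbrakk> \<Longrightarrow>
      (c \<otimes>\<^bsub>\<R> J\<^esub> rc n j v) \<otimes>\<^bsub>\<R> J\<^esub> \<Phi> x = \<zero>\<^bsub>\<R> J\<^esub>"
  shows "c \<otimes>\<^bsub>\<R> J\<^esub> \<Phi> v = \<zero>\<^bsub>\<R> J\<^esub>"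
proof -
  \<comment> \<open>The vector \<open>v\<close> cut off after its first \<open>m\<close> coordinates.\<close>
  define t where "t m = tup J (map (\<lambda>j. if j < m then rc n j v else \<zero>\<^bsub>\<R> J\<^esub>) [0..<n])" for m
  have t: "src E (t m) = J" "tgt E (t m) = Rn n"
    "\<And>j. j < n \<Longrightarrow> rc n j (t m) = (if j < m then rc n j v else \<zero>\<^bsub>\<R> J\<^esub>)" for m
    unfolding t_def using v by (simp_all add: tup_map_typing rc_carrier)
  have "c \<otimes>\<^bsub>\<R> J\<^esub> \<Phi> (t m) = \<zero>\<^bsub>\<R> J\<^esub>" if "m \<le> n" for m
    using that
  proof (induction m)
    case 0
    have "t 0 = vscale n J \<zero>\<^bsub>\<R> J\<^esub> v"
      by (rule coord_eqI[where X = "line E" and n = n])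
        (use v t in \<open>simp_all add: vec_ops_typing rc_carrier\<close>)
    then show ?case using scale[of "\<zero>\<^bsub>\<R> J\<^esub>" v] v c \<Phi>[of v] by simp
  next
    case (Suc m)
    define e where "e = tup J (map (\<lambda>j. if j = m then \<one>\<^bsub>\<R> J\<^esub> else \<zero>\<^bsub>\<R> J\<^esub>) [0..<n])"
    have e: "src E e = J" "tgt E e = Rn n"
      "\<And>j. j < n \<Longrightarrow> rc n j e = (if j = m then \<one>\<^bsub>\<R> J\<^esub> else \<zero>\<^bsub>\<R> J\<^esub>)"
      unfolding e_def by (simp_all add: tup_map_typing)
    have vm: "rc n m v \<in> carrier (\<R> J)" using v Suc.prems by (simp add: rc_carrier)
    let ?s = "vscale n J (rc n m v) e"
    have s: "src E ?s = J" "tgt E ?s = Rn n"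
      "\<And>j. j < n \<Longrightarrow> rc n j ?s = rc n m v \<otimes>\<^bsub>\<R> J\<^esub> rc n j e"
      using vec_ops_typing[OF e(1,2) e(1,2) vm] by simp_all
    have "t (Suc m) = vadd n J (t m) ?s"
    proof (rule coord_eqI[where X = "line E" and n = n])
      fix j assume j: "j < n"
      show "rc n j (t (Suc m)) = rc n j (vadd n J (t m) ?s)"
        using j vm v vec_ops_typing(7)[OF t(1,2) s(1,2) vm j]
        by (auto simp: t(3) s(3) e(3) rc_carrier less_Suc_eq)
    qed (use t s vm in \<open>simp_all add: vec_ops_typing\<close>)
    then have "\<Phi> (t (Suc m)) = \<Phi> (t m) \<oplus>\<^bsub>\<R> J\<^esub> rc n m v \<otimes>\<^bsub>\<R> J\<^esub> \<Phi> e"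
      using add t s e vm scale by simp
    moreover have "c \<otimes>\<^bsub>\<R> J\<^esub> (rc n m v \<otimes>\<^bsub>\<R> J\<^esub> \<Phi> e) = \<zero>\<^bsub>\<R> J\<^esub>"
      using ann[of m e] Suc.prems e vm c \<Phi> by (simp add: R.m_assoc)
    ultimately show ?case
      using Suc \<Phi> t e vm c by (simp add: R.r_distr)
  qed
  moreover have "t n = v"
    by (rule coord_eqI[where X = "line E" and n = n]) (use v t in simp_all)
  ultimately show ?thesis by auto
qed

text \<open>
  Full expansion of a multilinear form, in the arguments from position \<open>t\<close> on. The factor \<open>c\<close> collects the
  coordinates taken from the arguments already treated, which makes the induction go through.
\<close>

lemma multilinear_annihilated:
  assumes "multilinear r n J \<phi>" "t \<le> r" "ws \<in> tuples J (Rn n) r" "c \<in> carrier (\<R> J)"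
    "\<And>js. (\<forall>l\<in>{t..<r}. js l < n) \<Longrightarrow>
      c \<otimes>\<^bsub>\<R> J\<^esub> (\<Otimes>\<^bsub>\<R> J\<^esub>l\<in>{t..<r}. rc n (js l) (ws ! l)) = \<zero>\<^bsub>\<R> J\<^esub>"
  shows "c \<otimes>\<^bsub>\<R> J\<^esub> (\<phi> \<odot> \<langle>ident E J, tup J ws\<rangle>) = \<zero>\<^bsub>\<R> J\<^esub>"
  using assms(2-)
proof (induction "r - t" arbitrary: t c ws)
  case 0
  then have "c = \<zero>\<^bsub>\<R> J\<^esub>" by simp
  moreover have "\<phi> \<odot> \<langle>ident E J, tup J ws\<rangle> \<in> carrier (\<R> J)"
    using assms(1) "0.prems"(2) tgt_tup[of ws J "Rn n"]
    by (simp add: multilinear_def hom_iff carrier_iff tuples_iff)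
  ultimately show ?case by simp
next
  case (Suc d)
  then have tr: "t < r" and ws: "length ws = r" "\<forall>x\<in>set ws. src E x = J \<and> tgt E x = Rn n"
    by (simp_all add: tuples_iff)
  let ?\<Phi> = "\<lambda>x. \<phi> \<odot> \<langle>ident E J, tup J (ws[t := x])\<rangle>"
  have upd: "ws[t := x] \<in> tuples J (Rn n) r" if "src E x = J" "tgt E x = Rn n" for x
    using that ws set_update_subset_insert[of ws t x] by (auto simp: tuples_iff)
  have ml: "(\<forall>x\<in>hom J (Rn n). \<forall>y\<in>hom J (Rn n). ?\<Phi> (vadd n J x y) = ?\<Phi> x \<oplus>\<^bsub>\<R> J\<^esub> ?\<Phi> y) \<and>
      (\<forall>a\<in>hom J (line E). \<forall>x\<in>hom J (Rn n). ?\<Phi> (vscale n J a x) = a \<otimes>\<^bsub>\<R> J\<^esub> ?\<Phi> x)"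
    using assms(1) Suc.prems(2) tr ident_hom[of J] unfolding multilinear_def Let_def by blast
  have v: "src E (ws ! t) = J" "tgt E (ws ! t) = Rn n" using ws tr by (simp_all add: nth_mem)
  have "c \<otimes>\<^bsub>\<R> J\<^esub> ?\<Phi> (ws ! t) = \<zero>\<^bsub>\<R> J\<^esub>"
  proof (rule linear_annihilated[where n = n and \<Phi> = ?\<Phi>])
    fix x assume x: "src E x = J" "tgt E x = Rn n"
    show "?\<Phi> x \<in> carrier (\<R> J)"
      using assms(1) upd[OF x] tgt_tup[of "ws[t := x]" J "Rn n"]
      by (simp add: multilinear_def hom_iff carrier_iff tuples_iff)
    fix j assume j: "j < n"
    have vj: "rc n j (ws ! t) \<in> carrier (\<R> J)" using v j by (simp add: rc_carrier)
    show "(c \<otimes>\<^bsub>\<R> J\<^esub> rc n j (ws ! t)) \<otimes>\<^bsub>\<R> J\<^esub> ?\<Phi> x = \<zero>\<^bsub>\<R> J\<^esub>"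
    proof (rule Suc.hyps(1)[OF _ _ upd[OF x]])
      show "d = r - Suc t" using Suc.hyps(2) by simp
      show "Suc t \<le> r" using tr by simp
      show "c \<otimes>\<^bsub>\<R> J\<^esub> rc n j (ws ! t) \<in> carrier (\<R> J)" using vj Suc.prems(3) by simp
      fix js :: "nat \<Rightarrow> nat" assume js: "\<forall>l\<in>{Suc t..<r}. js l < n"
      have split: "{t..<r} = insert t {Suc t..<r}" using tr by auto
      have cl: "(\<lambda>l. rc n (js l) (ws ! l)) \<in> {Suc t..<r} \<rightarrow> carrier (\<R> J)"
        using js ws by (auto intro!: rc_carrier simp: nth_mem)
      have "(\<Otimes>\<^bsub>\<R> J\<^esub>l\<in>{Suc t..<r}. rc n (js l) (ws[t := x] ! l)) =
          (\<Otimes>\<^bsub>\<R> J\<^esub>l\<in>{Suc t..<r}. rc n (js l) (ws ! l))"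
        using cl by (intro R.finprod_cong) (auto simp: simp_implies_def)
      moreover have "(\<Otimes>\<^bsub>\<R> J\<^esub>l\<in>{t..<r}. rc n ((js(t := j)) l) (ws ! l)) =
          rc n j (ws ! t) \<otimes>\<^bsub>\<R> J\<^esub> (\<Otimes>\<^bsub>\<R> J\<^esub>l\<in>{Suc t..<r}. rc n (js l) (ws ! l))"
      proof -
        have cl': "(\<lambda>l. rc n ((js(t := j)) l) (ws ! l)) \<in> {Suc t..<r} \<rightarrow> carrier (\<R> J)"
          using js ws by (auto intro!: rc_carrier simp: nth_mem)
        have "(\<Otimes>\<^bsub>\<R> J\<^esub>l\<in>{Suc t..<r}. rc n ((js(t := j)) l) (ws ! l)) =
            (\<Otimes>\<^bsub>\<R> J\<^esub>l\<in>{Suc t..<r}. rc n (js l) (ws ! l))"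
          using cl by (intro R.finprod_cong) (auto simp: simp_implies_def)
        then show ?thesis unfolding split using cl' vj by (subst R.finprod_insert) simp_all
      qed
      moreover have "c \<otimes>\<^bsub>\<R> J\<^esub> (\<Otimes>\<^bsub>\<R> J\<^esub>l\<in>{t..<r}. rc n ((js(t := j)) l) (ws ! l)) = \<zero>\<^bsub>\<R> J\<^esub>"
        using js j by (intro Suc.prems(4)) auto
      ultimately show "(c \<otimes>\<^bsub>\<R> J\<^esub> rc n j (ws ! t)) \<otimes>\<^bsub>\<R> J\<^esub>
          (\<Otimes>\<^bsub>\<R> J\<^esub>l\<in>{Suc t..<r}. rc n (js l) (ws[t := x] ! l)) = \<zero>\<^bsub>\<R> J\<^esub>"
        using Suc.prems(3) vj R.finprod_closed[OF cl] by (simp add: R.m_assoc)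
    qed
  qed (use ml v Suc.prems(3) in \<open>simp_all add: hom_iff carrier_iff\<close>)
  then show ?case by simp
qed

text \<open>
  Products of coordinates are themselves multilinear forms, and conversely every multilinear form is a
  combination of them.
\<close>

lemma DN_iff:
  assumes vs: "vs \<in> tuples I (Rn n) (Suc k)"
  shows "vs \<in> DN k n I \<longleftrightarrow>
    (\<forall>v\<in>set vs. products_vanish (\<R> I) k ((\<lambda>j. rc n j v) ` {..<n})) \<and>
    (\<forall>js\<in>{..k} \<rightarrow> {..<n}. (\<Otimes>\<^bsub>\<R> I\<^esub>l\<in>{..k}. rc n (js l) (vs ! l)) = \<zero>\<^bsub>\<R> I\<^esub>)" (is "_ \<longleftrightarrow> ?D \<and> ?P")
proof
  have len: "length vs = Suc k" and vt: "\<forall>v\<in>set vs. src E v = I \<and> tgt E v = Rn n"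
    using vs by (simp_all add: tuples_iff)
  let ?X = "pw (Rn n) (Suc k)"
  {
    assume DN: "vs \<in> DN k n I"
    then have "?D" using vt by (auto simp: DN_def lies_in_Dinc)
    moreover have "?P"
    proof
      fix js assume js: "js \<in> {..k} \<rightarrow> {..<n}"
      let ?W = "prd E I ?X"
      let ?g = "\<lambda>l. rc n (js l) (coord (Rn n) (Suc k) l (prj2 E I ?X))"
      \<comment> \<open>The multilinear form that multiplies the coordinate \<open>js l\<close> of the argument number \<open>l\<close>.\<close>
      define \<phi> where "\<phi> = (\<Otimes>\<^bsub>\<R> ?W\<^esub>l\<in>{..k}. ?g l)"
      have gc: "?g \<in> {..k} \<rightarrow> carrier (\<R> ?W)"
        using js by (auto intro!: rc_carrier simp del: pw.simps)
      have \<phi>c: "\<phi> \<in> carrier (\<R> ?W)" unfolding \<phi>_def using gc by (rule R.finprod_closed)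
      have eval: "\<phi> \<odot> \<langle>w, tup K xs\<rangle> = (\<Otimes>\<^bsub>\<R> K\<^esub>l\<in>{..k}. rc n (js l) (xs ! l))"
        if w: "src E w = K" "tgt E w = I" and xs: "xs \<in> tuples K (Rn n) (Suc k)" for K w xs
      proof -
        have xt: "\<forall>x\<in>set xs. src E x = K \<and> tgt E x = Rn n" and xl: "length xs = Suc k"
          using xs by (simp_all add: tuples_iff)
        have tt: "src E (tup K xs) = K" "tgt E (tup K xs) = ?X"
          using xt tgt_tup[OF xt] xl by simp_all
        interpret r: ring_hom_cring "\<R> ?W" "\<R> K" "\<lambda>x. x \<odot> \<langle>w, tup K xs\<rangle>"
          using restrict_hom[of "\<langle>w, tup K xs\<rangle>" ?W] w tt by (simp del: pw.simps)
        have "\<phi> \<odot> \<langle>w, tup K xs\<rangle> = (\<Otimes>\<^bsub>\<R> K\<^esub>l\<in>{..k}. ((\<lambda>x. x \<odot> \<langle>w, tup K xs\<rangle>) \<circ> ?g) l)"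
          unfolding \<phi>_def using gc by (rule r.hom_finprod)
        also have "\<dots> = (\<Otimes>\<^bsub>\<R> K\<^esub>l\<in>{..k}. rc n (js l) (xs ! l))"
        proof (rule R.finprod_cong')
          show "(\<lambda>l. rc n (js l) (xs ! l)) \<in> {..k} \<rightarrow> carrier (\<R> K)"
            using js xt xl by (auto intro!: rc_carrier simp: nth_mem)
          fix l assume "l \<in> {..k}"
          then have l: "l < Suc k" "js l < n" using js by auto
          have "?g l \<odot> \<langle>w, tup K xs\<rangle> = rc n (js l) (coord (Rn n) (Suc k) l (tup K xs))"
            using l w tt by (simp add: coord_cmp del: pw.simps)
          also have "\<dots> = rc n (js l) (xs ! l)"
            using coord_tup[OF xt xl l(1)] by simp
          finally show "((\<lambda>x. x \<odot> \<langle>w, tup K xs\<rangle>) \<circ> ?g) l = rc n (js l) (xs ! l)" by simp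
        qed simp
        finally show ?thesis .
      qed
      have "multilinear (Suc k) n I \<phi>"
        unfolding multilinear_def Let_def
      proof (intro conjI allI ballI impI)
        show "\<phi> \<in> hom ?W (line E)" using \<phi>c by (simp add: carrier_iff hom_iff)
        fix K w xs l assume w: "w \<in> hom K I" and xs: "xs \<in> tuples K (Rn n) (Suc k)" and l: "l < Suc k"
        have upd: "xs[l := x] \<in> tuples K (Rn n) (Suc k)" if "src E x = K" "tgt E x = Rn n" for x
          using that xs set_update_subset_insert[of xs l x] by (auto simp: tuples_iff)
        let ?r = "\<Otimes>\<^bsub>\<R> K\<^esub>i\<in>{..k} - {l}. rc n (js i) (xs ! i)"
        have oc: "(\<lambda>i. rc n (js i) (xs ! i)) \<in> {..k} - {l} \<rightarrow> carrier (\<R> K)"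
          using js xs by (auto intro!: rc_carrier simp: nth_mem tuples_iff)
        have rc: "?r \<in> carrier (\<R> K)" using oc by (rule R.finprod_closed)
        have jl: "js l < n" using js l by auto
        have ev: "\<phi> \<odot> \<langle>w, tup K (xs[l := x])\<rangle> = rc n (js l) x \<otimes>\<^bsub>\<R> K\<^esub> ?r"
          if x: "src E x = K" "tgt E x = Rn n" for x
        proof -
          have c: "(\<lambda>i. rc n (js i) (xs[l := x] ! i)) \<in> {..k} \<rightarrow> carrier (\<R> K)"
            using js upd[OF x] by (fastforce intro!: rc_carrier simp: tuples_iff)
          have "\<phi> \<odot> \<langle>w, tup K (xs[l := x])\<rangle> = (\<Otimes>\<^bsub>\<R> K\<^esub>i\<in>{..k}. rc n (js i) (xs[l := x] ! i))"
            using w by (intro eval upd x) (simp_all add: hom_iff)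
          also have "\<dots> = rc n (js l) (xs[l := x] ! l) \<otimes>\<^bsub>\<R> K\<^esub>
              (\<Otimes>\<^bsub>\<R> K\<^esub>i\<in>{..k} - {l}. rc n (js i) (xs[l := x] ! i))"
            using l by (intro R.finprod_remove c) auto
          also have "(\<Otimes>\<^bsub>\<R> K\<^esub>i\<in>{..k} - {l}. rc n (js i) (xs[l := x] ! i)) = ?r"
            by (rule R.finprod_cong'[OF refl oc]) auto
          finally show ?thesis using xs l by (simp add: tuples_iff)
        qed
        fix x assume "x \<in> hom K (Rn n)"
        then have x: "src E x = K" "tgt E x = Rn n" by (simp_all add: hom_iff)
        have xc: "rc n (js l) x \<in> carrier (\<R> K)" using x jl by (rule rc_carrier)
        { fix y assume "y \<in> hom K (Rn n)"
          then have y: "src E y = K" "tgt E y = Rn n" by (simp_all add: hom_iff)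
          have yc: "rc n (js l) y \<in> carrier (\<R> K)" using y jl by (rule rc_carrier)
          show "\<phi> \<odot> \<langle>w, tup K (xs[l := vadd n K x y])\<rangle> =
              \<phi> \<odot> \<langle>w, tup K (xs[l := x])\<rangle> \<oplus>\<^bsub>\<R> K\<^esub> \<phi> \<odot> \<langle>w, tup K (xs[l := y])\<rangle>"
            using vec_ops_typing(1,2,7)[OF x y R.zero_closed] jl xc yc rc
            by (simp add: ev x y R.l_distr) }
        fix a assume "a \<in> hom K (line E)"
        then have a: "a \<in> carrier (\<R> K)" by (simp add: carrier_iff hom_iff)
        show "\<phi> \<odot> \<langle>w, tup K (xs[l := vscale n K a x])\<rangle> = a \<otimes>\<^bsub>\<R> K\<^esub> \<phi> \<odot> \<langle>w, tup K (xs[l := x])\<rangle>"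
          using vec_ops_typing(5,6,9)[OF x x a] jl xc rc a
          by (simp add: ev x R.m_assoc)
      qed
      then have "\<phi> \<odot> \<langle>ident E I, tup I (map (\<lambda>v. v \<odot> ident E I) vs)\<rangle> = \<zero>\<^bsub>\<R> I\<^esub>"
        using DN ident_hom[of I] unfolding DN_def by blast
      moreover have "map (\<lambda>v. v \<odot> ident E I) vs = vs" using vt by (intro map_idI) simp
      ultimately show "(\<Otimes>\<^bsub>\<R> I\<^esub>l\<in>{..k}. rc n (js l) (vs ! l)) = \<zero>\<^bsub>\<R> I\<^esub>"
        using eval[of "ident E I" I vs] vs by simp
    qed
    ultimately show "?D \<and> ?P" by blast
  next
    assume *: "?D \<and> ?P"
    show "vs \<in> DN k n I"
      unfolding DN_def
    proof (intro CollectI conjI ballI allI impI)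
      fix J u \<phi> assume u: "u \<in> hom J I" and \<phi>: "multilinear (Suc k) n J \<phi>"
      let ?ws = "map (\<lambda>v. v \<odot> u) vs"
      have ut: "src E u = J" "tgt E u = I" using u by (simp_all add: hom_iff)
      interpret r: ring_hom_cring "\<R> I" "\<R> J" "\<lambda>x. x \<odot> u"
        using restrict_hom[of u I] ut by simp
      have ws: "?ws \<in> tuples J (Rn n) (Suc k)" using vs ut by (auto simp: tuples_iff)
      have "\<one>\<^bsub>\<R> J\<^esub> \<otimes>\<^bsub>\<R> J\<^esub> (\<phi> \<odot> \<langle>ident E J, tup J ?ws\<rangle>) = \<zero>\<^bsub>\<R> J\<^esub>"
      proof (rule multilinear_annihilated[OF \<phi> _ ws, of 0])
        fix js :: "nat \<Rightarrow> nat" assume "\<forall>l\<in>{0..<Suc k}. js l < n"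
        then have js: "js \<in> {..k} \<rightarrow> {..<n}" by auto
        have c: "(\<lambda>l. rc n (js l) (vs ! l)) \<in> {..k} \<rightarrow> carrier (\<R> I)"
          using js vt len by (auto intro!: rc_carrier simp: nth_mem)
        have c': "(\<lambda>l. rc n (js l) (?ws ! l)) \<in> {..k} \<rightarrow> carrier (\<R> J)"
          using js vt len ut by (auto intro!: rc_carrier simp: nth_mem)
        have "(\<Otimes>\<^bsub>\<R> J\<^esub>l\<in>{..k}. rc n (js l) (?ws ! l)) =
            (\<Otimes>\<^bsub>\<R> J\<^esub>l\<in>{..k}. ((\<lambda>x. x \<odot> u) \<circ> (\<lambda>l. rc n (js l) (vs ! l))) l)"
        proof (rule R.finprod_cong')
          fix l assume "l \<in> {..k}"
          then have "l < length vs" "js l < n" using js len by auto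
          then show "rc n (js l) (?ws ! l) = ((\<lambda>x. x \<odot> u) \<circ> (\<lambda>l. rc n (js l) (vs ! l))) l"
            using vt ut by (simp add: coord_cmp nth_mem)
        qed (use r.hom_closed c in \<open>auto simp: Pi_iff\<close>)
        also have "\<dots> = (\<Otimes>\<^bsub>\<R> I\<^esub>l\<in>{..k}. rc n (js l) (vs ! l)) \<odot> u"
          using r.hom_finprod[OF c] by simp
        also have "\<dots> = \<zero>\<^bsub>\<R> J\<^esub>" using * js r.hom_zero by simp
        finally show "\<one>\<^bsub>\<R> J\<^esub> \<otimes>\<^bsub>\<R> J\<^esub> (\<Otimes>\<^bsub>\<R> J\<^esub>l\<in>{0..<Suc k}. rc n (js l) (?ws ! l)) = \<zero>\<^bsub>\<R> J\<^esub>"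
          by (simp add: atLeast0LessThan lessThan_Suc_atMost)
      qed simp_all
      moreover have "\<phi> \<odot> \<langle>ident E J, tup J ?ws\<rangle> \<in> carrier (\<R> J)"
        using \<phi> ws tgt_tup[of ?ws J "Rn n"]
        by (simp add: multilinear_def hom_iff carrier_iff tuples_iff del: pw.simps)
      ultimately show "\<phi> \<odot> \<langle>ident E J, tup J ?ws\<rangle> = \<zero>\<^bsub>\<R> J\<^esub>" by simp
    qed (use * vs vt in \<open>auto simp: lies_in_Dinc\<close>)
  }
qed

section \<open>The neighbour relation in coordinates\<close>

definition coord_diffs :: "nat \<Rightarrow> 'o \<Rightarrow> 'm list \<Rightarrow> 'm set" where
  "coord_diffs n I Ps =
    {rc n c P \<ominus>\<^bsub>\<R> I\<^esub> rc n c Q | c P Q. c < n \<and> P \<in> set Ps \<and> Q \<in> set Ps}"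

lemma coord_diffs_carrier:
  assumes "\<forall>P\<in>set Ps. src E P = I \<and> tgt E P = Rn n"
  shows "coord_diffs n I Ps \<subseteq> carrier (\<R> I)"
  using assms by (auto simp: coord_diffs_def intro!: R.minus_closed rc_carrier)

lemma coord_diffs_constant:
  assumes "\<forall>P\<in>set Ps. P = Q" "src E Q = I" "tgt E Q = Rn n"
  shows "products_vanish (\<R> I) k (coord_diffs n I Ps)"
proof (rule products_vanish_mono[OF R.products_vanish_zero])
  show "coord_diffs n I Ps \<subseteq> {\<zero>\<^bsub>\<R> I\<^esub>}"
  proof
    fix a assume "a \<in> coord_diffs n I Ps"
    then obtain c P P' where "c < n" "P \<in> set Ps" "P' \<in> set Ps" "a = rc n c P \<ominus>\<^bsub>\<R> I\<^esub> rc n c P'"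
      by (auto simp: coord_diffs_def)
    moreover from this have "P = Q" "P' = Q" using assms(1) by blast+
    ultimately show "a \<in> {\<zero>\<^bsub>\<R> I\<^esub>}" using assms(2,3) by (simp add: R.diff_self rc_carrier)
  qed
qed

text \<open>
  A factor with \<open>i\<^sub>l = j\<^sub>l\<close> is zero, so the products that range over distinct indices decide about all of them.
  The products in which every factor uses the same pair of points say that the difference of these points
  lies in \<open>D\<^sub>k(n)\<close>.
\<close>

lemma Rn_rel_iff:
  assumes Ps: "\<forall>P\<in>set Ps. src E P = I \<and> tgt E P = Rn n"
  shows "Rn_rel k n I Ps \<longleftrightarrow> products_vanish (\<R> I) k (coord_diffs n I Ps)"
proof
  let ?p = "length Ps"
  have P: "src E (Ps ! i) = I" "tgt E (Ps ! i) = Rn n" if "i < ?p" for i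
    using Ps that by (simp_all add: nth_mem)
  let ?vs = "\<lambda>i j. map (\<lambda>l. vdiff n I (Ps ! i l) (Ps ! j l)) [0..<Suc k]"
  have vd: "src E (vdiff n I (Ps ! i) (Ps ! j)) = I" "tgt E (vdiff n I (Ps ! i) (Ps ! j)) = Rn n"
    "c < n \<Longrightarrow> rc n c (vdiff n I (Ps ! i) (Ps ! j)) = rc n c (Ps ! i) \<ominus>\<^bsub>\<R> I\<^esub> rc n c (Ps ! j)"
    if "i < ?p" "j < ?p" for i j c
    using vec_ops_typing[OF P(1,2)[OF that(1)] P(1,2)[OF that(2)] R.zero_closed] by simp_all
  have vs: "?vs i j \<in> tuples I (Rn n) (Suc k)" if "i \<in> {..k} \<rightarrow> {..<?p}" "j \<in> {..k} \<rightarrow> {..<?p}" for i j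
    using that by (auto simp: tuples_iff vd Pi_iff less_Suc_eq_le simp del: upt_Suc)
  have nth: "?vs i j ! l = vdiff n I (Ps ! i l) (Ps ! j l)" if "l \<le> k" for i j l
    using that by (simp add: less_Suc_eq_le del: upt_Suc)
  {
    assume rel: "Rn_rel k n I Ps"
    show "products_vanish (\<R> I) k (coord_diffs n I Ps)"
      unfolding products_vanish_def
    proof
      fix f assume f: "f \<in> {..k} \<rightarrow> coord_diffs n I Ps"
      then have fc: "f \<in> {..k} \<rightarrow> carrier (\<R> I)" using coord_diffs_carrier[OF Ps] by blast
      have "\<forall>l\<in>{..k}. \<exists>c i j. c < n \<and> i < ?p \<and> j < ?p \<and>
          f l = rc n c (Ps ! i) \<ominus>\<^bsub>\<R> I\<^esub> rc n c (Ps ! j)"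
        using f unfolding coord_diffs_def Pi_iff by (fastforce simp: in_set_conv_nth)
      then obtain c i j where
        cij: "\<forall>l\<in>{..k}. c l < n \<and> i l < ?p \<and> j l < ?p \<and>
          f l = rc n (c l) (Ps ! i l) \<ominus>\<^bsub>\<R> I\<^esub> rc n (c l) (Ps ! j l)"
        by metis
      show "(\<Otimes>\<^bsub>\<R> I\<^esub>l\<in>{..k}. f l) = \<zero>\<^bsub>\<R> I\<^esub>"
      proof (cases "\<exists>l\<le>k. i l = j l")
        case True
        then obtain l where l: "l \<le> k" "i l = j l" by blast
        then have "f l = \<zero>\<^bsub>\<R> I\<^esub>" using cij P by (auto simp: R.diff_self rc_carrier)
        then show ?thesis using l fc by (intro R.finprod_zero) auto
      next
        case False
        then have "i 0 \<noteq> j 0" "i 0 < ?p" "j 0 < ?p" using cij by auto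
        then have "?p \<ge> 2" by linarith
        moreover have ij: "i \<in> {..k} \<rightarrow> {..<?p}" "j \<in> {..k} \<rightarrow> {..<?p}" using cij by auto
        ultimately have "?vs i j \<in> DN k n I"
          using rel False unfolding Rn_rel_def by blast
        then have "(\<Otimes>\<^bsub>\<R> I\<^esub>l\<in>{..k}. rc n (c l) (?vs i j ! l)) = \<zero>\<^bsub>\<R> I\<^esub>"
          using DN_iff[OF vs[OF ij]] cij by (auto simp: Pi_iff)
        moreover have "(\<Otimes>\<^bsub>\<R> I\<^esub>l\<in>{..k}. rc n (c l) (?vs i j ! l)) = (\<Otimes>\<^bsub>\<R> I\<^esub>l\<in>{..k}. f l)"
          by (rule R.finprod_cong'[OF refl fc]) (use cij vd nth in simp)
        ultimately show ?thesis by simp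
      qed
    qed
  next
    assume van: "products_vanish (\<R> I) k (coord_diffs n I Ps)"
    have mem: "rc n c (vdiff n I (Ps ! i) (Ps ! j)) \<in> coord_diffs n I Ps" if "i < ?p" "j < ?p" "c < n" for i j c
      using that by (auto simp: coord_diffs_def vd intro!: exI[of _ c] nth_mem)
    show "Rn_rel k n I Ps"
      unfolding Rn_rel_def
    proof (intro impI ballI)
      fix i j assume ij: "i \<in> {..k} \<rightarrow> {..<?p}" "j \<in> {..k} \<rightarrow> {..<?p}"
      show "?vs i j \<in> DN k n I"
        unfolding DN_iff[OF vs[OF ij]]
      proof (intro conjI ballI)
        fix v assume "v \<in> set (?vs i j)"
        then obtain l where l: "l \<le> k" "v = vdiff n I (Ps ! i l) (Ps ! j l)"
          by (auto simp: less_Suc_eq_le simp del: upt_Suc)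
        show "products_vanish (\<R> I) k ((\<lambda>j. rc n j v) ` {..<n})"
          by (rule products_vanish_mono[OF van]) (use l ij mem in \<open>auto simp: Pi_iff\<close>)
      next
        fix js assume js: "js \<in> {..k} \<rightarrow> {..<n}"
        have "rc n (js l) (?vs i j ! l) \<in> coord_diffs n I Ps" if "l \<le> k" for l
          unfolding nth[OF that] using that ij js by (intro mem) auto
        then show "(\<Otimes>\<^bsub>\<R> I\<^esub>l\<in>{..k}. rc n (js l) (?vs i j ! l)) = \<zero>\<^bsub>\<R> I\<^esub>"
          using van unfolding products_vanish_def by blast
      qed
    qed
  }
qed

section \<open>Maps out of infinitesimals\<close>

lemma Dinc_typing [simp]: "src E (Dinc k n) = D k n" "tgt E (Dinc k n) = Rn n"
  and Dinc_monic: "monic (Dinc k n)"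
proof -
  show "src E (Dinc k n) = D k n" by (simp add: D_def)
  show "tgt E (Dinc k n) = Rn n" "monic (Dinc k n)"
    using generic_tuples_typing[of n k] by (simp_all add: Dinc_eq eqz_monic)
qed

lemma Dzero_typing [simp]: "src E (Dzero k n I) = I" "tgt E (Dzero k n I) = D k n"
  and Dinc_Dzero [simp]: "Dinc k n \<odot> Dzero k n I = vzero n I"
proof -
  have "lies_in (vzero n I) (Dinc k n)"
    unfolding lies_in_Dinc[OF vzero_typing]
    by (rule products_vanish_mono[OF R.products_vanish_zero]) auto
  then obtain d where d: "src E d = I" "tgt E d = D k n" "Dinc k n \<odot> d = vzero n I"
    by (rule lies_inE) simp
  have "\<exists>!d. d \<in> hom I (D k n) \<and> Dinc k n \<odot> d = vzero n I"
  proof (rule ex1I)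
    show "d \<in> hom I (D k n) \<and> Dinc k n \<odot> d = vzero n I" using d by (simp add: hom_iff)
    fix d' assume "d' \<in> hom I (D k n) \<and> Dinc k n \<odot> d' = vzero n I"
    then show "d' = d" using d by - (rule monicD[OF Dinc_monic], simp_all add: hom_iff)
  qed
  from theI'[OF this] show "src E (Dzero k n I) = I" "tgt E (Dzero k n I) = D k n"
    "Dinc k n \<odot> Dzero k n I = vzero n I"
    by (simp_all add: Dzero_def hom_iff)
qed

lemma finite_multi_indices: "finite (multi_indices n k)"
proof (rule finite_subset)
  show "multi_indices n k \<subseteq> {xs. set xs \<subseteq> {..k} \<and> length xs = n}"
    using member_le_sum_list by (force simp: multi_indices_def)
  show "finite {xs. set xs \<subseteq> {..k} \<and> length xs = n}" by (rule finite_lists_length_eq) simp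
qed

text \<open>
  A polynomial in \<open>x\<close> is congruent to the same polynomial in \<open>y\<close> modulo the coordinate differences.
\<close>

lemma kock_lawvere_differences:
  assumes kn: "k \<ge> 1" "n \<ge> 1" and t: "src E t = prd E J (D k n)" "tgt E t = line E"
    and d: "src E d = J" "tgt E d = D k n" and d': "src E d' = J" "tgt E d' = D k n"
  shows "t \<odot> \<langle>ident E J, d\<rangle> \<ominus>\<^bsub>\<R> J\<^esub> t \<odot> \<langle>ident E J, d'\<rangle> \<in>
    R.double_ann J ((\<lambda>c. rc n c (Dinc k n \<odot> d) \<ominus>\<^bsub>\<R> J\<^esub> rc n c (Dinc k n \<odot> d')) ` {..<n})" (is "_ \<in> R.double_ann J ?X")
proof -
  have "t \<in> hom (prd E J (D k n)) (line E)" using t by (simp add: hom_iff)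
  from ex1_implies_ex[OF kock_lawvere[OF kn, unfolded kock_lawvere_def, THEN spec[of _ J], THEN bspec, OF this]]
  obtain a where a: "a \<in> multi_indices n k \<rightarrow>\<^sub>E hom J (line E)"
    and val: "\<forall>K. \<forall>u\<in>hom K J. \<forall>d\<in>hom K (D k n).
      t \<odot> \<langle>u, d\<rangle> = poly_value n k K (\<lambda>\<alpha>. a \<alpha> \<odot> u) (Dinc k n \<odot> d)"
    by blast
  have ac: "a \<alpha> \<odot> ident E J \<in> carrier (\<R> J)" if "\<alpha> \<in> multi_indices n k" for \<alpha>
    using a that by (auto simp: carrier_iff hom_iff PiE_iff)
  have x: "rc n c (Dinc k n \<odot> d) \<in> carrier (\<R> J)" "rc n c (Dinc k n \<odot> d') \<in> carrier (\<R> J)"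
    if "c < n" for c using that d d' by (simp_all add: rc_carrier)
  have X: "?X \<subseteq> carrier (\<R> J)" using x by auto
  have XB: "rc n c (Dinc k n \<odot> d) \<ominus>\<^bsub>\<R> J\<^esub> rc n c (Dinc k n \<odot> d') \<in> R.double_ann J ?X" if "c < n" for c
    using R.subset_double_ann[OF X] that by blast
  have "poly_value n k J (\<lambda>\<alpha>. a \<alpha> \<odot> ident E J) (Dinc k n \<odot> d) \<ominus>\<^bsub>\<R> J\<^esub>
      poly_value n k J (\<lambda>\<alpha>. a \<alpha> \<odot> ident E J) (Dinc k n \<odot> d') \<in> R.double_ann J ?X"
    unfolding poly_value_def
  proof (rule R.double_ann_diff_finsum[OF finite_multi_indices])
    fix \<alpha> assume \<alpha>: "\<alpha> \<in> multi_indices n k"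
    show "a \<alpha> \<odot> ident E J \<otimes>\<^bsub>\<R> J\<^esub> (\<Otimes>\<^bsub>\<R> J\<^esub>j\<in>{..<n}. rc n j (Dinc k n \<odot> d) [^]\<^bsub>\<R> J\<^esub> (\<alpha> ! j)) \<ominus>\<^bsub>\<R> J\<^esub>
        a \<alpha> \<odot> ident E J \<otimes>\<^bsub>\<R> J\<^esub> (\<Otimes>\<^bsub>\<R> J\<^esub>j\<in>{..<n}. rc n j (Dinc k n \<odot> d') [^]\<^bsub>\<R> J\<^esub> (\<alpha> ! j)) \<in> R.double_ann J ?X"
      using x ac[OF \<alpha>] XB
      by (intro R.double_ann_diff_mult X R.double_ann_diff_finprod R.double_ann_diff_pow R.finprod_closed)
        (auto simp: R.diff_self R.double_ann_zero)
  qed (use x ac in auto)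
  then show ?thesis
    using val[rule_format, of "ident E J" J d] val[rule_format, of "ident E J" J d'] d d'
    by (simp add: hom_iff)
qed

text \<open>
  The coordinate differences of the values lie in the double annihilator of the coordinate differences of
  the arguments.
\<close>

lemma map_preserves_neighbours:
  assumes kn: "k \<ge> 1" "n \<ge> 1" and g: "src E g = prd E J (D k n)" "tgt E g = Rn m"
    and ds: "\<forall>d\<in>set ds. src E d = J \<and> tgt E d = D k n"
    and van: "products_vanish (\<R> J) k (coord_diffs n J (map (\<lambda>d. Dinc k n \<odot> d) ds))"
  shows "products_vanish (\<R> J) k (coord_diffs m J (map (\<lambda>d. g \<odot> \<langle>ident E J, d\<rangle>) ds))"
proof (rule products_vanish_mono)
  let ?X = "coord_diffs n J (map (\<lambda>d. Dinc k n \<odot> d) ds)"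
  have X: "?X \<subseteq> carrier (\<R> J)" using ds by (intro coord_diffs_carrier) auto
  show "products_vanish (\<R> J) k (R.double_ann J ?X)" by (rule R.products_vanish_double_ann[OF X van])
  show "coord_diffs m J (map (\<lambda>d. g \<odot> \<langle>ident E J, d\<rangle>) ds) \<subseteq> R.double_ann J ?X"
  proof
    fix b assume "b \<in> coord_diffs m J (map (\<lambda>d. g \<odot> \<langle>ident E J, d\<rangle>) ds)"
    then obtain c d d' where c: "c < m" and d: "d \<in> set ds" "d' \<in> set ds"
      and b: "b = rc m c (g \<odot> \<langle>ident E J, d\<rangle>) \<ominus>\<^bsub>\<R> J\<^esub> rc m c (g \<odot> \<langle>ident E J, d'\<rangle>)"
      by (auto simp: coord_diffs_def)
    have dt: "src E d = J" "tgt E d = D k n" "src E d' = J" "tgt E d' = D k n" using d ds by auto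
    have "rc m c g \<odot> \<langle>ident E J, d\<rangle> \<ominus>\<^bsub>\<R> J\<^esub> rc m c g \<odot> \<langle>ident E J, d'\<rangle> \<in>
        R.double_ann J ((\<lambda>c. rc n c (Dinc k n \<odot> d) \<ominus>\<^bsub>\<R> J\<^esub> rc n c (Dinc k n \<odot> d')) ` {..<n})"
      using c g dt by (intro kock_lawvere_differences kn) simp_all
    also have "\<dots> \<subseteq> R.double_ann J ?X"
      using d by (intro R.double_ann_mono) (auto simp: coord_diffs_def)
    finally show "b \<in> R.double_ann J ?X" unfolding b using c g dt by (simp add: coord_cmp)
  qed
qed

section \<open>Charts\<close>

lemma fibre_iff: "y \<in> fibre U q u \<longleftrightarrow> src E y = src E u \<and> tgt E y = U \<and> q \<odot> y = u"
  by (auto simp: fibre_def hom_iff)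

lemma formally_open_typing:
  assumes "formally_open I U q \<iota> X"
  shows "src E q = U" "tgt E q = I" "src E \<iota> = U" "tgt E \<iota> = X" "monic \<langle>q, \<iota>\<rangle>"
  using assms by (simp_all add: formally_open_def hom_iff)

lemma formally_open_inject:
  assumes o: "formally_open I U q \<iota> X" and y: "y \<in> fibre U q u" "y' \<in> fibre U q u"
    and eq: "\<iota> \<odot> y = \<iota> \<odot> y'"
  shows "y = y'"
  using y eq formally_open_typing(1-4)[OF o]
  by - (rule monicD[OF formally_open_typing(5)[OF o]], simp_all add: fibre_iff)

lemma pair_prj_ident: "\<langle>prj1 E X Y, prj2 E X Y\<rangle> = ident E (prd E X Y)"
  using pair_prj[of "ident E (prd E X Y)" X Y] by simp

text \<open>
  Formal openness at the generic element of \<open>D\<^sub>k(n)\<close>: a map that starts in \<open>U\<close> factors through \<open>U\<close> as a whole.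
\<close>

lemma formally_open_lift:
  assumes o: "formally_open I U q \<iota> X" and kn: "k \<ge> 1" "n \<ge> 1"
    and u: "src E u = J" "tgt E u = I" and t: "src E t = prd E J (D k n)" "tgt E t = X"
    and y: "y \<in> fibre U q u" "\<iota> \<odot> y = t \<odot> \<langle>ident E J, Dzero k n J\<rangle>"
  obtains z where "src E z = prd E J (D k n)" "tgt E z = U"
    "q \<odot> z = u \<odot> prj1 E J (D k n)" "\<iota> \<odot> z = t"
proof -
  let ?p = "prj1 E J (D k n)" and ?d = "prj2 E J (D k n)"
  have "u \<in> hom J I" "t \<in> hom (prd E J (D k n)) X"
    "?p \<in> hom (prd E J (D k n)) J" "?d \<in> hom (prd E J (D k n)) (D k n)"
    using u t by (simp_all add: hom_iff)
  then have "\<exists>z\<in>fibre U q (u \<odot> ?p). \<iota> \<odot> z = t \<odot> \<langle>?p, ?d\<rangle>"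
    using o y kn unfolding formally_open_def by blast
  then obtain z where "z \<in> fibre U q (u \<odot> ?p)" "\<iota> \<odot> z = t" using t by (auto simp: pair_prj_ident)
  then show ?thesis using that u by (auto simp: fibre_iff)
qed

lemma vadd_cmp:
  assumes "src E x = I" "tgt E x = Rn n" "src E y = I" "tgt E y = Rn n" "tgt E w = I"
  shows "vadd n I x y \<odot> w = vadd n (src E w) (x \<odot> w) (y \<odot> w)"
proof -
  interpret r: ring_hom_cring "\<R> I" "\<R> (src E w)" "\<lambda>x. x \<odot> w"
    using assms(5) by (rule restrict_hom)
  note t = vec_ops_typing(1,2,7)[OF assms(1-4) R.zero_closed]
  have t': "src E (vadd n (src E w) (x \<odot> w) (y \<odot> w)) = src E w"
    "tgt E (vadd n (src E w) (x \<odot> w) (y \<odot> w)) = Rn n"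
    "\<And>j. j < n \<Longrightarrow> rc n j (vadd n (src E w) (x \<odot> w) (y \<odot> w)) =
      rc n j (x \<odot> w) \<oplus>\<^bsub>\<R> (src E w)\<^esub> rc n j (y \<odot> w)"
    using vec_ops_typing(1,2,7)[of "x \<odot> w" "src E w" n "y \<odot> w" "\<zero>\<^bsub>\<R> (src E w)\<^esub>"] assms by simp_all
  show ?thesis
  proof (rule coord_eqI[where X = "line E" and n = n])
    fix j assume j: "j < n"
    have "rc n j (vadd n I x y \<odot> w) = (rc n j x \<oplus>\<^bsub>\<R> I\<^esub> rc n j y) \<odot> w"
      using j t assms coord_cmp[of "vadd n I x y" "line E" n j w] by simp
    also have "\<dots> = rc n j x \<odot> w \<oplus>\<^bsub>\<R> (src E w)\<^esub> rc n j y \<odot> w"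
      using j assms by (intro r.hom_add) (simp_all add: rc_carrier)
    finally show "rc n j (vadd n I x y \<odot> w) = rc n j (vadd n (src E w) (x \<odot> w) (y \<odot> w))"
      using j assms t'(3)[OF j] by (simp add: coord_cmp)
  qed (use t t' assms in simp_all)
qed

lemma vadd_vzero:
  assumes "src E x = I" "tgt E x = Rn n"
  shows "vadd n I x (vzero n I) = x"
proof (rule coord_eqI[where X = "line E" and n = n])
  fix j assume j: "j < n"
  then show "rc n j (vadd n I x (vzero n I)) = rc n j x"
    using vec_ops_typing(7)[OF assms vzero_typing R.zero_closed j] assms by (simp add: rc_carrier)
qed (use vec_ops_typing(1,2)[OF assms vzero_typing R.zero_closed] assms in simp_all)

lemma vadd_vdiff:
  assumes x: "src E x = I" "tgt E x = Rn n" and y: "src E y = I" "tgt E y = Rn n"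
  shows "vadd n I x (vdiff n I y x) = y"
proof (rule coord_eqI[where X = "line E" and n = n])
  note d = vec_ops_typing(3,4,8)[OF y x R.zero_closed]
  fix j assume j: "j < n"
  have c: "rc n j x \<in> carrier (\<R> I)" "rc n j y \<in> carrier (\<R> I)" using x y j by (simp_all add: rc_carrier)
  have "rc n j x \<oplus>\<^bsub>\<R> I\<^esub> (rc n j y \<ominus>\<^bsub>\<R> I\<^esub> rc n j x) = rc n j y"
    using c by (simp add: R.minus_eq R.a_lcomm[of "rc n j x" I] R.r_neg)
  then show "rc n j (vadd n I x (vdiff n I y x)) = rc n j y"
    using vec_ops_typing(7)[OF x d(1,2) R.zero_closed j] d(3)[OF j] by simp
qed (use vec_ops_typing(1,2)[OF x vec_ops_typing(3,4)[OF y x R.zero_closed] R.zero_closed] y in simp_all)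

lemma chart_rel_iff:
  assumes "\<forall>y\<in>set ys. src E y = src E u \<and> tgt E y = src E \<phi>" "tgt E \<phi> = Rn n"
  shows "chart_rel k n \<phi> u ys \<longleftrightarrow>
    products_vanish (\<R> (src E u)) k (coord_diffs n (src E u) (map (\<lambda>y. \<phi> \<odot> y) ys))"
  unfolding chart_rel_def using assms by (intro Rn_rel_iff) auto

text \<open>
  The central local fact. Every member of \<open>ys\<close> has the form \<open>y\<^sub>0 + d\<close> with \<open>d\<close> in \<open>D\<^sub>k(n)\<close>, and the two charts
  lift \<open>d \<mapsto> y\<^sub>0 + d\<close> to a map \<open>z\<close> into \<open>U\<close> and its composite with \<open>F\<close> to a map \<open>z'\<close> into \<open>V\<close>. The coordinates
  of \<open>z'\<close> are polynomial in \<open>d\<close>. For \<open>n = 0\<close> all members of \<open>ys\<close> coincide; the other case uses \<open>D\<^sub>k(n)\<close> with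
  \<open>n \<ge> 1\<close>, to which formal openness and the Kock--Lawvere axiom apply.
\<close>

lemma transport_neighbours:
  assumes k: "k \<ge> 1"
    and A: "chart n K U q \<iota> \<phi> A" and u: "src E u = L" "tgt E u = K"
    and ys: "set ys \<subseteq> fibre U q u" "chart_rel k n \<phi> u ys" and y0: "y0 \<in> set ys"
    and B: "chart m K' V r \<kappa> \<psi> B" and v: "src E v = L" "tgt E v = K'"
    and F: "src E F = prd E L A" "tgt E F = B"
    and z0: "z0 \<in> fibre V r v" "\<kappa> \<odot> z0 = F \<odot> \<langle>ident E L, \<iota> \<odot> y0\<rangle>"
  obtains zs where "length zs = length ys" "set zs \<subseteq> fibre V r v" "chart_rel k m \<psi> v zs"
    "map (\<lambda>z. \<kappa> \<odot> z) zs = map (\<lambda>y. F \<odot> \<langle>ident E L, \<iota> \<odot> y\<rangle>) ys"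
proof -
  have oU: "formally_open K U q \<iota> A" and o\<phi>: "formally_open K U q \<phi> (Rn n)"
    using A by (simp_all add: chart_def)
  have oV: "formally_open K' V r \<kappa> B" and o\<psi>: "formally_open K' V r \<psi> (Rn m)"
    using B by (simp_all add: chart_def)
  note ty = formally_open_typing[OF oU] formally_open_typing[OF o\<phi>]
    formally_open_typing[OF oV] formally_open_typing[OF o\<psi>]
  have yt: "src E y = L" "tgt E y = U" "q \<odot> y = u" if "y \<in> set ys" for y
    using that ys(1) u by (auto simp: fibre_iff)
  have zt: "src E z0 = L" "tgt E z0 = V" "r \<odot> z0 = v" using z0(1) v by (auto simp: fibre_iff)
  show ?thesis
  proof (cases "n = 0")
    case True
    have "y = y0" if "y \<in> set ys" for y
    proof (rule formally_open_inject[OF o\<phi>])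
      show "\<phi> \<odot> y = \<phi> \<odot> y0"
        using yt[OF that] yt[OF y0] ty True by (intro terminal_unique) simp_all
    qed (use that y0 ys in auto)
    moreover have "chart_rel k m \<psi> v (map (\<lambda>_. z0) ys)"
      using zt v ty by (subst chart_rel_iff) (auto intro!: coord_diffs_constant[where Q = "\<psi> \<odot> z0"])
    ultimately show ?thesis
      using z0 by (intro that[of "map (\<lambda>_. z0) ys"]) auto
  next
    case False
    then have n: "n \<ge> 1" by simp
    let ?W = "prd E L (D k n)"
    let ?p = "prj1 E L (D k n)" and ?d = "prj2 E L (D k n)"
    let ?o = "\<langle>ident E L, Dzero k n L\<rangle>"
    \<comment> \<open>In coordinates, the map \<open>d \<mapsto> y\<^sub>0 + d\<close>.\<close>
    define t where "t = vadd n ?W (\<phi> \<odot> (y0 \<odot> ?p)) (Dinc k n \<odot> ?d)"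
    note y0t = yt[OF y0]
    have xt: "src E (\<phi> \<odot> (y0 \<odot> ?p)) = ?W" "tgt E (\<phi> \<odot> (y0 \<odot> ?p)) = Rn n"
      using y0t ty by simp_all
    have it: "src E (Dinc k n \<odot> ?d) = ?W" "tgt E (Dinc k n \<odot> ?d) = Rn n" by simp_all
    have tt: "src E t = ?W" "tgt E t = Rn n"
      unfolding t_def using vec_ops_typing(1,2)[OF xt it R.zero_closed] by simp_all
    have teval: "t \<odot> \<langle>ident E L, d\<rangle> = vadd n L (\<phi> \<odot> y0) (Dinc k n \<odot> d)"
      if "src E d = L" "tgt E d = D k n" for d
      unfolding t_def using that y0t ty vadd_cmp[OF xt it, of "\<langle>ident E L, d\<rangle>"] by simp
    have t0: "\<phi> \<odot> y0 = t \<odot> ?o"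
      using y0t ty by (simp add: teval vadd_vzero)
    obtain z where z: "src E z = ?W" "tgt E z = U" "q \<odot> z = u \<odot> ?p" "\<phi> \<odot> z = t"
      by (rule formally_open_lift[OF o\<phi> k n u tt _ t0]) (use y0 ys in auto)
    have zeval: "y = z \<odot> \<langle>ident E L, d\<rangle>"
      if "y \<in> set ys" "src E d = L" "tgt E d = D k n" "\<phi> \<odot> y = t \<odot> \<langle>ident E L, d\<rangle>" for y d
    proof (rule formally_open_inject[OF o\<phi>])
      show "y \<in> fibre U q u" using that ys by auto
      have "q \<odot> (z \<odot> \<langle>ident E L, d\<rangle>) = u"
        using square_cmp[OF z(3), of "\<langle>ident E L, d\<rangle>"] z that u ty by simp
      then show "z \<odot> \<langle>ident E L, d\<rangle> \<in> fibre U q u"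
        using z that u by (simp add: fibre_iff)
      show "\<phi> \<odot> y = \<phi> \<odot> (z \<odot> \<langle>ident E L, d\<rangle>)"
        using that z ty assoc[of "\<langle>ident E L, d\<rangle>" z \<phi>] by simp
    qed
    \<comment> \<open>The map \<open>d \<mapsto> F(y\<^sub>0 + d)\<close>.\<close>
    define F' where "F' = F \<odot> \<langle>?p, \<iota> \<odot> z\<rangle>"
    have F't: "src E F' = ?W" "tgt E F' = B" unfolding F'_def using F z ty by simp_all
    have F'eval: "F' \<odot> \<langle>ident E L, d\<rangle> = F \<odot> \<langle>ident E L, \<iota> \<odot> (z \<odot> \<langle>ident E L, d\<rangle>)\<rangle>"
      if "src E d = L" "tgt E d = D k n" for d
      unfolding F'_def using that F z ty by simp
    have "\<kappa> \<odot> z0 = F' \<odot> ?o"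
      using z0 F'eval[of "Dzero k n L"] zeval[OF y0 _ _ t0] by simp
    with z0(1) obtain z' where z': "src E z' = ?W" "tgt E z' = V" "r \<odot> z' = v \<odot> ?p" "\<kappa> \<odot> z' = F'"
      by (rule formally_open_lift[OF oV k n v F't])
    have van: "products_vanish (\<R> L) k (coord_diffs n L (map (\<lambda>y. \<phi> \<odot> y) ys))"
      using ys(2) yt ty u by (subst (asm) chart_rel_iff) simp_all
    have "\<exists>d. src E d = L \<and> tgt E d = D k n \<and> Dinc k n \<odot> d = vdiff n L (\<phi> \<odot> y) (\<phi> \<odot> y0)"
      if y: "y \<in> set ys" for y
    proof -
      have pt: "src E (\<phi> \<odot> y) = L" "tgt E (\<phi> \<odot> y) = Rn n"
        "src E (\<phi> \<odot> y0) = L" "tgt E (\<phi> \<odot> y0) = Rn n"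
        using yt[OF y] y0t ty by simp_all
      note vd = vec_ops_typing(3,4,8)[OF pt R.zero_closed]
      have "lies_in (vdiff n L (\<phi> \<odot> y) (\<phi> \<odot> y0)) (Dinc k n)"
        unfolding lies_in_Dinc[OF vd(1,2)]
        by (rule products_vanish_mono[OF van]) (use y y0 vd(3) in \<open>auto simp: coord_diffs_def\<close>)
      then show ?thesis by (rule lies_inE) (use vd in auto)
    qed
    then obtain d where d: "\<And>y. y \<in> set ys \<Longrightarrow> src E (d y) = L \<and> tgt E (d y) = D k n \<and>
        Dinc k n \<odot> d y = vdiff n L (\<phi> \<odot> y) (\<phi> \<odot> y0)"
      by metis
    have yd: "y = z \<odot> \<langle>ident E L, d y\<rangle>" if y: "y \<in> set ys" for y
    proof (rule zeval[OF y])
      have "t \<odot> \<langle>ident E L, d y\<rangle> = vadd n L (\<phi> \<odot> y0) (vdiff n L (\<phi> \<odot> y) (\<phi> \<odot> y0))"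
        using d[OF y] teval[of "d y"] by simp
      also have "\<dots> = \<phi> \<odot> y" using yt[OF y] y0t ty by (intro vadd_vdiff) simp_all
      finally show "\<phi> \<odot> y = t \<odot> \<langle>ident E L, d y\<rangle>" by simp
    qed (use d[OF y] in simp_all)
    define zs where "zs = map (\<lambda>y. z' \<odot> \<langle>ident E L, d y\<rangle>) ys"
    show ?thesis
    proof (rule that)
      show "length zs = length ys" by (simp add: zs_def)
      show fib: "set zs \<subseteq> fibre V r v"
      proof
        fix x assume "x \<in> set zs"
        then obtain y where y: "y \<in> set ys" and x: "x = z' \<odot> \<langle>ident E L, d y\<rangle>"
          by (auto simp: zs_def)
        show "x \<in> fibre V r v"
          using square_cmp[OF z'(3), of "\<langle>ident E L, d y\<rangle>"] d[OF y] z' v ty x by (simp add: fibre_iff)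
      qed
      show "map (\<lambda>z. \<kappa> \<odot> z) zs = map (\<lambda>y. F \<odot> \<langle>ident E L, \<iota> \<odot> y\<rangle>) ys"
      proof -
        have "\<kappa> \<odot> (z' \<odot> \<langle>ident E L, d y\<rangle>) = F \<odot> \<langle>ident E L, \<iota> \<odot> y\<rangle>" if y: "y \<in> set ys" for y
        proof -
          have "\<kappa> \<odot> (z' \<odot> \<langle>ident E L, d y\<rangle>) = (\<kappa> \<odot> z') \<odot> \<langle>ident E L, d y\<rangle>"
            by (rule assoc[symmetric]) (use d[OF y] z' ty in simp_all)
          also have "\<dots> = F \<odot> \<langle>ident E L, \<iota> \<odot> y\<rangle>"
            unfolding z'(4) using F'eval[of "d y"] d[OF y] yd[OF y] by simp
          finally show ?thesis .
        qed
        then show ?thesis by (simp add: zs_def)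
      qed
      have "products_vanish (\<R> L) k (coord_diffs m L (map (\<lambda>d. (\<psi> \<odot> z') \<odot> \<langle>ident E L, d\<rangle>) (map d ys)))"
      proof (rule map_preserves_neighbours[OF k n])
        show "products_vanish (\<R> L) k (coord_diffs n L (map (\<lambda>d. Dinc k n \<odot> d) (map d ys)))"
        proof (rule products_vanish_mono[OF van])
          show "coord_diffs n L (map (\<lambda>d. Dinc k n \<odot> d) (map d ys)) \<subseteq>
              coord_diffs n L (map (\<lambda>y. \<phi> \<odot> y) ys)"
          proof
            fix a assume "a \<in> coord_diffs n L (map (\<lambda>d. Dinc k n \<odot> d) (map d ys))"
            then obtain c x y where c: "c < n" and xy: "x \<in> set ys" "y \<in> set ys"
              and a: "a = rc n c (Dinc k n \<odot> d x) \<ominus>\<^bsub>\<R> L\<^esub> rc n c (Dinc k n \<odot> d y)"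
              by (auto simp: coord_diffs_def)
            have pt: "src E (\<phi> \<odot> y) = L" "tgt E (\<phi> \<odot> y) = Rn n" if "y \<in> set ys" for y
              using yt[OF that] ty by simp_all
            have pc: "rc n c (\<phi> \<odot> y) \<in> carrier (\<R> L)" if "y \<in> set ys" for y
              using pt[OF that] c by (rule rc_carrier)
            have "rc n c (Dinc k n \<odot> d y) = rc n c (\<phi> \<odot> y) \<ominus>\<^bsub>\<R> L\<^esub> rc n c (\<phi> \<odot> y0)" if "y \<in> set ys" for y
              using d[OF that] vec_ops_typing(8)[OF pt[OF that] pt[OF y0] R.zero_closed c] by simp
            then have "a = (rc n c (\<phi> \<odot> x) \<ominus>\<^bsub>\<R> L\<^esub> rc n c (\<phi> \<odot> y0)) \<ominus>\<^bsub>\<R> L\<^esub>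
                (rc n c (\<phi> \<odot> y) \<ominus>\<^bsub>\<R> L\<^esub> rc n c (\<phi> \<odot> y0))"
              using a xy by simp
            also have "\<dots> = rc n c (\<phi> \<odot> x) \<ominus>\<^bsub>\<R> L\<^esub> rc n c (\<phi> \<odot> y)"
              using pc[OF xy(1)] pc[OF xy(2)] pc[OF y0] by (rule R.diff_cancel_base)
            finally show "a \<in> coord_diffs n L (map (\<lambda>y. \<phi> \<odot> y) ys)"
              using c xy by (auto simp: coord_diffs_def)
          qed
        qed
      qed (use d z' ty in auto)
      then show "chart_rel k m \<psi> v zs"
      proof (subst chart_rel_iff)
        show "\<forall>z\<in>set zs. src E z = src E v \<and> tgt E z = src E \<psi>"
          using fib ty by (auto simp: fibre_iff)
        have "map (\<lambda>z. \<psi> \<odot> z) zs = map (\<lambda>d. (\<psi> \<odot> z') \<odot> \<langle>ident E L, d\<rangle>) (map d ys)"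
          using d z' ty by (simp add: zs_def)
        moreover assume "products_vanish (\<R> L) k (coord_diffs m L (map (\<lambda>d. (\<psi> \<odot> z') \<odot> \<langle>ident E L, d\<rangle>) (map d ys)))"
        ultimately show "products_vanish (\<R> (src E v)) k (coord_diffs m (src E v) (map (\<lambda>z. \<psi> \<odot> z) zs))"
          using v by simp
      qed (use ty in simp)
    qed
  qed
qed

section \<open>Change of stage\<close>

lemma chart_rel_restrict:
  assumes "chart_rel k n \<phi> u ys" "\<forall>y\<in>set ys. src E y = src E u \<and> tgt E y = src E \<phi>"
    "tgt E \<phi> = Rn n" "tgt E w = src E u"
  shows "chart_rel k n \<phi> (u \<odot> w) (map (\<lambda>y. y \<odot> w) ys)"
proof -
  let ?L = "src E u"
  let ?Ps = "map (\<lambda>y. \<phi> \<odot> y) ys" and ?Qs = "map (\<lambda>y. \<phi> \<odot> y) (map (\<lambda>y. y \<odot> w) ys)"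
  interpret r: ring_hom_cring "\<R> ?L" "\<R> (src E w)" "\<lambda>x. x \<odot> w"
    using assms(4) by (rule restrict_hom)
  have Pt: "\<forall>P\<in>set ?Ps. src E P = ?L \<and> tgt E P = Rn n" using assms by simp
  have Q: "?Qs = map (\<lambda>P. P \<odot> w) ?Ps" using assms by simp
  have Qt: "\<forall>P\<in>set ?Qs. src E P = src E w \<and> tgt E P = Rn n" using assms by simp
  have "coord_diffs n (src E w) ?Qs \<subseteq> (\<lambda>x. x \<odot> w) ` coord_diffs n ?L ?Ps"
  proof
    fix a assume "a \<in> coord_diffs n (src E w) ?Qs"
    then obtain c P P' where c: "c < n" "P \<in> set ?Ps" "P' \<in> set ?Ps"
      and a: "a = rc n c (P \<odot> w) \<ominus>\<^bsub>\<R> (src E w)\<^esub> rc n c (P' \<odot> w)"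
      unfolding Q by (auto simp: coord_diffs_def)
    have "a = (rc n c P \<ominus>\<^bsub>\<R> ?L\<^esub> rc n c P') \<odot> w"
      using a c Pt assms(4) by (simp add: r.hom_minus rc_carrier coord_cmp del: set_map)
    then show "a \<in> (\<lambda>x. x \<odot> w) ` coord_diffs n ?L ?Ps"
      using c unfolding coord_diffs_def by blast
  qed
  moreover have "products_vanish (\<R> ?L) k (coord_diffs n ?L ?Ps)"
    using assms(1) Pt by (simp add: chart_rel_def Rn_rel_iff)
  ultimately have "products_vanish (\<R> (src E w)) k (coord_diffs n (src E w) ?Qs)"
    using r.products_vanish_hom[OF coord_diffs_carrier[OF Pt]] products_vanish_mono by blast
  then show ?thesis using Qt assms(4) by (simp add: chart_rel_def Rn_rel_iff)
qed

lemma pullback_unique: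
  assumes pb: "is_pullback p q f g" and t: "src E a = src E b" "tgt E a = src E p" "tgt E b = src E p"
    and eq: "p \<odot> a = p \<odot> b" "q \<odot> a = q \<odot> b"
  shows "a = b"
proof -
  note ty = pullback_typing[OF pb]
  have "p \<odot> b \<in> hom (src E b) (src E f)" "q \<odot> b \<in> hom (src E b) (src E g)"
    "f \<odot> (p \<odot> b) = g \<odot> (q \<odot> b)"
    using ty t square_cmp[OF ty(5), of b] by (simp_all add: hom_iff)
  then have "\<exists>!h. h \<in> hom (src E b) (src E p) \<and> p \<odot> h = p \<odot> b \<and> q \<odot> h = q \<odot> b"
    using pb unfolding is_pullback_def by blast
  then show ?thesis using t eq unfolding hom_iff by metis
qed

lemma restrict_formally_open:
  assumes o: "formally_open K U q \<iota> X" and pb: "is_pullback q' \<pi> j q" and j: "src E j = L"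
  shows "formally_open L (src E \<pi>) q' (\<iota> \<odot> \<pi>) X"
proof -
  note ty = pullback_typing[OF pb] formally_open_typing[OF o]
  show ?thesis
    unfolding formally_open_def
  proof (intro conjI allI impI ballI)
    show "q' \<in> hom (src E \<pi>) L" "\<iota> \<odot> \<pi> \<in> hom (src E \<pi>) X" using ty j by (simp_all add: hom_iff)
    show "monic \<langle>q', \<iota> \<odot> \<pi>\<rangle>"
    proof (rule monicI)
      fix a b assume t: "tgt E a = src E \<langle>q', \<iota> \<odot> \<pi>\<rangle>" "tgt E b = src E \<langle>q', \<iota> \<odot> \<pi>\<rangle>" "src E a = src E b"
        and eq: "\<langle>q', \<iota> \<odot> \<pi>\<rangle> \<odot> a = \<langle>q', \<iota> \<odot> \<pi>\<rangle> \<odot> b"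
      have t': "tgt E a = src E q'" "tgt E b = src E q'" using t ty by simp_all
      have eq': "q' \<odot> a = q' \<odot> b \<and> \<iota> \<odot> (\<pi> \<odot> a) = \<iota> \<odot> (\<pi> \<odot> b)"
        using eq t' t(3) ty by - (rule pair_inject, simp_all)
      have "\<pi> \<odot> a = \<pi> \<odot> b"
      proof (rule formally_open_inject[OF o])
        show "\<pi> \<odot> a \<in> fibre U q (j \<odot> (q' \<odot> a))" "\<pi> \<odot> b \<in> fibre U q (j \<odot> (q' \<odot> a))"
          using square_cmp[OF ty(5), of a] square_cmp[OF ty(5), of b] eq' t' t(3) ty by (simp_all add: fibre_iff)
      qed (use eq' in simp)
      then show "a = b" using eq' t' t(3) by - (rule pullback_unique[OF pb], simp_all)
    qed
    fix k m J u t K' w d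
    assume km: "1 \<le> (k::nat)" "1 \<le> (m::nat)" and u: "u \<in> hom J L" and t: "t \<in> hom (prd E J (D k m)) X"
      and "\<exists>y\<in>fibre (src E \<pi>) q' u. (\<iota> \<odot> \<pi>) \<odot> y = t \<odot> \<langle>ident E J, Dzero k m J\<rangle>"
      and w: "w \<in> hom K' J" and d: "d \<in> hom K' (D k m)"
    then obtain y where y: "y \<in> fibre (src E \<pi>) q' u" "(\<iota> \<odot> \<pi>) \<odot> y = t \<odot> \<langle>ident E J, Dzero k m J\<rangle>"
      by blast
    have yt: "src E y = J" "tgt E y = src E \<pi>" "q' \<odot> y = u" using y(1) u by (simp_all add: fibre_iff hom_iff)
    have "j \<odot> u \<in> hom J K" using u j ty by (simp add: hom_iff)
    moreover have "\<pi> \<odot> y \<in> fibre U q (j \<odot> u)" "\<iota> \<odot> (\<pi> \<odot> y) = t \<odot> \<langle>ident E J, Dzero k m J\<rangle>"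
      using square_cmp[OF ty(5), of y] y(2) yt ty j u by (simp_all add: fibre_iff hom_iff)
    ultimately obtain y' where y': "y' \<in> fibre U q ((j \<odot> u) \<odot> w)" "\<iota> \<odot> y' = t \<odot> \<langle>w, d\<rangle>"
      using o km t w d unfolding formally_open_def by blast
    have ut: "src E u = J" "tgt E u = L" "src E w = K'" "tgt E w = J" using u w by (simp_all add: hom_iff)
    have y't: "src E y' = K'" "tgt E y' = U" "q \<odot> y' = j \<odot> (u \<odot> w)"
      using y'(1) ut ty j by (simp_all add: fibre_iff)
    obtain h where h: "src E h = src E y'" "tgt E h = src E q'" "q' \<odot> h = u \<odot> w" "\<pi> \<odot> h = y'"
      by (rule pullback_lift[OF pb, of "u \<odot> w" y']) (use y't ut ty j in simp_all)
    then show "\<exists>y\<in>fibre (src E \<pi>) q' (u \<odot> w). (\<iota> \<odot> \<pi>) \<odot> y = t \<odot> \<langle>w, d\<rangle>"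
      using y' y't ut ty j by (intro bexI[of _ h]) (simp_all add: fibre_iff)
  qed
qed

text \<open>
  A chart at stage \<open>K\<close> is a family of charts indexed by \<open>K\<close>; the pullback along \<open>j\<close> reindexes the family and
  keeps its elements.
\<close>

lemma restrict_chart:
  assumes c: "chart n K U q \<iota> \<phi> A" and j: "src E j = L" "tgt E j = K"
  obtains q' \<pi> where "tgt E q' = L" "src E q' = src E \<pi>" "tgt E \<pi> = U"
    "chart n L (src E \<pi>) q' (\<iota> \<odot> \<pi>) (\<phi> \<odot> \<pi>) A"
    "\<And>u y. tgt E u = L \<Longrightarrow> y \<in> fibre U q (j \<odot> u) \<Longrightarrow> \<exists>y'\<in>fibre (src E \<pi>) q' u. \<pi> \<odot> y' = y"
proof -
  have o: "formally_open K U q \<iota> A" "formally_open K U q \<phi> (Rn n)" using c by (simp_all add: chart_def)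
  note ty = formally_open_typing[OF o(1)]
  obtain q' \<pi> where pb: "is_pullback q' \<pi> j q" using pullback_exists[of j q] ty j by auto
  note pt = pullback_typing[OF pb]
  show ?thesis
  proof (rule that)
    show "chart n L (src E \<pi>) q' (\<iota> \<odot> \<pi>) (\<phi> \<odot> \<pi>) A"
      using restrict_formally_open[OF o(1) pb j(1)] restrict_formally_open[OF o(2) pb j(1)]
      by (simp add: chart_def)
    fix u y assume u: "tgt E u = L" and y: "y \<in> fibre U q (j \<odot> u)"
    have yt: "src E y = src E u" "tgt E y = U" "q \<odot> y = j \<odot> u" using y u j by (simp_all add: fibre_iff)
    obtain h where "src E h = src E y" "tgt E h = src E q'" "q' \<odot> h = u" "\<pi> \<odot> h = y"
      by (rule pullback_lift[OF pb, of u y]) (use yt u j ty in simp_all)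
    then show "\<exists>y'\<in>fibre (src E \<pi>) q' u. \<pi> \<odot> y' = y"
      using pt yt by (intro bexI[of _ h]) (simp_all add: fibre_iff)
  qed (use pt ty j in simp_all)
qed

section \<open>Families of subsets\<close>

lemma family_rel_restrict_index:
  assumes "\<And>p. S p \<in> hom I (pwr E (pw A p))" "tgt E v = I" "tgt E u = src E v"
  shows "family_rel A (\<lambda>p. S p \<odot> v) u xs \<longleftrightarrow> family_rel A S (v \<odot> u) xs"
  using assms by (simp add: family_rel_def hom_iff)

lemma family_rel_descent:
  assumes S: "\<And>p. S p \<in> hom I (pwr E (pw A p))" and u: "tgt E u = I"
    and xs: "\<forall>x\<in>set xs. src E x = src E u \<and> tgt E x = A"
    and e: "epic e" "tgt E e = src E u"
    and rel: "family_rel A S (u \<odot> e) (map (\<lambda>x. x \<odot> e) xs)"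
  shows "family_rel A S u xs"
proof -
  let ?z = "\<langle>tup (src E u) xs, S (length xs) \<odot> u\<rangle>"
  have St: "src E (S p) = I" "tgt E (S p) = pwr E (pw A p)" for p using S[of p] by (simp_all add: hom_iff)
  have tt: "src E (tup (src E u) xs) = src E u" "tgt E (tup (src E u) xs) = pw A (length xs)"
    using xs tgt_tup[OF xs] by simp_all
  have "?z \<odot> e = \<langle>tup (src E e) (map (\<lambda>x. x \<odot> e) xs), S (length xs) \<odot> (u \<odot> e)\<rangle>"
    using St tt u e tup_cmp[OF xs e(2)] by simp
  then have "lies_in (?z \<odot> e) (elt E (pw A (length xs)))"
    using rel u e by (simp add: family_rel_def member_def)
  then have "lies_in ?z (elt E (pw A (length xs)))"
    using definable_descent[OF definable_lies_in[OF elt_monic] e(1), of ?z] tt u e St by simp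
  then show ?thesis by (simp add: family_rel_def member_def)
qed

lemma family_eqI:
  assumes S: "\<And>p. S p \<in> hom I (pwr E (pw A p))" and T: "\<And>p. T p \<in> hom I (pwr E (pw A p))"
    and same: "\<And>u xs. \<lbrakk>tgt E u = I; \<forall>x\<in>set xs. src E x = src E u \<and> tgt E x = A\<rbrakk> \<Longrightarrow>
      family_rel A S u xs \<longleftrightarrow> family_rel A T u xs"
  shows "S = T"
proof
  fix p
  show "S p = T p"
  proof (rule extensionality)
    fix u x assume u: "tgt E u = I" and x: "tgt E x = pw A p" "src E x = src E u"
    let ?xs = "map (\<lambda>j. coord A p j x) [0..<p]"
    have "\<forall>y\<in>set ?xs. src E y = src E u \<and> tgt E y = A" using x by simp
    from same[OF u this] show "member (pw A p) x (S p \<odot> u) \<longleftrightarrow> member (pw A p) x (T p \<odot> u)"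
      by (simp add: family_rel_def tup_coord[OF x])
  qed (use S[of p] T[of p] in \<open>simp_all add: hom_iff\<close>)
qed

section \<open>Definability of the neighbour relation\<close>

text \<open>
  Only finitely many products are involved, and each is an arrow, obtained by evaluating it at the generic
  element.
\<close>

lemma products_vanish_definable:
  assumes "finite F" "F \<subseteq> carrier (\<R> Y)"
  shows "definable Y (\<lambda>y. products_vanish (\<R> (src E y)) k ((\<lambda>a. a \<odot> y) ` F))"
proof -
  let ?P = "\<lambda>f. finprod (\<R> Y) f {..k}"
  have fc: "f \<in> {..k} \<rightarrow> carrier (\<R> Y)" if "f \<in> {..k} \<rightarrow>\<^sub>E F" for f
    using that assms(2) by (auto simp: PiE_iff)
  have "definable Y (\<lambda>y. \<forall>f\<in>{..k} \<rightarrow>\<^sub>E F. ?P f \<odot> y = \<zero>\<^bsub>\<R> Y\<^esub> \<odot> y)"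
  proof (rule definable_finite_conj)
    show "finite ({..k} \<rightarrow>\<^sub>E F)" using assms(1) by (intro finite_PiE) auto
    show "definable Y (\<lambda>y. ?P f \<odot> y = \<zero>\<^bsub>\<R> Y\<^esub> \<odot> y)" if "f \<in> {..k} \<rightarrow>\<^sub>E F" for f
      using R.finprod_closed[OF fc[OF that]] R.zero_closed[of Y]
      by (intro definable_eq) (simp_all add: carrier_iff)
  qed
  then show ?thesis
  proof (rule definable_cong)
    fix y assume y: "tgt E y = Y"
    interpret r: ring_hom_cring "\<R> Y" "\<R> (src E y)" "\<lambda>x. x \<odot> y" using y by (rule restrict_hom)
    have ev: "?P f \<odot> y = finprod (\<R> (src E y)) (\<lambda>l. f l \<odot> y) {..k}" if "f \<in> {..k} \<rightarrow>\<^sub>E F" for f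
      using r.hom_finprod[OF fc[OF that]] by (simp add: comp_def)
    show "(\<forall>f\<in>{..k} \<rightarrow>\<^sub>E F. ?P f \<odot> y = \<zero>\<^bsub>\<R> Y\<^esub> \<odot> y) \<longleftrightarrow>
        products_vanish (\<R> (src E y)) k ((\<lambda>a. a \<odot> y) ` F)"
    proof
      assume *: "\<forall>f\<in>{..k} \<rightarrow>\<^sub>E F. ?P f \<odot> y = \<zero>\<^bsub>\<R> Y\<^esub> \<odot> y"
      show "products_vanish (\<R> (src E y)) k ((\<lambda>a. a \<odot> y) ` F)"
        unfolding products_vanish_def
      proof
        fix g assume "g \<in> {..k} \<rightarrow> (\<lambda>a. a \<odot> y) ` F"
        then have "\<forall>l\<in>{..k}. \<exists>a. a \<in> F \<and> g l = a \<odot> y" by auto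
        then obtain f where f: "\<forall>l\<in>{..k}. f l \<in> F \<and> g l = f l \<odot> y" by metis
        have fE: "restrict f {..k} \<in> {..k} \<rightarrow>\<^sub>E F" using f by auto
        have "finprod (\<R> (src E y)) g {..k} = finprod (\<R> (src E y)) (\<lambda>l. restrict f {..k} l \<odot> y) {..k}"
        proof (rule R.finprod_cong')
          show "(\<lambda>l. restrict f {..k} l \<odot> y) \<in> {..k} \<rightarrow> carrier (\<R> (src E y))"
            using f assms(2) r.hom_closed by auto
        qed (use f in simp_all)
        also have "\<dots> = \<zero>\<^bsub>\<R> (src E y)\<^esub>" using * fE ev[OF fE] r.hom_zero by simp
        finally show "finprod (\<R> (src E y)) g {..k} = \<zero>\<^bsub>\<R> (src E y)\<^esub>" .
      qed
    next
      assume van: "products_vanish (\<R> (src E y)) k ((\<lambda>a. a \<odot> y) ` F)"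
      show "\<forall>f\<in>{..k} \<rightarrow>\<^sub>E F. ?P f \<odot> y = \<zero>\<^bsub>\<R> Y\<^esub> \<odot> y"
      proof
        fix f assume f: "f \<in> {..k} \<rightarrow>\<^sub>E F"
        then have "(\<lambda>l. f l \<odot> y) \<in> {..k} \<rightarrow> (\<lambda>a. a \<odot> y) ` F" by auto
        then show "?P f \<odot> y = \<zero>\<^bsub>\<R> Y\<^esub> \<odot> y"
          using van ev[OF f] r.hom_zero unfolding products_vanish_def by simp
      qed
    qed
  qed
qed

lemma chart_rel_definable:
  assumes "src E \<phi> = U" "tgt E \<phi> = Rn n"
  shows "definable (pw U p) (\<lambda>y. chart_rel k n \<phi> y (comps U p y))"
proof -
  let ?Y = "pw U p" and ?id = "ident E (pw U p)"
  let ?G = "map (\<lambda>x. \<phi> \<odot> x) (comps U p ?id)"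
  have Gt: "\<forall>P\<in>set ?G. src E P = ?Y \<and> tgt E P = Rn n" using assms by auto
  have "coord_diffs n ?Y ?G = (\<lambda>(c, P, Q). rc n c P \<ominus>\<^bsub>\<R> ?Y\<^esub> rc n c Q) ` ({..<n} \<times> set ?G \<times> set ?G)"
    by (force simp: coord_diffs_def)
  then have fin: "finite (coord_diffs n ?Y ?G)" by simp
  from products_vanish_definable[OF fin coord_diffs_carrier[OF Gt]] show ?thesis
  proof (rule definable_cong)
    fix y assume y: "tgt E y = ?Y"
    interpret r: ring_hom_cring "\<R> ?Y" "\<R> (src E y)" "\<lambda>x. x \<odot> y" using y by (rule restrict_hom)
    have map: "map (\<lambda>x. \<phi> \<odot> x) (comps U p y) = map (\<lambda>P. P \<odot> y) ?G"
      using y assms by (simp add: coord_cmp)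
    have "coord_diffs n (src E y) (map (\<lambda>P. P \<odot> y) ?G) = (\<lambda>a. a \<odot> y) ` coord_diffs n ?Y ?G"
    proof -
      have *: "rc n c (P \<odot> y) \<ominus>\<^bsub>\<R> (src E y)\<^esub> rc n c (Q \<odot> y) = (rc n c P \<ominus>\<^bsub>\<R> ?Y\<^esub> rc n c Q) \<odot> y"
        if "P \<in> set ?G" "Q \<in> set ?G" "c < n" for c P Q
        using that Gt y by (simp add: r.hom_minus rc_carrier coord_cmp del: set_map)
      have "coord_diffs n (src E y) (map (\<lambda>P. P \<odot> y) ?G) =
          {rc n c (P \<odot> y) \<ominus>\<^bsub>\<R> (src E y)\<^esub> rc n c (Q \<odot> y) | c P Q. c < n \<and> P \<in> set ?G \<and> Q \<in> set ?G}"
        unfolding coord_diffs_def set_map[of "\<lambda>P. P \<odot> y"] by blast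
      also have "\<dots> = {(rc n c P \<ominus>\<^bsub>\<R> ?Y\<^esub> rc n c Q) \<odot> y | c P Q. c < n \<and> P \<in> set ?G \<and> Q \<in> set ?G}"
        using * by (intro Collect_cong ex_cong1) (auto simp del: set_map)
      also have "\<dots> = (\<lambda>a. a \<odot> y) ` coord_diffs n ?Y ?G"
        unfolding coord_diffs_def by blast
      finally show ?thesis .
    qed
    moreover have "chart_rel k n \<phi> y (comps U p y) \<longleftrightarrow>
        products_vanish (\<R> (src E y)) k (coord_diffs n (src E y) (map (\<lambda>x. \<phi> \<odot> x) (comps U p y)))"
      using y assms by (intro chart_rel_iff) auto
    ultimately show "products_vanish (\<R> (src E y)) k ((\<lambda>a. a \<odot> y) ` coord_diffs n ?Y ?G) \<longleftrightarrow>
        chart_rel k n \<phi> y (comps U p y)"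
      unfolding map by simp
  qed
qed

lemma chart_rel_stage: "src E u = src E v \<Longrightarrow> chart_rel k n \<phi> u = chart_rel k n \<phi> v"
  by (intro ext) (simp add: chart_rel_def)

lemma chart_rel_singleton: "chart_rel k n \<phi> u [y]"
  by (simp add: chart_rel_def Rn_rel_def)

lemma chart_rel_subset:
  assumes "chart_rel k n \<phi> u ys" "set zs \<subseteq> set ys"
    "\<forall>y\<in>set ys. src E y = src E u \<and> tgt E y = src E \<phi>" "tgt E \<phi> = Rn n"
  shows "chart_rel k n \<phi> u zs"
proof -
  have "coord_diffs n (src E u) (map (\<lambda>y. \<phi> \<odot> y) zs) \<subseteq> coord_diffs n (src E u) (map (\<lambda>y. \<phi> \<odot> y) ys)"
    using assms(2) by (auto simp: coord_diffs_def; blast)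
  moreover have "\<forall>y\<in>set zs. src E y = src E u \<and> tgt E y = src E \<phi>" using assms(2,3) by blast
  ultimately show ?thesis
    using assms products_vanish_mono by (simp add: chart_rel_iff) blast
qed

end

section \<open>A covering chart\<close>

text \<open>
  The data that the covering axiom provides for the generic point of \<open>A\<close>: a family of charts indexed by
  \<open>J0\<close> and a section \<open>s\<close> that lies over \<open>e0\<close>. So the chart with index \<open>j\<close> contains the point \<open>e0 j\<close>.
\<close>

locale covering_chart = sdg_model E for E :: "('o, 'm, 'z) sdg_scheme" (structure) +
  fixes k n :: nat and A J0 :: 'o and e0 :: 'm and U :: 'o and q \<iota> \<phi> s :: 'm
  assumes k: "k \<ge> 1" and e0: "epic e0" "src E e0 = J0" "tgt E e0 = A"
    and chart: "chart n J0 U q \<iota> \<phi> A"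
    and s: "s \<in> fibre U q (ident E J0)" "\<iota> \<odot> s = e0"
begin

lemma iota_open: "formally_open J0 U q \<iota> A" and phi_open: "formally_open J0 U q \<phi> (Rn n)"
  using chart by (simp_all add: chart_def)

lemmas chart_typing = formally_open_typing(1-4)[OF iota_open] formally_open_typing(3,4)[OF phi_open]

lemma s_typing: "src E s = J0" "tgt E s = U" "q \<odot> s = ident E J0"
  using s(1) by (simp_all add: fibre_iff)

lemma section_at: "tgt E j = J0 \<Longrightarrow> s \<odot> j \<in> fibre U q j \<and> \<iota> \<odot> (s \<odot> j) = e0 \<odot> j"
  using s_typing chart_typing s(2) e0 assoc[of j s \<iota>] assoc[of j s q] by (simp add: fibre_iff del: assoc)

definition lifts :: "'m \<Rightarrow> 'm list \<Rightarrow> bool" where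
  "lifts j xs \<longleftrightarrow> (\<exists>ys. set ys \<subseteq> fibre U q j \<and> map (\<lambda>y. \<iota> \<odot> y) ys = xs \<and> chart_rel k n \<phi> j ys)"

text \<open>
  The indices \<open>j\<close> at which the tuple is tested are all those over its first point. Quantifying over them,
  instead of asking for one such index, makes the relation definable without an existential quantifier.
\<close>

definition neighbours :: "'m list \<Rightarrow> bool" where
  "neighbours xs \<longleftrightarrow> (xs \<noteq> [] \<longrightarrow> (\<forall>w j. tgt E w = src E (hd xs) \<longrightarrow> tgt E j = J0 \<longrightarrow> src E j = src E w \<longrightarrow>
     e0 \<odot> j = hd xs \<odot> w \<longrightarrow> lifts j (map (\<lambda>x. x \<odot> w) xs)))"

text \<open>
  Since the inclusion of a chart is injective, the tuple of lifts is unique when it exists. So the predicate is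
  the image of a subobject \<open>?W\<close> of the power of \<open>U\<close> under a map \<open>?g\<close> that is injective on it: \<open>?W\<close> says that
  all components have the same index in \<open>J0\<close> and are neighbours.
\<close>

lemma lifts_definable:
  assumes p: "p = Suc r"
  shows "definable (prd E J0 (pw A p))
    (\<lambda>z. lifts (prj1 E J0 (pw A p) \<odot> z) (comps A p (prj2 E J0 (pw A p) \<odot> z)))"
proof -
  let ?Y = "pw U p" and ?X = "pw A p" and ?id = "ident E (pw U p)"
  let ?c = "\<lambda>i. coord U p i ?id"
  let ?\<iota> = "tup ?Y (map (\<lambda>i. \<iota> \<odot> ?c i) [0..<p])"
  let ?g = "\<langle>q \<odot> ?c 0, ?\<iota>\<rangle>"
  let ?W = "\<lambda>y. (\<forall>i\<in>{..<p}. (q \<odot> ?c i) \<odot> y = (q \<odot> ?c 0) \<odot> y) \<and> chart_rel k n \<phi> y (comps U p y)"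
  have ct: "src E (?c i) = ?Y" "tgt E (?c i) = U" if "i < p" for i using that by simp_all
  have p0: "0 < p" using p by simp
  have \<iota>e: "\<forall>x\<in>set (map (\<lambda>i. \<iota> \<odot> ?c i) [0..<p]). src E x = ?Y \<and> tgt E x = A"
    using ct chart_typing by simp
  have \<iota>t: "src E ?\<iota> = ?Y" "tgt E ?\<iota> = ?X"
    using \<iota>e tgt_tup[OF \<iota>e] by simp_all
  have gt: "src E ?g = ?Y" "tgt E ?g = prd E J0 ?X" using \<iota>t ct[OF p0] chart_typing by simp_all
  have qc: "(q \<odot> ?c i) \<odot> y = q \<odot> coord U p i y" and \<iota>c: "(\<iota> \<odot> ?c i) \<odot> y = \<iota> \<odot> coord U p i y"
    if "tgt E y = ?Y" "i < p" for i y using that chart_typing by (simp_all add: coord_cmp)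
  have gy: "?g \<odot> y = \<langle>q \<odot> coord U p 0 y, tup (src E y) (map (\<lambda>i. \<iota> \<odot> coord U p i y) [0..<p])\<rangle>"
    if y: "tgt E y = ?Y" for y
  proof -
    have "?\<iota> \<odot> y = tup (src E y) (map (\<lambda>x. x \<odot> y) (map (\<lambda>i. \<iota> \<odot> ?c i) [0..<p]))"
      using tup_cmp[OF \<iota>e] y by simp
    also have "map (\<lambda>x. x \<odot> y) (map (\<lambda>i. \<iota> \<odot> ?c i) [0..<p]) = map (\<lambda>i. \<iota> \<odot> coord U p i y) [0..<p]"
      using \<iota>c[OF y] by simp
    finally show ?thesis using qc[OF y p0] y \<iota>t ct[OF p0] chart_typing by simp
  qed
  have tt: "src E (tup (src E y) (map (\<lambda>i. \<iota> \<odot> coord U p i y) [0..<p])) = src E y"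
      "tgt E (tup (src E y) (map (\<lambda>i. \<iota> \<odot> coord U p i y) [0..<p])) = ?X"
      "comps A p (tup (src E y) (map (\<lambda>i. \<iota> \<odot> coord U p i y) [0..<p])) = map (\<lambda>y. \<iota> \<odot> y) (comps U p y)"
    if y: "tgt E y = ?Y" for y
  proof -
    have e: "\<forall>x\<in>set (map (\<lambda>i. \<iota> \<odot> coord U p i y) [0..<p]). src E x = src E y \<and> tgt E x = A"
      using y chart_typing by simp
    show "src E (tup (src E y) (map (\<lambda>i. \<iota> \<odot> coord U p i y) [0..<p])) = src E y"
      using e by (intro src_tup) blast
    show "tgt E (tup (src E y) (map (\<lambda>i. \<iota> \<odot> coord U p i y) [0..<p])) = ?X" using tgt_tup[OF e] by simp
    show "comps A p (tup (src E y) (map (\<lambda>i. \<iota> \<odot> coord U p i y) [0..<p])) = map (\<lambda>y. \<iota> \<odot> y) (comps U p y)"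
      using comps_tup[OF e] by (simp add: comp_def)
  qed
  have Wq: "q \<odot> coord U p i y = q \<odot> coord U p 0 y" if "tgt E y = ?Y" "?W y" "i < p" for y i
  proof -
    have "(q \<odot> ?c i) \<odot> y = (q \<odot> ?c 0) \<odot> y" using that by blast
    then show ?thesis unfolding qc[OF that(1,3)] qc[OF that(1) p0] .
  qed
  have "definable ?Y ?W"
  proof (rule definable_conj)
    show "definable ?Y (\<lambda>y. \<forall>i\<in>{..<p}. (q \<odot> ?c i) \<odot> y = (q \<odot> ?c 0) \<odot> y)"
      using ct p0 chart_typing by (intro definable_finite_conj definable_eq) simp_all
    show "definable ?Y (\<lambda>y. chart_rel k n \<phi> y (comps U p y))"
      using chart_typing by (intro chart_rel_definable) simp_all
  qed
  then have "definable (prd E J0 ?X) (\<lambda>z. \<exists>y. src E y = src E z \<and> tgt E y = ?Y \<and> ?W y \<and> ?g \<odot> y = z)"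
  proof (rule definable_image)
    fix y y' assume y: "tgt E y = ?Y" "tgt E y' = ?Y" "src E y = src E y'" and W: "?W y" "?W y'"
      and eq: "?g \<odot> y = ?g \<odot> y'"
    have "q \<odot> coord U p 0 y = q \<odot> coord U p 0 y' \<and>
        tup (src E y) (map (\<lambda>i. \<iota> \<odot> coord U p i y) [0..<p]) = tup (src E y') (map (\<lambda>i. \<iota> \<odot> coord U p i y') [0..<p])"
      using eq tt(1,2)[OF y(1)] tt(1,2)[OF y(2)] y p0 chart_typing unfolding gy[OF y(1)] gy[OF y(2)]
      by - (rule pair_inject, simp_all)
    then have q0: "q \<odot> coord U p 0 y = q \<odot> coord U p 0 y'"
      and \<iota>eq: "map (\<lambda>y. \<iota> \<odot> y) (comps U p y) = map (\<lambda>y. \<iota> \<odot> y) (comps U p y')"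
      using tt(3)[OF y(1)] tt(3)[OF y(2)] by simp_all
    show "y = y'"
    proof (rule coord_eqI[OF y])
      fix i assume i: "i < p"
      show "coord U p i y = coord U p i y'"
      proof (rule formally_open_inject[OF iota_open])
        have "q \<odot> coord U p i y = q \<odot> coord U p 0 y" "q \<odot> coord U p i y' = q \<odot> coord U p 0 y"
          using Wq[OF y(1) W(1) i] Wq[OF y(2) W(2) i] q0 by simp_all
        then show "coord U p i y \<in> fibre U q (q \<odot> coord U p 0 y)" "coord U p i y' \<in> fibre U q (q \<odot> coord U p 0 y)"
          using i y p0 chart_typing by (simp_all add: fibre_iff)
        show "\<iota> \<odot> coord U p i y = \<iota> \<odot> coord U p i y'" using \<iota>eq i by simp
      qed
    qed
  qed (use gt in simp_all)
  then show ?thesis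
  proof (rule definable_cong)
    fix z assume z: "tgt E z = prd E J0 ?X"
    let ?j = "prj1 E J0 ?X \<odot> z" and ?x = "prj2 E J0 ?X \<odot> z"
    show "(\<exists>y. src E y = src E z \<and> tgt E y = ?Y \<and> ?W y \<and> ?g \<odot> y = z) \<longleftrightarrow> lifts ?j (comps A p ?x)"
    proof
      assume "\<exists>y. src E y = src E z \<and> tgt E y = ?Y \<and> ?W y \<and> ?g \<odot> y = z"
      then obtain y where y: "src E y = src E z" "tgt E y = ?Y" and W: "?W y" and g: "?g \<odot> y = z" by blast
      have yc: "src E (coord U p 0 y) = src E y" "tgt E (coord U p 0 y) = U" using y p0 by simp_all
      have j: "?j = q \<odot> coord U p 0 y" and x: "?x = tup (src E y) (map (\<lambda>i. \<iota> \<odot> coord U p i y) [0..<p])"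
        unfolding g[symmetric] gy[OF y(2)] using tt(1,2)[OF y(2)] yc chart_typing
        by (simp_all del: coord.simps)
      have "q \<odot> coord U p i y = ?j" if "i < p" for i
        using Wq[OF y(2) W that] j by simp
      then have "set (comps U p y) \<subseteq> fibre U q ?j" using y z by (auto simp: fibre_iff)
      moreover have "map (\<lambda>y. \<iota> \<odot> y) (comps U p y) = comps A p ?x" unfolding x using tt(3)[OF y(2)] by simp
      moreover have "chart_rel k n \<phi> ?j (comps U p y)"
        using W chart_rel_stage[of ?j y] y z by simp
      ultimately show "lifts ?j (comps A p ?x)" unfolding lifts_def by blast
    next
      assume "lifts ?j (comps A p ?x)"
      then obtain ys where ys: "set ys \<subseteq> fibre U q ?j" "map (\<lambda>y. \<iota> \<odot> y) ys = comps A p ?x" "chart_rel k n \<phi> ?j ys"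
        unfolding lifts_def by blast
      have yt: "\<forall>y\<in>set ys. src E y = src E z \<and> tgt E y = U" "\<forall>y\<in>set ys. q \<odot> y = ?j"
        using ys(1) z by (auto simp: fibre_iff)
      have len: "length ys = p" using arg_cong[OF ys(2), of length] by simp
      define y where "y = tup (src E z) ys"
      have y: "src E y = src E z" "tgt E y = ?Y"
        unfolding y_def using yt tgt_tup[OF yt(1)] len by simp_all
      have cy: "comps U p y = ys" unfolding y_def by (rule comps_tup[OF yt(1) len])
      then have ci: "coord U p i y = ys ! i" if "i < p" for i using that by (metis add_0 diff_zero length_upt nth_map nth_upt)
      have qi: "(q \<odot> ?c i) \<odot> y = ?j" if "i < p" for i
        unfolding qc[OF y(2) that] ci[OF that] using yt(2) that len by simp
      have "chart_rel k n \<phi> y (comps U p y)"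
        unfolding cy using ys(3) chart_rel_stage[of ?j y] y z by simp
      moreover have "\<forall>i\<in>{..<p}. (q \<odot> ?c i) \<odot> y = (q \<odot> ?c 0) \<odot> y"
        unfolding Ball_def lessThan_iff using qi p0 by metis
      ultimately have W: "?W y" by blast
      have "?g \<odot> y = z"
      proof (rule prj_eqI[where X = J0 and Y = ?X])
        show "prj1 E J0 ?X \<odot> (?g \<odot> y) = prj1 E J0 ?X \<odot> z"
          using gy[OF y(2)] tt(1,2)[OF y(2)] qi[OF p0] qc[OF y(2) p0] y z p0 chart_typing by (simp del: coord.simps)
        have "prj2 E J0 ?X \<odot> (?g \<odot> y) = tup (src E y) (map (\<lambda>i. \<iota> \<odot> coord U p i y) [0..<p])"
          using gy[OF y(2)] tt(1,2)[OF y(2)] y z p0 chart_typing by (simp del: coord.simps)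
        also have "map (\<lambda>i. \<iota> \<odot> coord U p i y) [0..<p] = comps A p ?x"
        proof -
          have "map (\<lambda>i. \<iota> \<odot> coord U p i y) [0..<p] = map (\<lambda>y. \<iota> \<odot> y) (comps U p y)" by simp
          then show ?thesis unfolding cy ys(2) .
        qed
        also have "tup (src E y) (comps A p ?x) = ?x" using y z by (intro tup_coord) simp_all
        finally show "prj2 E J0 ?X \<odot> (?g \<odot> y) = ?x" .
      qed (use gt y z in simp_all)
      with y W show "\<exists>y. src E y = src E z \<and> tgt E y = ?Y \<and> ?W y \<and> ?g \<odot> y = z" by blast
    qed
  qed
qed

lemma neighbours_definable: "definable (pw A p) (\<lambda>x. neighbours (comps A p x))"
proof (cases p)
  case 0
  then show ?thesis by (simp add: neighbours_def definable_True)
next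
  case (Suc r)
  let ?X = "pw A p"
  let ?P = "prd E J0 ?X" and ?j = "prj1 E J0 ?X" and ?x = "prj2 E J0 ?X"
  let ?a = "coord A p 0 (ident E ?X)"
  let ?same = "\<lambda>z. (e0 \<odot> ?j) \<odot> z = (?a \<odot> ?x) \<odot> z"
  let ?lift = "\<lambda>z. lifts (?j \<odot> z) (comps A p (?x \<odot> z))"
  have at: "src E ?a = ?X" "tgt E ?a = A" using Suc by (simp_all del: coord.simps pw.simps)
  have a: "?a \<odot> x = coord A p 0 x" if "tgt E x = ?X" for x
    using that Suc by (simp add: coord_cmp del: coord.simps pw.simps)
  \<comment> \<open>The element \<open>z\<close> is a pair of an index and a tuple; \<open>?same\<close> says that the index lies over the first point.\<close>
  have "definable ?P (\<lambda>z. \<forall>w. tgt E w = src E z \<longrightarrow> ?same (z \<odot> w) \<longrightarrow> ?lift (z \<odot> w))"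
  proof (rule definable_imp)
    show "definable ?P ?same" using at e0 by (intro definable_eq) (simp_all del: coord.simps pw.simps)
    show "definable ?P ?lift" by (rule lifts_definable[OF Suc])
  qed
  from definable_all[OF this] show ?thesis
  proof (rule definable_cong)
    fix x assume x: "tgt E x = ?X"
    have ne: "comps A p x \<noteq> []" and hd: "hd (comps A p x) = coord A p 0 x"
      using Suc by (simp_all add: upt_conv_Cons del: upt_Suc)
    have c0: "src E (coord A p 0 x) = src E x" "tgt E (coord A p 0 x) = A"
      using x Suc by (simp_all del: coord.simps pw.simps)
    have same: "?same \<langle>j, x \<odot> w\<rangle> \<longleftrightarrow> e0 \<odot> j = coord A p 0 x \<odot> w"
      if "tgt E w = src E x" "tgt E j = J0" "src E j = src E w" for j w
      using that x e0 at a[of "x \<odot> w"] Suc by (simp add: coord_cmp del: coord.simps pw.simps)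
    have cm: "comps A p (x \<odot> w) = map (\<lambda>y. y \<odot> w) (comps A p x)" if "tgt E w = src E x" for w
      using that x by (simp add: coord_cmp del: coord.simps pw.simps)
    have lift: "?lift \<langle>j, x \<odot> w\<rangle> \<longleftrightarrow> lifts j (map (\<lambda>y. y \<odot> w) (comps A p x))"
      if "tgt E w = src E x" "tgt E j = J0" "src E j = src E w" for j w
      using that x cm[OF that(1)] by (simp del: map_map)
    have nb: "neighbours (comps A p x) \<longleftrightarrow> (\<forall>w j. tgt E w = src E x \<longrightarrow> tgt E j = J0 \<longrightarrow> src E j = src E w \<longrightarrow>
        ?same \<langle>j, x \<odot> w\<rangle> \<longrightarrow> ?lift \<langle>j, x \<odot> w\<rangle>)"
      unfolding neighbours_def hd c0(1) using ne same lift by (auto simp del: coord.simps upt_Suc)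
    show "(\<forall>u y. tgt E u = src E x \<longrightarrow> tgt E y = J0 \<longrightarrow> src E y = src E u \<longrightarrow>
        (\<forall>w. tgt E w = src E \<langle>y, x \<odot> u\<rangle> \<longrightarrow> ?same (\<langle>y, x \<odot> u\<rangle> \<odot> w) \<longrightarrow> ?lift (\<langle>y, x \<odot> u\<rangle> \<odot> w))) \<longleftrightarrow>
        neighbours (comps A p x)"
      unfolding nb
    proof (intro iffI allI impI)
      fix u j assume *: "\<forall>u y. tgt E u = src E x \<longrightarrow> tgt E y = J0 \<longrightarrow> src E y = src E u \<longrightarrow>
          (\<forall>w. tgt E w = src E \<langle>y, x \<odot> u\<rangle> \<longrightarrow> ?same (\<langle>y, x \<odot> u\<rangle> \<odot> w) \<longrightarrow> ?lift (\<langle>y, x \<odot> u\<rangle> \<odot> w))"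
        and t: "tgt E u = src E x" "tgt E j = J0" "src E j = src E u" and s: "?same \<langle>j, x \<odot> u\<rangle>"
      have z: "src E \<langle>j, x \<odot> u\<rangle> = src E u" "\<langle>j, x \<odot> u\<rangle> \<odot> ident E (src E u) = \<langle>j, x \<odot> u\<rangle>"
        using t by simp_all
      show "?lift \<langle>j, x \<odot> u\<rangle>"
        using *[rule_format, of u j "ident E (src E u)"] t s unfolding z by simp
    next
      fix u y w assume *: "\<forall>w j. tgt E w = src E x \<longrightarrow> tgt E j = J0 \<longrightarrow> src E j = src E w \<longrightarrow>
          ?same \<langle>j, x \<odot> w\<rangle> \<longrightarrow> ?lift \<langle>j, x \<odot> w\<rangle>"
        and t: "tgt E u = src E x" "tgt E y = J0" "src E y = src E u" "tgt E w = src E \<langle>y, x \<odot> u\<rangle>"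
        and s: "?same (\<langle>y, x \<odot> u\<rangle> \<odot> w)"
      have z: "\<langle>y, x \<odot> u\<rangle> \<odot> w = \<langle>y \<odot> w, x \<odot> (u \<odot> w)\<rangle>" using t by simp
      show "?lift (\<langle>y, x \<odot> u\<rangle> \<odot> w)"
        using *[rule_format, of "u \<odot> w" "y \<odot> w"] s t unfolding z by simp
    qed
  qed
qed

lemma neighbours_family:
  "\<exists>S. (\<forall>p. S p \<in> hom I (pwr E (pw A p))) \<and>
    (\<forall>u xs. tgt E u = I \<longrightarrow> (\<forall>x\<in>set xs. src E x = src E u \<and> tgt E x = A) \<longrightarrow>
      (family_rel A S u xs \<longleftrightarrow> neighbours xs))"
proof -
  have "\<exists>c. src E c = I \<and> tgt E c = pwr E (pw A p) \<and>
    (\<forall>u x. tgt E u = I \<longrightarrow> tgt E x = pw A p \<longrightarrow> src E x = src E u \<longrightarrow>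
      (member (pw A p) x (c \<odot> u) \<longleftrightarrow> neighbours (comps A p x)))" for p
  proof -
    have "definable (prd E (pw A p) I) (\<lambda>z. neighbours (comps A p (prj1 E (pw A p) I \<odot> z)))"
      by (rule definable_subst[OF neighbours_definable]) simp_all
    from comprehension[OF this] show ?thesis by (auto simp del: coord.simps)
  qed
  then obtain S where S: "\<And>p. src E (S p) = I \<and> tgt E (S p) = pwr E (pw A p) \<and>
    (\<forall>u x. tgt E u = I \<longrightarrow> tgt E x = pw A p \<longrightarrow> src E x = src E u \<longrightarrow>
      (member (pw A p) x (S p \<odot> u) \<longleftrightarrow> neighbours (comps A p x)))" by metis
  show ?thesis
  proof (intro exI[of _ S] conjI allI impI)
    show "S p \<in> hom I (pwr E (pw A p))" for p using S[of p] by (simp add: hom_iff)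
    fix u xs assume u: "tgt E u = I" and xs: "\<forall>x\<in>set xs. src E x = src E u \<and> tgt E x = A"
    have "src E (tup (src E u) xs) = src E u" "tgt E (tup (src E u) xs) = pw A (length xs)"
      using xs tgt_tup[OF xs] by simp_all
    then show "family_rel A S u xs \<longleftrightarrow> neighbours xs"
      using S[of "length xs"] u comps_tup[OF xs refl] by (simp add: family_rel_def)
  qed
qed

text \<open>
  Independence of the chart: \<open>transport_neighbours\<close> for the identity of \<open>A\<close>, from the given chart to the
  chart of the covering family with index \<open>j\<close>, which contains the first point by \<open>section_at\<close>.
\<close>

lemma chart_neighbours:
  assumes c: "chart n K U' q' \<iota>' \<phi>' A" and u: "tgt E u = K"
    and ys: "set ys \<subseteq> fibre U' q' u" "chart_rel k n \<phi>' u ys"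
  shows "neighbours (map (\<lambda>y. \<iota>' \<odot> y) ys)"
  unfolding neighbours_def
proof (intro impI allI)
  have "formally_open K U' q' \<iota>' A" "formally_open K U' q' \<phi>' (Rn n)" using c by (simp_all add: chart_def)
  note ty = this[THEN formally_open_typing(1)] this[THEN formally_open_typing(2)]
    this[THEN formally_open_typing(3)] this[THEN formally_open_typing(4)]
  have yt: "\<forall>y\<in>set ys. src E y = src E u \<and> tgt E y = U'" using ys(1) by (auto simp: fibre_iff)
  fix w j assume ne: "map (\<lambda>y. \<iota>' \<odot> y) ys \<noteq> []"
    and w: "tgt E w = src E (hd (map (\<lambda>y. \<iota>' \<odot> y) ys))" and j: "tgt E j = J0" "src E j = src E w"
    and e: "e0 \<odot> j = hd (map (\<lambda>y. \<iota>' \<odot> y) ys) \<odot> w"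
  obtain y0 ys' where ys_eq: "ys = y0 # ys'" using ne by (cases ys) auto
  have y0: "src E y0 = src E u" "tgt E y0 = U'" using yt ys_eq by auto
  then have wt: "tgt E w = src E u" using w ys_eq ty by simp
  let ?L = "src E w" and ?zs = "map (\<lambda>y. y \<odot> w) ys"
  have zf: "set ?zs \<subseteq> fibre U' q' (u \<odot> w)"
  proof
    fix z assume "z \<in> set ?zs"
    then obtain y where y: "y \<in> set ys" "z = y \<odot> w" by auto
    then have "src E y = src E u" "tgt E y = U'" "q' \<odot> y = u" using ys(1) by (auto simp: fibre_iff)
    moreover from this have "q' \<odot> (y \<odot> w) = u \<odot> w" using wt ty assoc[of w y q'] by simp
    ultimately show "z \<in> fibre U' q' (u \<odot> w)" using y wt by (simp add: fibre_iff)
  qed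
  have zr: "chart_rel k n \<phi>' (u \<odot> w) ?zs"
    using yt ty wt by (intro chart_rel_restrict ys(2)) simp_all
  have z0: "y0 \<odot> w \<in> set ?zs" using ys_eq by simp
  have sj: "\<iota> \<odot> (s \<odot> j) = prj2 E ?L A \<odot> \<langle>ident E ?L, \<iota>' \<odot> (y0 \<odot> w)\<rangle>"
    using section_at[OF j(1)] e ys_eq y0 wt ty by simp
  have uw: "src E (u \<odot> w) = ?L" "tgt E (u \<odot> w) = K" using u wt by simp_all
  obtain zs where zs: "set zs \<subseteq> fibre U q j" "chart_rel k n \<phi> j zs"
    "map (\<lambda>z. \<iota> \<odot> z) zs = map (\<lambda>y. prj2 E ?L A \<odot> \<langle>ident E ?L, \<iota>' \<odot> y\<rangle>) ?zs"
    by (rule transport_neighbours[OF k c uw zf zr z0 chart j(2,1) src_prj(2) tgt_prj(2) _ sj])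
      (use section_at[OF j(1)] in blast)
  have "map (\<lambda>y. prj2 E ?L A \<odot> \<langle>ident E ?L, \<iota>' \<odot> y\<rangle>) ?zs = map (\<lambda>x. x \<odot> w) (map (\<lambda>y. \<iota>' \<odot> y) ys)"
    using yt wt ty by simp
  then show "lifts j (map (\<lambda>x. x \<odot> w) (map (\<lambda>y. \<iota>' \<odot> y) ys))"
    unfolding lifts_def using zs by auto
qed

text \<open>
  An index \<open>j\<close> over the first point exists after pulling \<open>e0\<close> back along this point.
\<close>

lemma neighbours_locally:
  assumes nb: "neighbours xs" "xs \<noteq> []" and xs: "\<forall>x\<in>set xs. src E x = L \<and> tgt E x = A"
  obtains e j ys where "epic e" "tgt E e = L" "src E j = src E e" "tgt E j = J0"
    "set ys \<subseteq> fibre U q j" "map (\<lambda>y. \<iota> \<odot> y) ys = map (\<lambda>x. x \<odot> e) xs" "chart_rel k n \<phi> j ys"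
proof -
  have h: "src E (hd xs) = L" "tgt E (hd xs) = A" using xs nb(2) by simp_all
  obtain e j where pb: "is_pullback e j (hd xs) e0" using pullback_exists[of "hd xs" e0] h e0 by auto
  note ty = pullback_typing[OF pb]
  have "lifts j (map (\<lambda>x. x \<odot> e) xs)"
    using nb ty h e0 unfolding neighbours_def by metis
  then show ?thesis
    unfolding lifts_def using that pullback_epic[OF e0(1) pb] ty h e0 by metis
qed

lemma neighbours_singleton:
  assumes "tgt E x = A"
  shows "neighbours [x]"
  unfolding neighbours_def
proof (intro impI allI)
  fix w j assume j: "tgt E j = J0" "e0 \<odot> j = hd [x] \<odot> w"
  show "lifts j (map (\<lambda>x. x \<odot> w) [x])"
    unfolding lifts_def using section_at[OF j(1)] j(2)
    by (intro exI[of _ "[s \<odot> j]"]) (simp add: chart_rel_singleton)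
qed

lemma neighbours_descent:
  assumes xs: "\<forall>x\<in>set xs. src E x = L \<and> tgt E x = A" and e: "epic e" "tgt E e = L"
    and nb: "neighbours (map (\<lambda>x. x \<odot> e) xs)"
  shows "neighbours xs"
proof -
  let ?p = "length xs" and ?z = "tup L xs"
  have z: "src E ?z = L" "tgt E ?z = pw A ?p" using xs tgt_tup[OF xs] by simp_all
  have xs': "\<forall>x\<in>set (map (\<lambda>x. x \<odot> e) xs). src E x = src E e \<and> tgt E x = A" using xs e by simp
  have "neighbours (comps A ?p (?z \<odot> e))"
    unfolding tup_cmp[OF xs e(2)] using comps_tup[OF xs', of ?p] nb by simp
  from definable_descent[OF neighbours_definable[of ?p] e(1) z(2) _ this] have "neighbours (comps A ?p ?z)"
    using z(1) e(2) by simp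
  then show ?thesis using comps_tup[OF xs refl] by simp
qed

text \<open>
  The condition on coordinate differences involves only the set of points, so within a chart it passes to
  subsets; the claim follows by descent.
\<close>

lemma neighbours_subset:
  assumes nb: "neighbours xs" and xs: "\<forall>x\<in>set xs. src E x = L \<and> tgt E x = A" and zs: "set zs \<subseteq> set xs"
  shows "neighbours zs"
proof (cases "xs = []")
  case True
  then show ?thesis using zs by (simp add: neighbours_def)
next
  case False
  obtain e j ys where e: "epic e" "tgt E e = L" and j: "src E j = src E e" "tgt E j = J0"
    and ys: "set ys \<subseteq> fibre U q j" "map (\<lambda>y. \<iota> \<odot> y) ys = map (\<lambda>x. x \<odot> e) xs" "chart_rel k n \<phi> j ys"
    by (rule neighbours_locally[OF nb False xs])
  have "\<forall>z\<in>set zs. \<exists>y. y \<in> set ys \<and> \<iota> \<odot> y = z \<odot> e"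
  proof
    fix z assume "z \<in> set zs"
    then have "z \<odot> e \<in> set (map (\<lambda>y. \<iota> \<odot> y) ys)" unfolding ys(2) using zs by auto
    then show "\<exists>y. y \<in> set ys \<and> \<iota> \<odot> y = z \<odot> e" by auto
  qed
  then obtain g where g: "\<forall>z\<in>set zs. g z \<in> set ys \<and> \<iota> \<odot> g z = z \<odot> e" by metis
  have sub: "set (map g zs) \<subseteq> set ys" using g by auto
  have "chart_rel k n \<phi> j (map g zs)"
  proof (rule chart_rel_subset[OF ys(3) sub])
    show "\<forall>y\<in>set ys. src E y = src E j \<and> tgt E y = src E \<phi>"
      using ys(1) chart_typing by (auto simp: fibre_iff)
  qed (simp add: chart_typing)
  then have "neighbours (map (\<lambda>y. \<iota> \<odot> y) (map g zs))"
    using sub ys(1) j(2) by (intro chart_neighbours[OF chart]) auto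
  moreover have "map (\<lambda>y. \<iota> \<odot> y) (map g zs) = map (\<lambda>z. z \<odot> e) zs" using g by simp
  ultimately have "neighbours (map (\<lambda>z. z \<odot> e) zs)" by (simp only:)
  moreover have "\<forall>z\<in>set zs. src E z = L \<and> tgt E z = A" using xs zs by blast
  ultimately show ?thesis using e by (intro neighbours_descent[of zs L e])
qed

text \<open>
  A morphism restricts to every chart because the images of charts are tuples of neighbours. Conversely, a
  tuple of neighbours lifts to a chart after an epimorphism, the values form a tuple of \<open>T\<close> there, and
  membership in \<open>T\<close> descends.
\<close>

lemma neighbours_kth_order:
  assumes S: "\<And>p. S p \<in> hom I (pwr E (pw A p))"
    and rel: "\<And>u xs. \<lbrakk>tgt E u = I; \<forall>x\<in>set xs. src E x = src E u \<and> tgt E x = A\<rbrakk> \<Longrightarrow>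
      family_rel A S u xs \<longleftrightarrow> neighbours xs"
  shows "kth_order_structure k n I A S"
  unfolding kth_order_structure_def
proof (intro conjI allI ballI impI)
  show "i_structure I A S"
    unfolding i_structure_def
  proof (intro conjI allI ballI impI S)
    fix J u assume "u \<in> hom J I"
    then have u: "src E u = J" "tgt E u = I" by (simp_all add: hom_iff)
    show "family_rel A S u []" using rel[OF u(2), of "[]"] by (simp add: neighbours_def)
    show "family_rel A S u [x]" if "x \<in> hom J A" for x
      using that u rel[OF u(2), of "[x]"] neighbours_singleton[of x] by (simp add: hom_iff)
    fix m p :: nat and h xs assume h: "h \<in> {..<m} \<rightarrow> {..<p}" and xs: "xs \<in> tuples J A p" and r: "family_rel A S u xs"
    have xt: "\<forall>x\<in>set xs. src E x = src E u \<and> tgt E x = A" "length xs = p" using xs u by (simp_all add: tuples_iff)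
    have sub: "set (map (\<lambda>i. xs ! h i) [0..<m]) \<subseteq> set xs" using h xt(2) by (auto simp: Pi_iff)
    then have "\<forall>x\<in>set (map (\<lambda>i. xs ! h i) [0..<m]). src E x = src E u \<and> tgt E x = A" using xt(1) by blast
    then show "family_rel A S u (map (\<lambda>i. xs ! h i) [0..<m])"
      using rel[OF u(2)] rel[OF u(2) xt(1)] r neighbours_subset[OF _ xt(1) sub] by blast
  qed
  fix M J T v f assume "v \<in> hom J I" "f \<in> hom (prd E J A) M" and T: "i_structure J M T"
  then have v: "src E v = J" "tgt E v = I" and f: "src E f = prd E J A" "tgt E f = M" by (simp_all add: hom_iff)
  have Tt: "T p \<in> hom J (pwr E (pw M p))" for p using T by (simp add: i_structure_def)
  let ?charts = "\<forall>K. \<forall>w\<in>hom K J. \<forall>U q \<iota> \<phi>. chart n K U q \<iota> \<phi> A \<longrightarrow>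
    i_morphism K (fibre U q) (chart_rel k n \<phi>) (\<lambda>u y. f \<odot> \<langle>w \<odot> u, \<iota> \<odot> y\<rangle>) (family_rel M (\<lambda>p. T p \<odot> w))"
  show "space_i_morphism J A (\<lambda>p. S p \<odot> v) f M T \<longleftrightarrow> ?charts"
  proof
    assume mor: "space_i_morphism J A (\<lambda>p. S p \<odot> v) f M T"
    show ?charts
      unfolding i_morphism_def
    proof (intro allI ballI impI)
      fix K w U' q' \<iota>' \<phi>' L u ys
      assume "w \<in> hom K J" and c: "chart n K U' q' \<iota>' \<phi>' A" and "u \<in> hom L K"
        and ys: "set ys \<subseteq> fibre U' q' u \<and> chart_rel k n \<phi>' u ys"
      then have w: "src E w = K" "tgt E w = J" and u: "src E u = L" "tgt E u = K" by (simp_all add: hom_iff)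
      have ct: "src E \<iota>' = U'" "tgt E \<iota>' = A" using c by (simp_all add: chart_def formally_open_def hom_iff)
      let ?xs = "map (\<lambda>y. \<iota>' \<odot> y) ys"
      have xt: "\<forall>x\<in>set ?xs. src E x = L \<and> tgt E x = A" using ys ct u by (auto simp: fibre_iff)
      have "neighbours ?xs" using ys by (intro chart_neighbours[OF c u(2)]) auto
      then have "family_rel A S (v \<odot> (w \<odot> u)) ?xs" using xt v w u by (subst rel) simp_all
      then have "family_rel A (\<lambda>p. S p \<odot> v) (w \<odot> u) ?xs"
        using family_rel_restrict_index[OF S v(2)] v w u by simp
      moreover have "w \<odot> u \<in> hom L J" "set ?xs \<subseteq> hom (src E (w \<odot> u)) A"
        using w u xt by (auto simp: hom_iff)
      ultimately have "family_rel M T (w \<odot> u) (map (\<lambda>x. f \<odot> \<langle>w \<odot> u, x\<rangle>) ?xs)"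
        using mor unfolding space_i_morphism_def i_morphism_def by blast
      then show "family_rel M (\<lambda>p. T p \<odot> w) u (map (\<lambda>y. f \<odot> \<langle>w \<odot> u, \<iota>' \<odot> y\<rangle>) ys)"
        using family_rel_restrict_index[OF Tt w(2)] w u by (simp add: comp_def)
    qed
  next
    assume charts: ?charts
    show "space_i_morphism J A (\<lambda>p. S p \<odot> v) f M T"
      unfolding space_i_morphism_def i_morphism_def
    proof (intro allI ballI impI)
      fix L u xs assume uh: "u \<in> hom L J" and *: "set xs \<subseteq> hom (src E u) A \<and> family_rel A (\<lambda>p. S p \<odot> v) u xs"
      then have u: "src E u = L" "tgt E u = J" and xt: "\<forall>x\<in>set xs. src E x = L \<and> tgt E x = A"
        by (auto simp: hom_iff)
      show "family_rel M T u (map (\<lambda>x. f \<odot> \<langle>u, x\<rangle>) xs)"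
      proof (cases "xs = []")
        case True
        then show ?thesis using T uh by (simp add: i_structure_def)
      next
        case False
        have "family_rel A S (v \<odot> u) xs" using * family_rel_restrict_index[OF S v(2)] v u by simp
        then have nb: "neighbours xs" using xt v u by (subst (asm) rel) simp_all
        obtain e j ys where e: "epic e" "tgt E e = L" and j: "src E j = src E e" "tgt E j = J0"
          and ys: "set ys \<subseteq> fibre U q j" "map (\<lambda>y. \<iota> \<odot> y) ys = map (\<lambda>x. x \<odot> e) xs" "chart_rel k n \<phi> j ys"
          by (rule neighbours_locally[OF nb False xt])
        let ?L = "src E e"
        obtain q' \<pi> where q': "tgt E q' = ?L" "src E q' = src E \<pi>" "tgt E \<pi> = U"
          and c: "chart n ?L (src E \<pi>) q' (\<iota> \<odot> \<pi>) (\<phi> \<odot> \<pi>) A"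
          and lift: "\<And>u y. tgt E u = ?L \<Longrightarrow> y \<in> fibre U q (j \<odot> u) \<Longrightarrow> \<exists>y'\<in>fibre (src E \<pi>) q' u. \<pi> \<odot> y' = y"
          by (rule restrict_chart[OF chart j]) blast
        let ?i = "ident E ?L"
        have "\<forall>y\<in>set ys. \<exists>y'. y' \<in> fibre (src E \<pi>) q' ?i \<and> \<pi> \<odot> y' = y"
          using lift[of ?i] ys(1) j by auto
        then obtain g where g: "\<forall>y\<in>set ys. g y \<in> fibre (src E \<pi>) q' ?i \<and> \<pi> \<odot> g y = y" by metis
        have gt: "\<forall>y\<in>set ys. src E (g y) = ?L \<and> tgt E (g y) = src E \<pi>" using g by (auto simp: fibre_iff)
        have \<phi>g: "map (\<lambda>y. (\<phi> \<odot> \<pi>) \<odot> y) (map g ys) = map (\<lambda>y. \<phi> \<odot> y) ys"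
          using g gt q' chart_typing by simp
        have \<iota>g: "map (\<lambda>y. (\<iota> \<odot> \<pi>) \<odot> y) (map g ys) = map (\<lambda>x. x \<odot> e) xs"
          unfolding ys(2)[symmetric] using g gt q' chart_typing by simp
        have cr: "chart_rel k n (\<phi> \<odot> \<pi>) ?i (map g ys)"
          using ys(3) j(1) unfolding chart_rel_def \<phi>g by simp
        have w: "u \<odot> e \<in> hom ?L J" "?i \<in> hom ?L ?L" using u e by (simp_all add: hom_iff)
        have "i_morphism ?L (fibre (src E \<pi>) q') (chart_rel k n (\<phi> \<odot> \<pi>))
            (\<lambda>u' y. f \<odot> \<langle>(u \<odot> e) \<odot> u', (\<iota> \<odot> \<pi>) \<odot> y\<rangle>) (family_rel M (\<lambda>p. T p \<odot> (u \<odot> e)))"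
          using charts w(1) c by blast
        moreover have "set (map g ys) \<subseteq> fibre (src E \<pi>) q' ?i" using g by auto
        ultimately have "family_rel M (\<lambda>p. T p \<odot> (u \<odot> e)) ?i
            (map (\<lambda>y. f \<odot> \<langle>(u \<odot> e) \<odot> ?i, (\<iota> \<odot> \<pi>) \<odot> y\<rangle>) (map g ys))"
          using cr w(2) unfolding i_morphism_def by blast
        moreover have "map (\<lambda>y. f \<odot> \<langle>(u \<odot> e) \<odot> ?i, (\<iota> \<odot> \<pi>) \<odot> y\<rangle>) (map g ys) =
            map (\<lambda>x. f \<odot> \<langle>u \<odot> e, x\<rangle>) (map (\<lambda>y. (\<iota> \<odot> \<pi>) \<odot> y) (map g ys))"
          using u e by simp
        moreover have "\<dots> = map (\<lambda>x. x \<odot> e) (map (\<lambda>x. f \<odot> \<langle>u, x\<rangle>) xs)"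
          unfolding \<iota>g using u e xt f by simp
        ultimately have "family_rel M (\<lambda>p. T p \<odot> (u \<odot> e)) ?i (map (\<lambda>x. x \<odot> e) (map (\<lambda>x. f \<odot> \<langle>u, x\<rangle>) xs))"
          by (simp only:)
        then have "family_rel M T (u \<odot> e) (map (\<lambda>x. x \<odot> e) (map (\<lambda>x. f \<odot> \<langle>u, x\<rangle>) xs))"
          using family_rel_restrict_index[OF Tt, of "u \<odot> e" ?i] u e by simp
        then show ?thesis
          using u e xt f by (intro family_rel_descent[OF Tt u(2) _ e(1)]) auto
      qed
    qed
  qed
qed

end

section \<open>The universal property and its consequences\<close>

context sdg_model
begin

lemma formal_manifold_chart:
  assumes "formal_manifold n A" "tgt E x = A"
  obtains e J U q \<iota> \<phi> y where "epic e" "src E e = J" "tgt E e = src E x" "chart n J U q \<iota> \<phi> A"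
    "y \<in> fibre U q (ident E J)" "\<iota> \<odot> y = x \<odot> e"
proof -
  have "x \<in> hom (src E x) A" using assms(2) by (simp add: hom_iff)
  then obtain J e U q \<iota> \<phi> y where "e \<in> hom J (src E x)" "epic e" "chart n J U q \<iota> \<phi> A"
    "y \<in> fibre U q (ident E J)" "\<iota> \<odot> y = x \<odot> e"
    using assms(1) unfolding formal_manifold_def by blast
  then show ?thesis using that by (simp add: hom_iff)
qed

lemma kth_order_exists:
  assumes k: "k \<ge> 1" and A: "formal_manifold n A"
  shows "\<exists>S. kth_order_structure k n I A S"
proof -
  obtain e0 J0 U q \<iota> \<phi> s where e0: "epic e0" "src E e0 = J0" "tgt E e0 = src E (ident E A)"
    and c: "chart n J0 U q \<iota> \<phi> A" and s: "s \<in> fibre U q (ident E J0)" "\<iota> \<odot> s = ident E A \<odot> e0"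
    by (rule formal_manifold_chart[OF A, of "ident E A"]) simp
  interpret covering_chart E k n A J0 e0 U q \<iota> \<phi> s
    using k e0 c s by unfold_locales simp_all
  show ?thesis using neighbours_family[of I] neighbours_kth_order by blast
qed

lemma kth_order_i_structure: "kth_order_structure k n I A S \<Longrightarrow> i_structure I A S"
  by (simp add: kth_order_structure_def)

lemma i_structure_hom: "i_structure I A S \<Longrightarrow> S p \<in> hom I (pwr E (pw A p))"
  by (simp add: i_structure_def)

lemma i_structure_restrict_ident:
  assumes "i_structure I A S"
  shows "(\<lambda>p. S p \<odot> ident E I) = S"
  using i_structure_hom[OF assms] by (intro ext) (simp add: hom_iff)

lemma kth_order_morphism_iff:
  assumes S: "kth_order_structure k n I A S" and T: "i_structure I M T" and f: "f \<in> hom (prd E I A) M"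
  shows "space_i_morphism I A S f M T \<longleftrightarrow>
    (\<forall>K. \<forall>w\<in>hom K I. \<forall>U q \<iota> \<phi>. chart n K U q \<iota> \<phi> A \<longrightarrow>
       i_morphism K (fibre U q) (chart_rel k n \<phi>)
         (\<lambda>u y. f \<odot> \<langle>w \<odot> u, \<iota> \<odot> y\<rangle>) (family_rel M (\<lambda>p. T p \<odot> w)))"
proof -
  have "space_i_morphism I A (\<lambda>p. S p \<odot> ident E I) f M T \<longleftrightarrow>
    (\<forall>K. \<forall>w\<in>hom K I. \<forall>U q \<iota> \<phi>. chart n K U q \<iota> \<phi> A \<longrightarrow>
       i_morphism K (fibre U q) (chart_rel k n \<phi>)
         (\<lambda>u y. f \<odot> \<langle>w \<odot> u, \<iota> \<odot> y\<rangle>) (family_rel M (\<lambda>p. T p \<odot> w)))"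
    using S ident_hom[of I] f T unfolding kth_order_structure_def by blast
  then show ?thesis
    unfolding i_structure_restrict_ident[OF kth_order_i_structure[OF S]] .
qed

text \<open>
  The universal property for the identity map of \<open>A\<close>, which is a morphism from \<open>S\<close> to itself.
\<close>

lemma kth_order_contains_charts:
  assumes S: "kth_order_structure k n I A S" and w: "src E w = K" "tgt E w = I"
    and c: "chart n K U q \<iota> \<phi> A" and u: "tgt E u = K"
    and ys: "set ys \<subseteq> fibre U q u" "chart_rel k n \<phi> u ys"
  shows "family_rel A S (w \<odot> u) (map (\<lambda>y. \<iota> \<odot> y) ys)"
proof -
  note i = kth_order_i_structure[OF S]
  have ct: "src E \<iota> = U" "tgt E \<iota> = A" using c by (simp_all add: chart_def formally_open_def hom_iff)
  have "space_i_morphism I A S (prj2 E I A) A S"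
    unfolding space_i_morphism_def i_morphism_def
  proof (intro allI ballI impI)
    fix J v xs assume v: "v \<in> hom J I" and xs: "set xs \<subseteq> hom (src E v) A \<and> family_rel A S v xs"
    have "map (\<lambda>x. prj2 E I A \<odot> \<langle>v, x\<rangle>) xs = xs"
      using v xs by (intro map_idI) (auto simp: hom_iff)
    then show "family_rel A S v (map (\<lambda>x. prj2 E I A \<odot> \<langle>v, x\<rangle>) xs)" using xs by simp
  qed
  then have "i_morphism K (fibre U q) (chart_rel k n \<phi>)
      (\<lambda>u y. prj2 E I A \<odot> \<langle>w \<odot> u, \<iota> \<odot> y\<rangle>) (family_rel A (\<lambda>p. S p \<odot> w))"
    using kth_order_morphism_iff[OF S i, of "prj2 E I A"] w c by (simp add: hom_iff)
  moreover have "u \<in> hom (src E u) K" using u by (simp add: hom_iff)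
  ultimately have "family_rel A (\<lambda>p. S p \<odot> w) u (map (\<lambda>y. prj2 E I A \<odot> \<langle>w \<odot> u, \<iota> \<odot> y\<rangle>) ys)"
    using ys unfolding i_morphism_def by blast
  moreover have "map (\<lambda>y. prj2 E I A \<odot> \<langle>w \<odot> u, \<iota> \<odot> y\<rangle>) ys = map (\<lambda>y. \<iota> \<odot> y) ys"
    using ys(1) ct u w by (auto simp: fibre_iff)
  ultimately show ?thesis
    using family_rel_restrict_index[OF i_structure_hom[OF i] w(2), of u] u w by simp
qed

text \<open>
  The structure \<open>T\<close> contains the images of all charts, so the universal property of \<open>S\<close> makes the identity a
  morphism from \<open>S\<close> to \<open>T\<close>.
\<close>

lemma kth_order_minimal:
  assumes S: "kth_order_structure k n I A S" and T: "kth_order_structure k n I A T"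
    and u: "tgt E u = I" and xs: "\<forall>x\<in>set xs. src E x = src E u \<and> tgt E x = A"
    and rel: "family_rel A S u xs"
  shows "family_rel A T u xs"
proof -
  note i = kth_order_i_structure[OF T]
  have "space_i_morphism I A S (prj2 E I A) A T"
    unfolding kth_order_morphism_iff[OF S i prj2_hom] i_morphism_def
  proof (intro allI ballI impI)
    fix K w U q \<iota> \<phi> J v ys
    assume "w \<in> hom K I" and c: "chart n K U q \<iota> \<phi> A" and "v \<in> hom J K"
      and ys: "set ys \<subseteq> fibre U q v \<and> chart_rel k n \<phi> v ys"
    then have w: "src E w = K" "tgt E w = I" and v: "src E v = J" "tgt E v = K" by (simp_all add: hom_iff)
    have ct: "src E \<iota> = U" "tgt E \<iota> = A" using c by (simp_all add: chart_def formally_open_def hom_iff)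
    have eq: "map (\<lambda>y. prj2 E I A \<odot> \<langle>w \<odot> v, \<iota> \<odot> y\<rangle>) ys = map (\<lambda>y. \<iota> \<odot> y) ys"
      using ys ct v w by (auto simp: fibre_iff)
    show "family_rel A (\<lambda>p. T p \<odot> w) v (map (\<lambda>y. prj2 E I A \<odot> \<langle>w \<odot> v, \<iota> \<odot> y\<rangle>) ys)"
      unfolding eq using kth_order_contains_charts[OF T w c v(2)] ys
        family_rel_restrict_index[OF i_structure_hom[OF i] w(2), of v] v w by simp
  qed
  moreover have "u \<in> hom (src E u) I" "set xs \<subseteq> hom (src E u) A" using u xs by (auto simp: hom_iff)
  ultimately have "family_rel A T u (map (\<lambda>x. prj2 E I A \<odot> \<langle>u, x\<rangle>) xs)"
    using rel unfolding space_i_morphism_def i_morphism_def by blast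
  moreover have "map (\<lambda>x. prj2 E I A \<odot> \<langle>u, x\<rangle>) xs = xs" using u xs by (intro map_idI) simp
  ultimately show ?thesis by simp
qed

lemma kth_order_unique:
  assumes S: "kth_order_structure k n I A S" and T: "kth_order_structure k n I A T"
  shows "S = T"
proof (rule family_eqI)
  show "S p \<in> hom I (pwr E (pw A p))" "T p \<in> hom I (pwr E (pw A p))" for p
    using S T by (simp_all add: kth_order_i_structure i_structure_hom)
qed (use kth_order_minimal[OF S T] kth_order_minimal[OF T S] in blast)

text \<open>
  The universal property of \<open>S\<close> reduces the claim to tuples in a chart of \<open>A\<close>. A chart of \<open>B\<close> around the image
  of the first point exists after an epimorphism \<open>e\<close>; it receives the image of the whole tuple by
  \<open>transport_neighbours\<close>, and membership in \<open>T\<close> descends along \<open>e\<close>.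
\<close>

lemma maps_preserve_kth_order:
  assumes k: "k \<ge> 1" and B: "formal_manifold m B"
    and S: "kth_order_structure k n I A S" and T: "kth_order_structure k m I B T"
    and f: "f \<in> hom (prd E I A) B"
  shows "space_i_morphism I A S f B T"
  unfolding kth_order_morphism_iff[OF S kth_order_i_structure[OF T] f] i_morphism_def
proof (intro allI ballI impI)
  note i = kth_order_i_structure[OF T]
  have ft: "src E f = prd E I A" "tgt E f = B" using f by (simp_all add: hom_iff)
  fix K w U q \<iota> \<phi> L u ys
  assume "w \<in> hom K I" and c: "chart n K U q \<iota> \<phi> A" and "u \<in> hom L K"
    and ys: "set ys \<subseteq> fibre U q u \<and> chart_rel k n \<phi> u ys"
  then have w: "src E w = K" "tgt E w = I" and u: "src E u = L" "tgt E u = K" by (simp_all add: hom_iff)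
  have ct: "src E \<iota> = U" "tgt E \<iota> = A" "src E \<phi> = U" "tgt E \<phi> = Rn n" "src E q = U"
    using c by (simp_all add: chart_def formally_open_def hom_iff)
  have yt: "\<forall>y\<in>set ys. src E y = L \<and> tgt E y = U" using ys u by (auto simp: fibre_iff)
  let ?xs = "map (\<lambda>y. f \<odot> \<langle>w \<odot> u, \<iota> \<odot> y\<rangle>) ys"
  have xt: "\<forall>x\<in>set ?xs. src E x = src E (w \<odot> u) \<and> tgt E x = B" using yt ct u w ft by simp
  have "family_rel B T (w \<odot> u) ?xs"
  proof (cases ys)
    case Nil
    then show ?thesis using i u w by (simp add: i_structure_def hom_iff)
  next
    case (Cons y0 ys')
    then have y0: "y0 \<in> set ys" "src E y0 = L" "tgt E y0 = U" using yt by auto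
    let ?b = "f \<odot> \<langle>w \<odot> u, \<iota> \<odot> y0\<rangle>"
    have bt: "src E ?b = L" "tgt E ?b = B" using y0 ct u w ft by simp_all
    obtain e J V r \<kappa> \<psi> z0 where e: "epic e" "src E e = J" "tgt E e = src E ?b"
      and d: "chart m J V r \<kappa> \<psi> B" and z0: "z0 \<in> fibre V r (ident E J)" "\<kappa> \<odot> z0 = ?b \<odot> e"
      by (rule formal_manifold_chart[OF B bt(2)])
    have eL: "tgt E e = L" using e(3) bt(1) by simp
    \<comment> \<open>The map \<open>f\<close>, given at stage \<open>I\<close>, restricted to the stage \<open>J\<close>.\<close>
    let ?F = "f \<odot> \<langle>(w \<odot> (u \<odot> e)) \<odot> prj1 E J A, prj2 E J A\<rangle>"
    have Ft: "src E ?F = prd E J A" "tgt E ?F = B" using ft w u e eL by simp_all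
    have Fe: "?F \<odot> \<langle>ident E J, \<iota> \<odot> (y \<odot> e)\<rangle> = f \<odot> \<langle>w \<odot> u, \<iota> \<odot> y\<rangle> \<odot> e" if "y \<in> set ys" for y
      using that yt ft w u e eL ct by simp
    have zf: "set (map (\<lambda>y. y \<odot> e) ys) \<subseteq> fibre U q (u \<odot> e)"
    proof
      fix z assume "z \<in> set (map (\<lambda>y. y \<odot> e) ys)"
      then obtain y where y: "y \<in> set ys" "z = y \<odot> e" by auto
      then have "q \<odot> y = u" using ys by (auto simp: fibre_iff)
      then have "q \<odot> (y \<odot> e) = u \<odot> e" using y yt eL ct assoc[of e y q] by simp
      then show "z \<in> fibre U q (u \<odot> e)" using y yt eL u by (simp add: fibre_iff)
    qed
    have zr: "chart_rel k n \<phi> (u \<odot> e) (map (\<lambda>y. y \<odot> e) ys)"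
      using ys yt ct u eL by (intro chart_rel_restrict) simp_all
    have ye: "y0 \<odot> e \<in> set (map (\<lambda>y. y \<odot> e) ys)" using y0 by simp
    have z0e: "\<kappa> \<odot> z0 = ?F \<odot> \<langle>ident E J, \<iota> \<odot> (y0 \<odot> e)\<rangle>"
      unfolding z0(2) Fe[OF y0(1)] using y0 ct u w ft eL by simp
    have ue: "src E (u \<odot> e) = J" "tgt E (u \<odot> e) = K" using u e eL by simp_all
    obtain zs where zs: "set zs \<subseteq> fibre V r (ident E J)" "chart_rel k m \<psi> (ident E J) zs"
      "map (\<lambda>z. \<kappa> \<odot> z) zs = map (\<lambda>y. ?F \<odot> \<langle>ident E J, \<iota> \<odot> y\<rangle>) (map (\<lambda>y. y \<odot> e) ys)"
      by (rule transport_neighbours[OF k c ue zf zr ye d src_ident tgt_ident Ft z0(1) z0e])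
    have "family_rel B T ((w \<odot> (u \<odot> e)) \<odot> ident E J) (map (\<lambda>z. \<kappa> \<odot> z) zs)"
      using u w e eL by (intro kth_order_contains_charts[OF T _ _ d _ zs(1,2)]) simp_all
    moreover have "map (\<lambda>z. \<kappa> \<odot> z) zs = map (\<lambda>x. x \<odot> e) ?xs"
      unfolding zs(3) using yt ft w u e eL ct by simp
    ultimately have "family_rel B T ((w \<odot> u) \<odot> e) (map (\<lambda>x. x \<odot> e) ?xs)"
      using u w e eL by simp
    then show ?thesis
      using u w eL by (intro family_rel_descent[OF i_structure_hom[OF i] _ xt e(1)]) simp_all
  qed
  then show "family_rel B (\<lambda>p. T p \<odot> w) u ?xs"
    using family_rel_restrict_index[OF i_structure_hom[OF i] w(2), of u] u w by simp
qed

end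

theorem theorem3:
  fixes E :: "('o, 'm) sdg" and k :: nat
  assumes "sdg_model E" and "k \<ge> 1"
  shows
    "(\<forall>n A. sdg_ops.formal_manifold E n A \<longrightarrow>
        (\<forall>I. \<exists>!S. sdg_ops.kth_order_structure E k n I A S)) \<and>
     (\<forall>n A m B. sdg_ops.formal_manifold E n A \<longrightarrow> sdg_ops.formal_manifold E m B \<longrightarrow>
        (\<forall>I S T. \<forall>f \<in> topos_ops.hom E (prd E I A) B.
           sdg_ops.kth_order_structure E k n I A S \<longrightarrow>
           sdg_ops.kth_order_structure E k m I B T \<longrightarrow>
           sdg_ops.space_i_morphism E I A S f B T))"
proof -
  interpret sdg_model E by (rule assms(1))
  show ?thesis
    using kth_order_exists[OF assms(2)] kth_order_unique maps_preserve_kth_order[OF assms(2)] by blast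
qed

end
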